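(* Let $\mathbb{K}$ be an arbitrary field and let $n\geq 5$. Let $X$ be either the Temperley--Lieb monoid $TL_n$ or the truncated Temperley--Lieb monoid $TL_n^{\leq k}$ with $3\leq k<n$, $k\equiv n \bmod 2$. For every integer $l\geq 0$ with $l\equiv n\bmod 2$ and $l\leq n$ (if $X=TL_n$), respectively $l\leq k$ (if $X=TL_n^{\leq k}$), let $m(l)$ be the dimension over $\mathbb{K}$ of the simple $X$-representation $L_l$. Then $$\mathrm{gap}_{\mathbb{K}}(TL_n)=\min\{m(l)\mid l\notin\{0,1,n\}\},$$ $$\mathrm{gap}_{\mathbb{K}}(TL_n^{\leq k})=\min\{m(l)\mid l\notin\{0,1,k+1,k+2,\dots,n\}\},$$ where in both formulas $l$ ranges over the integers $0\leq l\leq n$ with $l\equiv n\bmod 2$.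
   Context: Temperley--Lieb monoid: $TL_n$ is the finite monoid of crossingless (planar) perfect matchings of $n$ bottom and $n$ top points of a strip, up to isotopy. The product $ab$ is obtained by stacking $a$ on top of $b$ and deleting all closed circles. A through strand is a strand joining a bottom point to a top point; the number of through strands has the parity of $n$. Let $J_l\subset TL_n$ be the set of diagrams with exactly $l$ through strands. For $k<n$, $k\equiv n \bmod 2$, $TL_n^{\leq k}=\{1\}\cup\bigcup_{l\leq k}J_l$ is the submonoid of diagrams with at most $k$ through strands together with the identity. Representations are finite-dimensional left representations over $\mathbb{K}$. For a finite monoid $S$ with group of units $G$: two-sided cells ($J$-cells) are the equivalence classes of the preorder $a\leq_{lr}b\Leftrightarrow b\in SaS$. The apex of a simple representation $M$ is the unique $\leq_{lr}$-maximal $J$-cell $J$ with $J\cap\{s\in S\mid sM=0\}=\emptyset$. The sets $J_l$ (and $\{1\}$) are the $J$-cells of $TL_n$, resp. $TL_n^{\leq k}$, and each is the apex of exactly one simple representation up to isomorphism; $L_l$ denotes the simple representation of apex $J_l$. Trivial representations: $1_b\colon S\to\mathbb{K}$ sends $s$ to $1$ if $s\in G$ and to $0$ otherwise; $1_t\colon S\to \mathbb{K}$ sends every $s$ to $1$. Representation gap: $(S,\mathbb{K})$ is $m$-trivial if every representation $M$ with $\dim_{\mathbb{K}}M\leq m$ is isomorphic to a direct sum of $\dim_{\mathbb{K}} M$ representations each of which is $1_b$ or $1_t$. If $S$ is neither the one-element monoid nor the two-element monoid $\{1,a\}$ with $aa=a$, then $\mathrm{gap}_{\mathbb{K}}(S)$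 is the maximal $m$ such that $(S,\mathbb{K})$ is $(m-1)$-trivial; for these two exceptional monoids the gap is $0$ by convention. *)

theory Defs
  imports
    "HOL-Algebra.Group"
    "HOL-Library.Disjoint_Sets"
    "HOL-Number_Theory.Cong"
    "Jordan_Normal_Form.VS_Connect"
begin

section \<open>Representations of monoids\<close>

text \<open>
  A finite-dimensional left representation of a monoid over a field \<open>'k\<close> is given by its
  dimension \<open>d\<close> and a unital homomorphism to the monoid of \<open>d \<times> d\<close> matrices; the underlying
  space is \<open>carrier_vec d\<close>, on which matrices act from the left.
\<close>

definition representation ::
    "('a, 'b) monoid_scheme \<Rightarrow> nat \<Rightarrow> ('a \<Rightarrow> 'k::field mat) \<Rightarrow> bool" where
  "representation S d \<rho> \<longleftrightarrow>
     (\<forall>s\<in>carrier S. \<rho> s \<in> carrier_mat d d) \<and>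
     \<rho> \<one>\<^bsub>S\<^esub> = 1\<^sub>m d \<and>
     (\<forall>s\<in>carrier S. \<forall>t\<in>carrier S. \<rho> (s \<otimes>\<^bsub>S\<^esub> t) = \<rho> s * \<rho> t)"

definition rep_isomorphic ::
    "('a, 'b) monoid_scheme \<Rightarrow> nat \<Rightarrow> ('a \<Rightarrow> 'k::field mat) \<Rightarrow> ('a \<Rightarrow> 'k mat) \<Rightarrow> bool" where
  "rep_isomorphic S d \<rho> \<sigma> \<longleftrightarrow>
     (\<exists>P\<in>carrier_mat d d. invertible_mat P \<and> (\<forall>s\<in>carrier S. P * \<rho> s = \<sigma> s * P))"

definition direct_sum_rep :: "('a \<Rightarrow> 'k::field mat) list \<Rightarrow> 'a \<Rightarrow> 'k mat" where
  "direct_sum_rep \<sigma>s s = diag_block_mat (map (\<lambda>\<sigma>. \<sigma> s) \<sigma>s)"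

definition invariant_subspace ::
    "('a, 'b) monoid_scheme \<Rightarrow> nat \<Rightarrow> ('a \<Rightarrow> 'k::field mat) \<Rightarrow> 'k vec set \<Rightarrow> bool" where
  "invariant_subspace S d \<rho> W \<longleftrightarrow>
     VectorSpace.subspace class_ring W (module_vec TYPE('k) d) \<and>
     (\<forall>s\<in>carrier S. \<forall>w\<in>W. \<rho> s *\<^sub>v w \<in> W)"

definition simple_rep ::
    "('a, 'b) monoid_scheme \<Rightarrow> nat \<Rightarrow> ('a \<Rightarrow> 'k::field mat) \<Rightarrow> bool" where
  "simple_rep S d \<rho> \<longleftrightarrow>
     representation S d \<rho> \<and> 0 < d \<and>
     (\<forall>W. invariant_subspace S d \<rho> W \<longrightarrow> W = {0\<^sub>v d} \<or> W = carrier_vec d)"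

definition triv_b :: "('a, 'b) monoid_scheme \<Rightarrow> 'a \<Rightarrow> 'k::field mat" where
  "triv_b S s = (if s \<in> Units S then 1\<^sub>m 1 else 0\<^sub>m 1 1)"

definition triv_t :: "'a \<Rightarrow> 'k::field mat" where
  "triv_t s = 1\<^sub>m 1"

section \<open>Cells and apexes\<close>

text \<open>In this order the cells with few through strands are the large ones.\<close>

definition lr_le :: "('a, 'b) monoid_scheme \<Rightarrow> 'a \<Rightarrow> 'a \<Rightarrow> bool" where
  "lr_le S a b \<longleftrightarrow> (\<exists>x\<in>carrier S. \<exists>y\<in>carrier S. b = x \<otimes>\<^bsub>S\<^esub> a \<otimes>\<^bsub>S\<^esub> y)"

definition J_cells :: "('a, 'b) monoid_scheme \<Rightarrow> 'a set set" where
  "J_cells S =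
     carrier S // {(a, b). a \<in> carrier S \<and> b \<in> carrier S \<and> lr_le S a b \<and> lr_le S b a}"

definition cell_le :: "('a, 'b) monoid_scheme \<Rightarrow> 'a set \<Rightarrow> 'a set \<Rightarrow> bool" where
  "cell_le S J J' \<longleftrightarrow> (\<exists>a\<in>J. \<exists>b\<in>J'. lr_le S a b)"

definition annihilator ::
    "('a, 'b) monoid_scheme \<Rightarrow> nat \<Rightarrow> ('a \<Rightarrow> 'k::field mat) \<Rightarrow> 'a set" where
  "annihilator S d \<rho> = {s \<in> carrier S. \<rho> s = 0\<^sub>m d d}"

definition maximal_unannihilated ::
    "('a, 'b) monoid_scheme \<Rightarrow> nat \<Rightarrow> ('a \<Rightarrow> 'k::field mat) \<Rightarrow> 'a set \<Rightarrow> bool" where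
  "maximal_unannihilated S d \<rho> J \<longleftrightarrow>
     J \<in> J_cells S \<and> J \<inter> annihilator S d \<rho> = {} \<and>
     (\<forall>J'\<in>J_cells S. J' \<inter> annihilator S d \<rho> = {} \<and> cell_le S J J' \<longrightarrow> J' = J)"

definition is_apex ::
    "('a, 'b) monoid_scheme \<Rightarrow> nat \<Rightarrow> ('a \<Rightarrow> 'k::field mat) \<Rightarrow> 'a set \<Rightarrow> bool" where
  "is_apex S d \<rho> J \<longleftrightarrow>
     maximal_unannihilated S d \<rho> J \<and>
     (\<forall>J'. maximal_unannihilated S d \<rho> J' \<longrightarrow> J' = J)"

text \<open>
  The dimension of the simple representation of apex \<open>J\<close>. It is only meaningful if such a
  representation exists and all of them have the same dimension.
\<close>

definition simple_dim :: "'k::field itself \<Rightarrow> ('a, 'b) monoid_scheme \<Rightarrow> 'a set \<Rightarrow> nat" where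
  "simple_dim K S J =
     (THE d. \<exists>\<rho> :: 'a \<Rightarrow> 'k mat. simple_rep S d \<rho> \<and> is_apex S d \<rho> J)"

section \<open>The representation gap\<close>

definition m_trivial :: "'k::field itself \<Rightarrow> ('a, 'b) monoid_scheme \<Rightarrow> nat \<Rightarrow> bool" where
  "m_trivial K S m \<longleftrightarrow>
     (\<forall>d \<le> m. \<forall>\<rho> :: 'a \<Rightarrow> 'k mat. representation S d \<rho> \<longrightarrow>
        (\<exists>\<sigma>s. length \<sigma>s = d \<and> set \<sigma>s \<subseteq> {triv_b S, triv_t} \<and>
              rep_isomorphic S d \<rho> (direct_sum_rep \<sigma>s)))"

definition exceptional_monoid :: "('a, 'b) monoid_scheme \<Rightarrow> bool" where
  "exceptional_monoid S \<longleftrightarrow>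
     carrier S = {\<one>\<^bsub>S\<^esub>} \<or>
     (\<exists>a. a \<noteq> \<one>\<^bsub>S\<^esub> \<and> carrier S = {\<one>\<^bsub>S\<^esub>, a} \<and> a \<otimes>\<^bsub>S\<^esub> a = a)"

definition rep_gap :: "'k::field itself \<Rightarrow> ('a, 'b) monoid_scheme \<Rightarrow> nat" where
  "rep_gap K S =
     (if exceptional_monoid S then 0
      else (GREATEST m. 0 < m \<and> m_trivial K S (m - 1)))"

section \<open>The Temperley--Lieb monoid\<close>

datatype level = Bottom | Middle | Top

text \<open>
  A point \<open>(v, i)\<close> is the \<open>i\<close>-th point from the left on level \<open>v\<close>. Diagrams live on the levels
  \<^const>\<open>Bottom\<close> and \<^const>\<open>Top\<close>; the level \<^const>\<open>Middle\<close> is only used for stacking. A diagram is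
  the set of its strands, a strand being the set of its two endpoints.
\<close>

type_synonym point = "level \<times> nat"
type_synonym diagram = "point set set"

definition points :: "nat \<Rightarrow> point set" where
  "points n = {Bottom, Top} \<times> {..<n}"

text \<open>
  The position of a point when going once around the boundary of the strip: the bottom from left
  to right, then the top from right to left. A matching can be drawn without crossings in the strip
  iff no two of its strands interlace with respect to this order.
\<close>

fun boundary_pos :: "nat \<Rightarrow> point \<Rightarrow> nat" where
  "boundary_pos n (v, i) = (if v = Bottom then i else 2 * n - 1 - i)"

definition crossingless :: "nat \<Rightarrow> diagram \<Rightarrow> bool" where
  "crossingless n D \<longleftrightarrow>
     \<not> (\<exists>p q r s. {p, r} \<in> D \<and> {q, s} \<in> D \<and>
          boundary_pos n p < boundary_pos n q \<and>
          boundary_pos n q < boundary_pos n r \<and>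
          boundary_pos n r < boundary_pos n s)"

definition tl_diagrams :: "nat \<Rightarrow> diagram set" where
  "tl_diagrams n =
     {D. partition_on (points n) D \<and> (\<forall>e\<in>D. card e = 2) \<and> crossingless n D}"

definition tl_one :: "nat \<Rightarrow> diagram" where
  "tl_one n = {{(Bottom, i), (Top, i)} | i. i < n}"

definition move_level :: "level \<Rightarrow> level \<Rightarrow> point \<Rightarrow> point" where
  "move_level u v = (\<lambda>(w, i). (if w = u then v else w, i))"

definition stack :: "diagram \<Rightarrow> diagram \<Rightarrow> diagram" where
  "stack a b = (`) (move_level Bottom Middle) ` a \<union> (`) (move_level Top Middle) ` b"

text \<open>
  The product joins two outer points if they are connected in the stacked diagram, in which \<open>a\<close> is on
  top; components not meeting the outer points, that is closed circles, disappear.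
\<close>

definition tl_mult :: "nat \<Rightarrow> diagram \<Rightarrow> diagram \<Rightarrow> diagram" where
  "tl_mult n a b =
     {{p, q} | p q. p \<in> points n \<and> q \<in> points n \<and> p \<noteq> q \<and>
                    (p, q) \<in> {(x, y). {x, y} \<in> stack a b}\<^sup>*}"

definition TL :: "nat \<Rightarrow> diagram monoid" where
  "TL n = \<lparr>carrier = tl_diagrams n, mult = tl_mult n, one = tl_one n\<rparr>"

definition through_strands :: "diagram \<Rightarrow> point set set" where
  "through_strands D = {e \<in> D. \<exists>i j. e = {(Bottom, i), (Top, j)}}"

definition TL_J :: "nat \<Rightarrow> nat \<Rightarrow> diagram set" where
  "TL_J n l = {D \<in> tl_diagrams n. card (through_strands D) = l}"

definition TL_trunc :: "nat \<Rightarrow> nat \<Rightarrow> diagram monoid" where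
  "TL_trunc n k = (TL n)\<lparr>carrier := {tl_one n} \<union> (\<Union>l\<le>k. TL_J n l)\<rparr>"

end

theory Submission
  imports Defs "Jordan_Normal_Form.Determinant"
begin

text \<open>
The theorem has a representation theoretic half, which concerns an abstract finite monoid, and a
combinatorial half, which verifies its hypotheses for planar diagrams.

If the cells of a finite monoid \<open>S\<close> form a chain and each of them contains an idempotent \<open>e\<close> such
that \<open>e s e\<close> is either \<open>e\<close> or lies in a strictly smaller ideal, then for a simple representation
\<open>M\<close> with that apex the space \<open>e M\<close> is a line. This determines \<open>M\<close>: a linear combination of the
vectors \<open>s v\<close>, with \<open>v\<close> spanning \<open>e M\<close>, vanishes iff \<open>e t\<close> kills it for every \<open>t\<close>, a
condition in which only the products \<open>e t s e\<close> occur (\<open>simple_rep_corner_dim_le\<close>). A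
representation of smallest dimension in which \<open>e\<close> is nonzero and the smaller ideal is zero is
simple (\<open>simple_rep_corner_exists\<close>). So every cell is the apex of simple representations of
exactly one dimension; for the cell \<open>{1}\<close> and for the minimal ideal they are the two trivial ones.

Let \<open>D\<close> be the smallest dimension that occurs for the other cells. In a simple representation of
dimension \<open>D\<close> whose apex is one of these cells, some nonunit acts by zero and some nonunit does
not, whereas in a sum of trivial representations all nonunits act alike. Hence the gap is at most
\<open>D\<close>. Conversely all composition factors of a representation of smaller dimension are trivial,
and it remains to split extensions of trivial representations. An extension is given by a block
\<open>B\<close> with \<open>B(s t) = A B(t) + B(s) C\<close>, where \<open>A\<close> and \<open>C\<close> are constant diagonal matrices with
entries 0 and 1 on the nonunits. Every entry of \<open>B\<close> is then constant on the nonunits: if the two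
diagonal entries differ, then it is invariant under multiplication by nonunits from one side, and
the nonunits are connected under such multiplications; if they agree, then it vanishes
(\<open>cocycle_const\<close>). A constant block is removed by a change of basis
(\<open>trivial_extension_splits\<close>).

For diagrams, closure of planarity under stacking is obtained by contracting the points of the
middle line one pair at a time; the two points of a pair are adjacent on the boundary, so no
crossing can arise (\<open>contract_middle\<close>). A diagram is determined by its two sides, which are half
diagrams, that is systems of cups with exposed free points, and \<open>(T, M) (M, B) = (T, B)\<close> holds
(\<open>diag_mult\<close>). This yields the chain of cells. Connectedness reduces to the poset of nonempty
half diagrams with at most \<open>k\<close> free points. Two half diagrams without room for a further cup are
joined by steps that open one or two cups, creating three or four free points, and close them
differently (\<open>full_step\<close>). Here \<open>k \<ge> 3\<close> makes such steps possible, and \<open>n \<ge> 5\<close> ensures that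
a cup is left when they are carried out.
\<close>

section \<open>Linear algebra over a field\<close>

lemma subspace_vec_iff:
  "VectorSpace.subspace class_ring W (module_vec TYPE('k::field) d) \<longleftrightarrow>
     W \<subseteq> carrier_vec d \<and> 0\<^sub>v d \<in> W \<and> (\<forall>v\<in>W. \<forall>w\<in>W. v + w \<in> W) \<and> (\<forall>c. \<forall>w\<in>W. c \<cdot>\<^sub>v w \<in> W)"
  (is "?L \<longleftrightarrow> ?R")
proof
  assume ?L
  then have "submodule class_ring W (module_vec TYPE('k::field) d)"
    by (auto simp: VectorSpace.subspace_def)
  then show ?R
    by (auto simp: submodule_def module_vec_simps class_ring_simps)
next
  assume ?R
  then show ?L
    unfolding VectorSpace.subspace_def
    by (auto simp: submodule_def module_vec_simps class_ring_simps vec_vs vec_module)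
qed

lemma invariant_subspace_iff:
  "invariant_subspace S d (\<rho> :: 'a \<Rightarrow> 'k::field mat) W \<longleftrightarrow>
     W \<subseteq> carrier_vec d \<and> 0\<^sub>v d \<in> W \<and> (\<forall>v\<in>W. \<forall>w\<in>W. v + w \<in> W) \<and> (\<forall>c. \<forall>w\<in>W. c \<cdot>\<^sub>v w \<in> W)
     \<and> (\<forall>s\<in>carrier S. \<forall>w\<in>W. \<rho> s *\<^sub>v w \<in> W)"
  by (auto simp: invariant_subspace_def subspace_vec_iff)

lemma injective_imp_inverse:
  fixes P :: "'k::field mat"
  assumes P: "P \<in> carrier_mat d d"
    and inj: "\<And>v. v \<in> carrier_vec d \<Longrightarrow> P *\<^sub>v v = 0\<^sub>v d \<Longrightarrow> v = 0\<^sub>v d"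
  obtains Q where "Q \<in> carrier_mat d d" "P * Q = 1\<^sub>m d" "Q * P = 1\<^sub>m d"
proof -
  have "det P \<noteq> 0"
    using det_0_iff_vec_prod_zero_field[OF P] inj by blast
  from det_non_zero_imp_unit[OF P this, of "()"] show ?thesis
    using that by (auto simp: Units_def ring_mat_def)
qed

lemma invertible_matI:
  assumes "P \<in> carrier_mat d d" "Q \<in> carrier_mat d d" "P * Q = 1\<^sub>m d" "Q * P = 1\<^sub>m d"
  shows "invertible_mat P"
  using assms unfolding invertible_mat_def inverts_mat_def by auto

lemma invertible_matE:
  assumes "invertible_mat P" "P \<in> carrier_mat d d"
  obtains Q where "Q \<in> carrier_mat d d" "P * Q = 1\<^sub>m d" "Q * P = 1\<^sub>m d"
proof -
  from assms obtain Q where Q: "P * Q = 1\<^sub>m d" "Q * P = 1\<^sub>m (dim_row Q)"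
    unfolding invertible_mat_def inverts_mat_def by auto
  from arg_cong[OF Q(1), of dim_col] arg_cong[OF Q(2), of dim_col] assms(2)
  have "Q \<in> carrier_mat d d" by (auto intro: carrier_matI)
  with Q that show ?thesis by auto
qed

text \<open>
Padding with zero rows makes a wide matrix square and singular, so that it has a kernel vector.
\<close>

lemma injective_imp_dim_le:
  fixes M :: "'k::field mat"
  assumes M: "M \<in> carrier_mat d' d"
    and inj: "\<And>v. v \<in> carrier_vec d \<Longrightarrow> M *\<^sub>v v = 0\<^sub>v d' \<Longrightarrow> v = 0\<^sub>v d"
  shows "d \<le> d'"
proof (rule ccontr)
  assume "\<not> d \<le> d'"
  then have lt: "d' < d" by simp
  define A where "A = mat\<^sub>r d d (\<lambda>i. if i = d' then 0\<^sub>v d else (\<lambda>i. if i < d' then row M i else 0\<^sub>v d) i)"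
  have A: "A \<in> carrier_mat d d" unfolding A_def by auto
  have "det A = 0"
    unfolding A_def by (rule det_row_0[OF lt]) (use M in \<open>auto\<close>)
  then obtain v where v: "v \<in> carrier_vec d" "v \<noteq> 0\<^sub>v d" "A *\<^sub>v v = 0\<^sub>v d"
    using det_0_iff_vec_prod_zero_field[OF A] by blast
  have "M *\<^sub>v v = 0\<^sub>v d'"
  proof (rule eq_vecI)
    fix i assume i: "i < dim_vec (0\<^sub>v d' :: 'k vec)"
    have "row A i = row M i"
      using i lt M unfolding A_def by (subst row_mat_of_row_fun) auto
    moreover have "(A *\<^sub>v v) $ i = 0" using v(3) i lt by simp
    ultimately show "(M *\<^sub>v v) $ i = 0\<^sub>v d' $ i" using i lt A M by simp
  qed (use M in auto)
  with inj v show False by blast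
qed

text \<open>
A change of basis with as many leading columns in \<open>W\<close> as possible is adapted to \<open>W\<close>: a vector of
\<open>W\<close> with a nonzero later coordinate could be exchanged for a further column.
\<close>

lemma adapted_basis:
  fixes W :: "'k::field vec set"
  assumes W: "VectorSpace.subspace class_ring W (module_vec TYPE('k) d)"
  obtains P Q r where "P \<in> carrier_mat d d" "Q \<in> carrier_mat d d" "P * Q = 1\<^sub>m d" "Q * P = 1\<^sub>m d"
    "r \<le> d" "\<And>i. i < r \<Longrightarrow> col P i \<in> W" "\<And>w j. w \<in> W \<Longrightarrow> r \<le> j \<Longrightarrow> j < d \<Longrightarrow> (Q *\<^sub>v w) $ j = 0"
proof -
  define ok where "ok r \<longleftrightarrow> r \<le> d \<and> (\<exists>P Q. P \<in> carrier_mat d d \<and> Q \<in> carrier_mat d d \<and> P * Q = 1\<^sub>m d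
    \<and> Q * P = 1\<^sub>m d \<and> (\<forall>i<r. col P i \<in> W))" for r
  have ok0: "ok 0" unfolding ok_def by (auto intro!: exI[of _ "1\<^sub>m d"])
  have bound: "\<And>r. ok r \<Longrightarrow> r \<le> d" by (simp add: ok_def)
  define r where "r = (GREATEST r. ok r)"
  have okr: "ok r" unfolding r_def by (rule GreatestI_nat[where P = ok, OF ok0]) (rule bound)
  have max: "\<not> ok (Suc r)" using Greatest_le_nat[of ok "Suc r" d] bound by (auto simp: r_def)
  from okr obtain P Q where P: "P \<in> carrier_mat d d" and Q: "Q \<in> carrier_mat d d"
    and PQ: "P * Q = 1\<^sub>m d" and QP: "Q * P = 1\<^sub>m d" and cols: "\<And>i. i < r \<Longrightarrow> col P i \<in> W"
    and r: "r \<le> d" by (auto simp: ok_def)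
  have Wc: "W \<subseteq> carrier_vec d" using W by (simp add: subspace_vec_iff)
  have "(Q *\<^sub>v w) $ j = 0" if w: "w \<in> W" and j: "r \<le> j" "j < d" for w j
  proof (rule ccontr)
    assume nz: "(Q *\<^sub>v w) $ j \<noteq> 0"
    have wc: "w \<in> carrier_vec d" using w Wc by auto
    define c where "c = Q *\<^sub>v w"
    have c: "c \<in> carrier_vec d" using Q wc by (simp add: c_def)
    have Pc: "P *\<^sub>v c = w" using P Q PQ wc unfolding c_def
      by (metis assoc_mult_mat_vec one_mult_mat_vec)
    \<comment> \<open>exchange: the column \<open>r\<close> of \<open>P\<close> is moved to position \<open>j\<close> and replaced by \<open>w\<close>\<close>
    define E where "E = mat d d (\<lambda>(i, l). if l = r then c $ i else if l = j then of_bool (i = r) else of_bool (i = l))"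
    have E: "E \<in> carrier_mat d d" by (simp add: E_def)
    have Ev: "(E *\<^sub>v x) $ i = c $ i * x $ r + (if i = r then (if j = r then 0 else x $ j) else if i = j then 0 else x $ i)"
      if x: "x \<in> carrier_vec d" and i: "i < d" for x i
    proof -
      have "(E *\<^sub>v x) $ i = (\<Sum>l = 0..<d. E $$ (i, l) * x $ l)"
        using x i E by (simp add: scalar_prod_def)
      also have "\<dots> = (\<Sum>l = 0..<d. (if l = r then c $ i * x $ r else 0)
          + (if l = j then (if i = r \<and> j \<noteq> r then x $ j else 0) else 0)
          + (if l = i then (if i \<noteq> r \<and> i \<noteq> j then x $ i else 0) else 0))"
        by (rule sum.cong) (use i in \<open>auto simp: E_def\<close>)
      also have "\<dots> = c $ i * x $ r + (if i = r \<and> j \<noteq> r then x $ j else 0) + (if i \<noteq> r \<and> i \<noteq> j then x $ i else 0)"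
        using j i by (simp add: sum.distrib)
      finally show ?thesis by auto
    qed
    have injE: "x = 0\<^sub>v d" if x: "x \<in> carrier_vec d" and Ex: "E *\<^sub>v x = 0\<^sub>v d" for x
    proof -
      have ev: "c $ i * x $ r + (if i = r then (if j = r then 0 else x $ j) else if i = j then 0 else x $ i) = 0"
        if "i < d" for i using Ev[OF x that] Ex that by simp
      have xr: "x $ r = 0" using ev[OF j(2)] nz by (auto simp: c_def split: if_splits)
      have "x $ i = 0" if i: "i < d" for i
      proof (cases "i = j \<and> j \<noteq> r")
        case True then show ?thesis using ev[of r] j xr by auto
      next
        case False then show ?thesis using ev[OF i] xr by (auto split: if_splits)
      qed
      then show ?thesis using x by (intro eq_vecI) auto
    qed
    obtain F where F: "F \<in> carrier_mat d d" "E * F = 1\<^sub>m d" "F * E = 1\<^sub>m d"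
      using injective_imp_inverse[OF E injE] by blast
    have "(P * E) * (F * Q) = P * (E * F) * Q"
      using P Q E F(1) by (smt (verit) assoc_mult_mat mult_carrier_mat)
    then have i1: "(P * E) * (F * Q) = 1\<^sub>m d" using F(2) P PQ by simp
    have i2: "(F * Q) * (P * E) = 1\<^sub>m d"
      by (rule mat_mult_left_right_inverse[OF _ _ i1]) (use P E F Q in auto)
    have "col (P * E) i \<in> W" if i: "i < Suc r" for i
    proof (cases "i = r")
      case True
      have "col E r = c" using c j by (intro eq_vecI) (auto simp: E_def)
      then have "col (P * E) i = w" using True j Pc col_mult2[OF P E, of r] by simp
      then show ?thesis using w by simp
    next
      case False
      then have ir: "i < r" using i by simp
      have "col E i = unit_vec d i" using ir j by (intro eq_vecI) (auto simp: E_def unit_vec_def)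
      moreover have "P *\<^sub>v unit_vec d i = col P i" using P ir j
        by (intro eq_vecI) auto
      ultimately have "col (P * E) i = col P i" using ir j col_mult2[OF P E, of i] by simp
      then show ?thesis using cols ir by simp
    qed
    then have "ok (Suc r)"
      unfolding ok_def using j i1 i2 P E F Q by (intro conjI exI[of _ "P * E"] exI[of _ "F * Q"]) auto
    with max show False ..
  qed
  with that[OF P Q PQ QP r] cols show ?thesis by blast
qed

section \<open>Subrepresentations and quotients in block form\<close>

text \<open>
An induction over linear combinations of the unit vectors. With a relation that ignores its first
argument it shows that subspaces are closed under linear combinations; with a subspace of a direct
sum it shows that a linear map is contained in it.
\<close>

lemma additive_relation_matrix:
  fixes M :: "'k::field mat"
  assumes M: "M \<in> carrier_mat d' d" and x: "x \<in> carrier_vec d"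
    and zero: "R (0\<^sub>v d) (0\<^sub>v d')"
    and add: "\<And>x x' y y'. R x y \<Longrightarrow> R x' y' \<Longrightarrow> R (x + x') (y + y')"
    and smult: "\<And>c x y. R x y \<Longrightarrow> R (c \<cdot>\<^sub>v x) (c \<cdot>\<^sub>v y)"
    and cols: "\<And>i. i < d \<Longrightarrow> R (unit_vec d i) (col M i)"
  shows "R x (M *\<^sub>v x)"
proof -
  define t where "t m = vec d (\<lambda>i. if i < m then x $ i else 0)" for m
  have "R (t m) (M *\<^sub>v t m)" if "m \<le> d" for m
    using that
  proof (induction m)
    case 0
    have "t 0 = 0\<^sub>v d" by (intro eq_vecI) (auto simp: t_def)
    moreover have "M *\<^sub>v 0\<^sub>v d = 0\<^sub>v d'" using M by (intro eq_vecI) auto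
    ultimately show ?case using zero by simp
  next
    case (Suc m)
    have t: "t (Suc m) = t m + x $ m \<cdot>\<^sub>v unit_vec d m"
      using Suc.prems by (intro eq_vecI) (auto simp: t_def unit_vec_def less_Suc_eq)
    have tc: "t m \<in> carrier_vec d" by (simp add: t_def)
    have "M *\<^sub>v unit_vec d m = col M m" using M Suc.prems by (intro eq_vecI) auto
    then have "M *\<^sub>v t (Suc m) = M *\<^sub>v t m + x $ m \<cdot>\<^sub>v col M m"
      using M tc by (simp add: t mult_add_distrib_mat_vec[OF M] mult_mat_vec[OF M])
    then show ?case
      unfolding t using add[OF Suc.IH smult[OF cols]] Suc.prems by (simp add: t)
  qed
  moreover have "t d = x" using x by (intro eq_vecI) (auto simp: t_def)
  ultimately show ?thesis by fastforce
qed

lemma representationD: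
  assumes "representation S d \<rho>"
  shows "s \<in> carrier S \<Longrightarrow> \<rho> s \<in> carrier_mat d d" "\<rho> \<one>\<^bsub>S\<^esub> = 1\<^sub>m d"
    "s \<in> carrier S \<Longrightarrow> t \<in> carrier S \<Longrightarrow> \<rho> (s \<otimes>\<^bsub>S\<^esub> t) = \<rho> s * \<rho> t"
  using assms by (auto simp: representation_def)

lemma rep_vec_mult:
  assumes "representation S d \<rho>" "s \<in> carrier S" "t \<in> carrier S" "v \<in> carrier_vec d"
  shows "\<rho> (s \<otimes>\<^bsub>S\<^esub> t) *\<^sub>v v = \<rho> s *\<^sub>v (\<rho> t *\<^sub>v v)"
  using representationD(1,3)[OF assms(1)] assms assoc_mult_mat_vec[of "\<rho> s" d d "\<rho> t" d v] by auto

lemma four_block_mat_inject: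
  assumes dims: "A \<in> carrier_mat r r'" "B \<in> carrier_mat r q'" "C \<in> carrier_mat q r'" "D \<in> carrier_mat q q'"
    "A' \<in> carrier_mat r r'" "B' \<in> carrier_mat r q'" "C' \<in> carrier_mat q r'" "D' \<in> carrier_mat q q'"
    and eq: "four_block_mat A B C D = four_block_mat A' B' C' D'"
  shows "A = A'" "B = B'" "C = C'" "D = D'"
proof -
  have e: "four_block_mat A B C D $$ (i, j) = four_block_mat A' B' C' D' $$ (i, j)" for i j
    using eq by simp
  show "A = A'"
  proof (rule eq_matI)
    fix i j assume "i < dim_row A'" "j < dim_col A'"
    then show "A $$ (i, j) = A' $$ (i, j)" using e[of i j] dims by auto
  qed (use dims in auto)
  show "B = B'"
  proof (rule eq_matI)
    fix i j assume "i < dim_row B'" "j < dim_col B'"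
    then show "B $$ (i, j) = B' $$ (i, j)" using e[of i "j + r'"] dims by auto
  qed (use dims in auto)
  show "C = C'"
  proof (rule eq_matI)
    fix i j assume "i < dim_row C'" "j < dim_col C'"
    then show "C $$ (i, j) = C' $$ (i, j)" using e[of "i + r" j] dims by auto
  qed (use dims in auto)
  show "D = D'"
  proof (rule eq_matI)
    fix i j assume "i < dim_row D'" "j < dim_col D'"
    then show "D $$ (i, j) = D' $$ (i, j)" using e[of "i + r" "j + r'"] dims by auto
  qed (use dims in auto)
qed

lemma four_block_upper_mult:
  fixes A :: "'k::field mat"
  assumes "A \<in> carrier_mat r r" "B \<in> carrier_mat r q" "C \<in> carrier_mat q q"
    "A' \<in> carrier_mat r r" "B' \<in> carrier_mat r q" "C' \<in> carrier_mat q q"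
  shows "four_block_mat A B (0\<^sub>m q r) C * four_block_mat A' B' (0\<^sub>m q r) C'
    = four_block_mat (A * A') (A * B' + B * C') (0\<^sub>m q r) (C * C')"
  using assms
  by (subst mult_four_block_mat[of _ r r _ q _ q _ _ r _ q]) auto

lemma conj_mult:
  fixes A :: "'k::field mat"
  assumes "P \<in> carrier_mat d d" "Q \<in> carrier_mat d d" "P * Q = 1\<^sub>m d"
    "A \<in> carrier_mat d d" "B \<in> carrier_mat d d"
  shows "(Q * A * P) * (Q * B * P) = Q * (A * B) * P"
proof -
  have "(Q * A * P) * (Q * B * P) = Q * A * (P * Q) * (B * P)"
    using assms(1,2,4,5) by (smt (verit) assoc_mult_mat mult_carrier_mat)
  also have "\<dots> = Q * (A * B) * P"
    using assms by (smt (verit) assoc_mult_mat mult_carrier_mat right_mult_one_mat)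
  finally show ?thesis .
qed

lemma representation_conj:
  assumes "monoid S" and \<rho>: "representation S d (\<rho> :: 'a \<Rightarrow> 'k::field mat)"
    and P: "P \<in> carrier_mat d d" "Q \<in> carrier_mat d d" "P * Q = 1\<^sub>m d" "Q * P = 1\<^sub>m d"
  shows "representation S d (\<lambda>s. Q * \<rho> s * P)"
  unfolding representation_def
  using representationD[OF \<rho>] P by (auto simp: conj_mult[OF P(1-3)] simp del: assoc_mult_mat)

lemma block_form_representations:
  assumes S: "monoid S" and R: "representation S (r + q) (R :: 'a \<Rightarrow> 'k::field mat)"
    and dims: "\<And>s. s \<in> carrier S \<Longrightarrow> A s \<in> carrier_mat r r" "\<And>s. s \<in> carrier S \<Longrightarrow> B s \<in> carrier_mat r q"
      "\<And>s. s \<in> carrier S \<Longrightarrow> C s \<in> carrier_mat q q"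
    and block: "\<And>s. s \<in> carrier S \<Longrightarrow> R s = four_block_mat (A s) (B s) (0\<^sub>m q r) (C s)"
  shows "representation S r A" "representation S q C"
    "\<And>s t. s \<in> carrier S \<Longrightarrow> t \<in> carrier S \<Longrightarrow> B (s \<otimes>\<^bsub>S\<^esub> t) = A s * B t + B s * C t"
proof -
  interpret monoid S by fact
  have one: "A \<one>\<^bsub>S\<^esub> = 1\<^sub>m r" "C \<one>\<^bsub>S\<^esub> = 1\<^sub>m q"
  proof -
    have "four_block_mat (A \<one>\<^bsub>S\<^esub>) (B \<one>\<^bsub>S\<^esub>) (0\<^sub>m q r) (C \<one>\<^bsub>S\<^esub>) =
        four_block_mat (1\<^sub>m r) (0\<^sub>m r q) (0\<^sub>m q r) (1\<^sub>m q)"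
      using block[of "\<one>\<^bsub>S\<^esub>"] representationD(2)[OF R] by simp
    from four_block_mat_inject[OF _ _ _ _ _ _ _ _ this, of r r q q] dims[OF one_closed]
    show "A \<one>\<^bsub>S\<^esub> = 1\<^sub>m r" "C \<one>\<^bsub>S\<^esub> = 1\<^sub>m q" by auto
  qed
  have mult: "A (s \<otimes>\<^bsub>S\<^esub> t) = A s * A t" "C (s \<otimes>\<^bsub>S\<^esub> t) = C s * C t"
      "B (s \<otimes>\<^bsub>S\<^esub> t) = A s * B t + B s * C t"
    if s: "s \<in> carrier S" and t: "t \<in> carrier S" for s t
  proof -
    have st: "s \<otimes>\<^bsub>S\<^esub> t \<in> carrier S" using s t by simp
    have "four_block_mat (A (s \<otimes>\<^bsub>S\<^esub> t)) (B (s \<otimes>\<^bsub>S\<^esub> t)) (0\<^sub>m q r) (C (s \<otimes>\<^bsub>S\<^esub> t)) =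
        four_block_mat (A s * A t) (A s * B t + B s * C t) (0\<^sub>m q r) (C s * C t)"
      using block[OF st] block[OF s] block[OF t] representationD(3)[OF R s t]
        four_block_upper_mult[OF dims[OF s] dims[OF t]] by simp
    from four_block_mat_inject[OF _ _ _ _ _ _ _ _ this, of r r q q] dims[OF st] dims[OF s] dims[OF t]
    show "A (s \<otimes>\<^bsub>S\<^esub> t) = A s * A t" "C (s \<otimes>\<^bsub>S\<^esub> t) = C s * C t"
      "B (s \<otimes>\<^bsub>S\<^esub> t) = A s * B t + B s * C t" by auto
  qed
  show "representation S r A" "representation S q C"
    unfolding representation_def using dims one mult by auto
  show "\<And>s t. s \<in> carrier S \<Longrightarrow> t \<in> carrier S \<Longrightarrow> B (s \<otimes>\<^bsub>S\<^esub> t) = A s * B t + B s * C t"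
    by (rule mult(3))
qed

lemma reducible_block_form:
  assumes S: "monoid S" and \<rho>: "representation S d (\<rho> :: 'a \<Rightarrow> 'k::field mat)"
    and W: "invariant_subspace S d \<rho> W" "W \<noteq> {0\<^sub>v d}" "W \<noteq> carrier_vec d"
  obtains r q P Q A B C where "d = r + q" "0 < r" "0 < q"
    "P \<in> carrier_mat d d" "Q \<in> carrier_mat d d" "P * Q = 1\<^sub>m d" "Q * P = 1\<^sub>m d"
    "\<And>s. s \<in> carrier S \<Longrightarrow> A s \<in> carrier_mat r r" "\<And>s. s \<in> carrier S \<Longrightarrow> B s \<in> carrier_mat r q"
    "\<And>s. s \<in> carrier S \<Longrightarrow> C s \<in> carrier_mat q q"
    "\<And>s. s \<in> carrier S \<Longrightarrow> Q * \<rho> s * P = four_block_mat (A s) (B s) (0\<^sub>m q r) (C s)"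
    "representation S r A" "representation S q C"
proof -
  have Wi: "W \<subseteq> carrier_vec d" "0\<^sub>v d \<in> W" "\<And>v w. v \<in> W \<Longrightarrow> w \<in> W \<Longrightarrow> v + w \<in> W"
    "\<And>c w. w \<in> W \<Longrightarrow> c \<cdot>\<^sub>v w \<in> W" "\<And>s w. s \<in> carrier S \<Longrightarrow> w \<in> W \<Longrightarrow> \<rho> s *\<^sub>v w \<in> W"
    using W(1) by (auto simp: invariant_subspace_iff)
  have "VectorSpace.subspace class_ring W (module_vec TYPE('k) d)"
    using W(1) by (simp add: invariant_subspace_def)
  then obtain P Q r where P: "P \<in> carrier_mat d d" "Q \<in> carrier_mat d d" "P * Q = 1\<^sub>m d" "Q * P = 1\<^sub>m d"
    and r: "r \<le> d" and cols: "\<And>i. i < r \<Longrightarrow> col P i \<in> W"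
    and coord: "\<And>w j. w \<in> W \<Longrightarrow> r \<le> j \<Longrightarrow> j < d \<Longrightarrow> (Q *\<^sub>v w) $ j = 0"
    using adapted_basis[of W d] by blast
  have PQv: "P *\<^sub>v (Q *\<^sub>v v) = v" if "v \<in> carrier_vec d" for v
    using that P by (metis assoc_mult_mat_vec one_mult_mat_vec)
  have r0: "0 < r"
  proof (rule ccontr)
    assume "\<not> 0 < r"
    have "w = 0\<^sub>v d" if w: "w \<in> W" for w
    proof -
      have "Q *\<^sub>v w = 0\<^sub>v d" using coord[OF w] \<open>\<not> 0 < r\<close> P(2) by (intro eq_vecI) auto
      moreover have "P *\<^sub>v 0\<^sub>v d = 0\<^sub>v d" using P(1) by (intro eq_vecI) auto
      ultimately show ?thesis using PQv[of w] w Wi(1) by auto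
    qed
    with Wi(2) W(2) show False by blast
  qed
  have rd: "r < d"
  proof (rule ccontr)
    assume "\<not> r < d"
    then have rd: "r = d" using r by simp
    have "v \<in> W" if v: "v \<in> carrier_vec d" for v
    proof -
      have "P *\<^sub>v (Q *\<^sub>v v) \<in> W"
        by (rule additive_relation_matrix[where R = "\<lambda>_ y. y \<in> W", OF P(1)])
          (use P v Wi cols rd in auto)
      then show ?thesis using PQv[OF v] by simp
    qed
    with Wi(1) W(3) show False by blast
  qed
  define q where "q = d - r"
  have d: "d = r + q" "0 < q" using rd by (auto simp: q_def)
  define R where "R = (\<lambda>s. Q * \<rho> s * P)"
  define A where "A s = mat r r (\<lambda>(i, j). R s $$ (i, j))" for s
  define B where "B s = mat r q (\<lambda>(i, j). R s $$ (i, j + r))" for s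
  define C where "C s = mat q q (\<lambda>(i, j). R s $$ (i + r, j + r))" for s
  have R: "representation S d R" unfolding R_def by (rule representation_conj[OF S \<rho> P])
  have zero: "R s $$ (i, j) = 0" if s: "s \<in> carrier S" and i: "r \<le> i" "i < d" and j: "j < r" for s i j
  proof -
    note rs = representationD(1)[OF \<rho> s]
    have "R s $$ (i, j) = col (R s) j $ i" using R s i j r representationD(1)[OF R s] by auto
    also have "col (R s) j = (Q * \<rho> s) *\<^sub>v col P j" unfolding R_def
      by (rule col_mult2[of _ d d _ d]) (use P rs j r in auto)
    also have "\<dots> = Q *\<^sub>v (\<rho> s *\<^sub>v col P j)"
      by (rule assoc_mult_mat_vec[of _ d d _ d]) (use P rs j r in auto)
    also have "\<dots> $ i = 0" by (rule coord[OF Wi(5)[OF s cols[OF j]] i])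
    finally show ?thesis .
  qed
  have blk: "R s = four_block_mat (A s) (B s) (0\<^sub>m q r) (C s)" if s: "s \<in> carrier S" for s
    using representationD(1)[OF R s] zero[OF s] d
    by (intro eq_matI) (auto simp: A_def B_def C_def)
  have car: "A s \<in> carrier_mat r r" "B s \<in> carrier_mat r q" "C s \<in> carrier_mat q q" for s
    by (auto simp: A_def B_def C_def)
  have R': "representation S (r + q) R" using R d by simp
  note reps = block_form_representations[OF S R' car blk]
  show ?thesis
    by (rule that[OF d(1) r0 d(2) P car _ reps(1,2)]) (use blk in \<open>auto simp: R_def\<close>)
qed

section \<open>Simple representations with a given apex\<close>

lemma zero_smult_carrier_vec: "w \<in> carrier_vec m \<Longrightarrow> (0::'k::field) \<cdot>\<^sub>v w = 0\<^sub>v m"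
  by (intro eq_vecI) auto

lemma mult_mat_zero_vec: "A \<in> carrier_mat m m' \<Longrightarrow> A *\<^sub>v 0\<^sub>v m' = (0\<^sub>v m :: 'k::field vec)"
  by (intro eq_vecI) auto

lemma nonzero_mat_unit_vec:
  assumes A: "A \<in> carrier_mat d d'" and "A \<noteq> (0\<^sub>m d d' :: 'k::field mat)"
  obtains i where "i < d'" "A *\<^sub>v unit_vec d' i \<noteq> 0\<^sub>v d"
proof -
  obtain i j where ij: "i < d" "j < d'" "A $$ (i, j) \<noteq> 0"
    using assms by (metis eq_matI carrier_matD index_zero_mat)
  then have "(A *\<^sub>v unit_vec d' j) $ i \<noteq> 0" using A by auto
  then have "A *\<^sub>v unit_vec d' j \<noteq> 0\<^sub>v d" using ij(1) by (metis index_zero_vec(1))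
  then show ?thesis using that ij by blast
qed

text \<open>
The subrepresentation of the direct sum of \<open>\<rho>\<close> and \<open>\<sigma>\<close> that is generated by \<open>(v, v')\<close>, as a
relation between the two summands. For simple \<open>\<rho>\<close> and \<open>\<sigma>\<close> with matching generators it is the
graph of an isomorphism.
\<close>

inductive cyclic_pair :: "('a, 'b) monoid_scheme \<Rightarrow> ('a \<Rightarrow> 'k::field mat) \<Rightarrow> 'k vec \<Rightarrow>
    ('a \<Rightarrow> 'k mat) \<Rightarrow> 'k vec \<Rightarrow> 'k vec \<Rightarrow> 'k vec \<Rightarrow> bool"
  for S \<rho> v \<sigma> v' where
  gen: "s \<in> carrier S \<Longrightarrow> cyclic_pair S \<rho> v \<sigma> v' (\<rho> s *\<^sub>v v) (\<sigma> s *\<^sub>v v')"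
| add: "cyclic_pair S \<rho> v \<sigma> v' w w' \<Longrightarrow> cyclic_pair S \<rho> v \<sigma> v' x x' \<Longrightarrow>
    cyclic_pair S \<rho> v \<sigma> v' (w + x) (w' + x')"
| smult: "cyclic_pair S \<rho> v \<sigma> v' w w' \<Longrightarrow> cyclic_pair S \<rho> v \<sigma> v' (c \<cdot>\<^sub>v w) (c \<cdot>\<^sub>v w')"

lemma
  assumes "cyclic_pair S \<rho> v \<sigma> v' w w'" and S: "monoid S"
    and \<rho>: "representation S d \<rho>" and \<sigma>: "representation S d' \<sigma>"
    and v: "v \<in> carrier_vec d" "v' \<in> carrier_vec d'"
  shows cyclic_pair_carrier: "w \<in> carrier_vec d \<and> w' \<in> carrier_vec d'"
    and cyclic_pair_act: "s \<in> carrier S \<Longrightarrow> cyclic_pair S \<rho> v \<sigma> v' (\<rho> s *\<^sub>v w) (\<sigma> s *\<^sub>v w')"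
proof -
  interpret monoid S by fact
  have "w \<in> carrier_vec d \<and> w' \<in> carrier_vec d' \<and>
      (\<forall>s\<in>carrier S. cyclic_pair S \<rho> v \<sigma> v' (\<rho> s *\<^sub>v w) (\<sigma> s *\<^sub>v w'))"
    using assms(1)
  proof induction
    case (gen t)
    have "cyclic_pair S \<rho> v \<sigma> v' (\<rho> s *\<^sub>v (\<rho> t *\<^sub>v v)) (\<sigma> s *\<^sub>v (\<sigma> t *\<^sub>v v'))"
      if "s \<in> carrier S" for s
      using cyclic_pair.gen[of "s \<otimes>\<^bsub>S\<^esub> t" S \<rho> v \<sigma> v'] gen that
        rep_vec_mult[OF \<rho> that gen v(1)] rep_vec_mult[OF \<sigma> that gen v(2)] by simp
    then show ?case
      using v mult_mat_vec_carrier[OF representationD(1)[OF \<rho> gen] v(1)]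
        mult_mat_vec_carrier[OF representationD(1)[OF \<sigma> gen] v(2)] by blast
  next
    case (add w w' x x')
    then show ?case
      using representationD(1)[OF \<rho>] representationD(1)[OF \<sigma>]
      by (auto simp: mult_add_distrib_mat_vec[of _ d d] mult_add_distrib_mat_vec[of _ d' d']
          intro!: cyclic_pair.add)
  next
    case (smult w w' c)
    then show ?case
      using representationD(1)[OF \<rho>] representationD(1)[OF \<sigma>]
      by (auto simp: mult_mat_vec[of _ d d] mult_mat_vec[of _ d' d']
          intro!: cyclic_pair.smult)
  qed
  then show "w \<in> carrier_vec d \<and> w' \<in> carrier_vec d'"
    "s \<in> carrier S \<Longrightarrow> cyclic_pair S \<rho> v \<sigma> v' (\<rho> s *\<^sub>v w) (\<sigma> s *\<^sub>v w')" by auto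
qed

text \<open>
The space \<open>e M\<close> is a line spanned by some \<open>v\<close>, and \<open>e t v\<close> is \<open>v\<close> or \<open>0\<close> depending on
\<open>e t e\<close> alone. So if \<open>w\<close> corresponds to \<open>w'\<close> under \<open>cyclic_pair\<close>, then \<open>e t w\<close> and \<open>e t w'\<close>
are the same multiple of the two generators. For \<open>w' = 0\<close> this puts \<open>w\<close> into the proper
subrepresentation of all vectors killed by every \<open>e t\<close>, hence \<open>w = 0\<close>, and the relation contains
an injective linear map.
\<close>

lemma simple_rep_corner_dim_le:
  fixes \<rho> \<sigma> :: "'a \<Rightarrow> 'k::field mat"
  assumes S: "monoid S" and e: "e \<in> carrier S" "e \<otimes>\<^bsub>S\<^esub> e = e"
    and corner: "\<And>s. s \<in> carrier S \<Longrightarrow> e \<otimes>\<^bsub>S\<^esub> s \<otimes>\<^bsub>S\<^esub> e = e \<or> e \<otimes>\<^bsub>S\<^esub> s \<otimes>\<^bsub>S\<^esub> e \<in> I"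
    and \<rho>: "simple_rep S d \<rho>" "\<rho> e \<noteq> 0\<^sub>m d d" "\<And>s. s \<in> I \<Longrightarrow> \<rho> s = 0\<^sub>m d d"
    and \<sigma>: "simple_rep S d' \<sigma>" "\<sigma> e \<noteq> 0\<^sub>m d' d'" "\<And>s. s \<in> I \<Longrightarrow> \<sigma> s = 0\<^sub>m d' d'"
  shows "d \<le> d'"
proof -
  interpret monoid S by fact
  have r: "representation S d \<rho>" "representation S d' \<sigma>" using \<rho>(1) \<sigma>(1) by (auto simp: simple_rep_def)
  define g :: "'a \<Rightarrow> 'k" where "g t = (if e \<otimes>\<^bsub>S\<^esub> t \<otimes>\<^bsub>S\<^esub> e = e then 1 else 0)" for t
  have gen: "\<exists>v. v \<in> carrier_vec m \<and> v \<noteq> 0\<^sub>v m \<and>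
      (\<forall>t\<in>carrier S. \<tau> e *\<^sub>v (\<tau> t *\<^sub>v v) = g t \<cdot>\<^sub>v v)"
    if t: "representation S m \<tau>" "\<tau> e \<noteq> 0\<^sub>m m m" "\<And>s. s \<in> I \<Longrightarrow> \<tau> s = 0\<^sub>m m m" for m and \<tau> :: "'a \<Rightarrow> 'k mat"
  proof -
    from nonzero_mat_unit_vec[OF representationD(1)[OF t(1) e(1)] t(2)]
    obtain i where i: "i < m" "\<tau> e *\<^sub>v unit_vec m i \<noteq> 0\<^sub>v m" .
    define u where "u = (unit_vec m i :: 'k vec)"
    have u: "u \<in> carrier_vec m" by (simp add: u_def)
    have te: "\<tau> e *\<^sub>v u \<in> carrier_vec m" using representationD(1)[OF t(1) e(1)] u by simp
    have "\<tau> e *\<^sub>v (\<tau> s *\<^sub>v (\<tau> e *\<^sub>v u)) = g s \<cdot>\<^sub>v (\<tau> e *\<^sub>v u)" if s: "s \<in> carrier S" for s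
    proof -
      have "\<tau> e *\<^sub>v (\<tau> s *\<^sub>v (\<tau> e *\<^sub>v u)) = \<tau> (e \<otimes>\<^bsub>S\<^esub> s \<otimes>\<^bsub>S\<^esub> e) *\<^sub>v u"
        using s e(1) u te by (simp add: rep_vec_mult[OF t(1)])
      also have "\<dots> = g s \<cdot>\<^sub>v (\<tau> e *\<^sub>v u)"
      proof (cases "e \<otimes>\<^bsub>S\<^esub> s \<otimes>\<^bsub>S\<^esub> e = e")
        case False
        then have "\<tau> (e \<otimes>\<^bsub>S\<^esub> s \<otimes>\<^bsub>S\<^esub> e) = 0\<^sub>m m m" using corner[OF s] t(3) by auto
        moreover have "0\<^sub>m m m *\<^sub>v u = 0\<^sub>v m" by (intro eq_vecI) (use u in auto)
        moreover have "(0::'k) \<cdot>\<^sub>v (\<tau> e *\<^sub>v u) = 0\<^sub>v m" by (rule zero_smult_carrier_vec[OF te])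
        ultimately show ?thesis using False by (simp add: g_def)
      qed (use te in \<open>simp add: g_def\<close>)
      finally show ?thesis .
    qed
    then show ?thesis using te i by (intro exI[of _ "\<tau> e *\<^sub>v u"]) (auto simp: u_def)
  qed
  obtain v where v: "v \<in> carrier_vec d" "v \<noteq> 0\<^sub>v d"
    and gv: "\<And>t. t \<in> carrier S \<Longrightarrow> \<rho> e *\<^sub>v (\<rho> t *\<^sub>v v) = g t \<cdot>\<^sub>v v"
    using gen[OF r(1) \<rho>(2,3)] by blast
  obtain v' where v': "v' \<in> carrier_vec d'" "v' \<noteq> 0\<^sub>v d'"
    and gv': "\<And>t. t \<in> carrier S \<Longrightarrow> \<sigma> e *\<^sub>v (\<sigma> t *\<^sub>v v') = g t \<cdot>\<^sub>v v'"
    using gen[OF r(2) \<sigma>(2,3)] by blast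
  let ?R = "cyclic_pair S \<rho> v \<sigma> v'"
  note rc = representationD(1)[OF r(1)] and sc = representationD(1)[OF r(2)]
  have Rc: "w \<in> carrier_vec d" "w' \<in> carrier_vec d'" if "?R w w'" for w w'
    using cyclic_pair_carrier[OF that S r v(1) v'(1)] by auto
  have Ract: "?R (\<rho> s *\<^sub>v w) (\<sigma> s *\<^sub>v w')" if "?R w w'" "s \<in> carrier S" for w w' s
    using cyclic_pair_act[OF that(1) S r v(1) v'(1) that(2)] .
  have R0: "?R (0\<^sub>v d) (0\<^sub>v d')"
  proof -
    have "?R (0 \<cdot>\<^sub>v (\<rho> \<one>\<^bsub>S\<^esub> *\<^sub>v v)) (0 \<cdot>\<^sub>v (\<sigma> \<one>\<^bsub>S\<^esub> *\<^sub>v v'))"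
      by (intro cyclic_pair.smult cyclic_pair.gen) simp
    then show ?thesis using v(1) v'(1) representationD(2)[OF r(1)] representationD(2)[OF r(2)]
      by (simp add: zero_smult_carrier_vec[of _ d] zero_smult_carrier_vec[of _ d'])
  qed
  have same: "\<exists>c. \<rho> e *\<^sub>v w = c \<cdot>\<^sub>v v \<and> \<sigma> e *\<^sub>v w' = c \<cdot>\<^sub>v v'" if "?R w w'" for w w'
    using that
  proof induction
    case (gen s) then show ?case using gv gv' by blast
  next
    case (add w w' x x')
    then obtain a b where "\<rho> e *\<^sub>v w = a \<cdot>\<^sub>v v" "\<sigma> e *\<^sub>v w' = a \<cdot>\<^sub>v v'"
      "\<rho> e *\<^sub>v x = b \<cdot>\<^sub>v v" "\<sigma> e *\<^sub>v x' = b \<cdot>\<^sub>v v'" by blast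
    then show ?case
      using Rc[OF add(1)] Rc[OF add(2)] rc[OF e(1)] sc[OF e(1)]
      by (intro exI[of _ "a + b"])
        (auto simp: mult_add_distrib_mat_vec[of _ d d] mult_add_distrib_mat_vec[of _ d' d'] add_smult_distrib_vec)
  next
    case (smult w w' c)
    then obtain a where "\<rho> e *\<^sub>v w = a \<cdot>\<^sub>v v" "\<sigma> e *\<^sub>v w' = a \<cdot>\<^sub>v v'" by blast
    then show ?case
      using Rc[OF smult(1)] rc[OF e(1)] sc[OF e(1)]
      by (intro exI[of _ "c * a"]) (auto simp: mult_mat_vec[of _ d d] mult_mat_vec[of _ d' d'] smult_smult_assoc)
  qed
  have kernel: "w = 0\<^sub>v d" if R: "?R w (0\<^sub>v d')" for w
  proof -
    \<comment> \<open>the largest subrepresentation on which \<open>e\<close> acts by zero\<close>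
    define N where "N = {x. x \<in> carrier_vec d \<and> (\<forall>t\<in>carrier S. \<rho> (e \<otimes>\<^bsub>S\<^esub> t) *\<^sub>v x = 0\<^sub>v d)}"
    have et: "\<rho> (e \<otimes>\<^bsub>S\<^esub> t) \<in> carrier_mat d d" if "t \<in> carrier S" for t
      using that e(1) rc by simp
    have "invariant_subspace S d \<rho> N"
      unfolding invariant_subspace_iff
    proof (intro conjI ballI allI)
      show "0\<^sub>v d \<in> N" using et by (auto simp: N_def mult_mat_zero_vec[of _ d d])
      show "x + y \<in> N" if "x \<in> N" "y \<in> N" for x y
        using that et by (auto simp: N_def mult_add_distrib_mat_vec[of _ d d])
      show "c \<cdot>\<^sub>v y \<in> N" if "y \<in> N" for c y
        using that et by (auto simp: N_def mult_mat_vec[of _ d d])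
      show "\<rho> s *\<^sub>v y \<in> N" if s: "s \<in> carrier S" and y: "y \<in> N" for s y
      proof -
        have yc: "y \<in> carrier_vec d" using y by (simp add: N_def)
        have "\<rho> (e \<otimes>\<^bsub>S\<^esub> t) *\<^sub>v (\<rho> s *\<^sub>v y) = 0\<^sub>v d" if t: "t \<in> carrier S" for t
          using y e(1) s t rep_vec_mult[OF r(1) _ s yc, of "e \<otimes>\<^bsub>S\<^esub> t"]
          by (simp add: N_def m_assoc)
        then show ?thesis using mult_mat_vec_carrier[OF rc[OF s] yc] by (simp add: N_def)
      qed
    qed (auto simp: N_def)
    moreover have "v \<notin> N"
    proof
      assume "v \<in> N"
      then have "\<rho> (e \<otimes>\<^bsub>S\<^esub> e) *\<^sub>v v = 0\<^sub>v d" using e(1) unfolding N_def by blast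
      then show False using gv[OF e(1)] v rep_vec_mult[OF r(1) e(1) e(1) v(1)] e(2) by (simp add: g_def)
    qed
    ultimately have N: "N = {0\<^sub>v d}" using \<rho>(1) v(1) by (auto simp: simple_rep_def)
    have "\<rho> e *\<^sub>v (\<rho> t *\<^sub>v w) = 0\<^sub>v d" if t: "t \<in> carrier S" for t
    proof -
      have "\<sigma> t *\<^sub>v 0\<^sub>v d' = 0\<^sub>v d'" "\<sigma> e *\<^sub>v 0\<^sub>v d' = 0\<^sub>v d'" using sc t e(1) by (auto simp: mult_mat_zero_vec[of _ d' d'])
      then obtain c where c: "\<rho> e *\<^sub>v (\<rho> t *\<^sub>v w) = c \<cdot>\<^sub>v v" "0\<^sub>v d' = c \<cdot>\<^sub>v v'"
        using same[OF Ract[OF R t]] by auto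
      obtain i where "i < d'" "v' $ i \<noteq> 0" using v' by (metis eq_vecI carrier_vecD index_zero_vec)
      then have "c = 0" using arg_cong[OF c(2), of "\<lambda>x. x $ i"] v'(1) by auto
      then show ?thesis using c(1) zero_smult_carrier_vec[OF v(1)] by simp
    qed
    then have "w \<in> N" using Rc(1)[OF R] e(1) by (simp add: N_def rep_vec_mult[OF r(1)])
    then show ?thesis using N by simp
  qed
  have all: "\<exists>w'. ?R w w'" if w: "w \<in> carrier_vec d" for w
  proof -
    define W where "W = {w. \<exists>w'. ?R w w'}"
    have "invariant_subspace S d \<rho> W"
      unfolding invariant_subspace_iff
    proof (intro conjI ballI allI)
      show "\<rho> s *\<^sub>v y \<in> W" if "s \<in> carrier S" "y \<in> W" for s y
        using that Ract unfolding W_def by blast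
      show "x + y \<in> W" if "x \<in> W" "y \<in> W" for x y
        using that cyclic_pair.add unfolding W_def by blast
      show "c \<cdot>\<^sub>v y \<in> W" if "y \<in> W" for c y
        using that cyclic_pair.smult unfolding W_def by blast
    qed (use R0 Rc in \<open>auto simp: W_def\<close>)
    moreover have "v \<in> W"
      using cyclic_pair.gen[of "\<one>\<^bsub>S\<^esub>" S \<rho> v \<sigma> v'] representationD(2)[OF r(1)] v(1) by (auto simp: W_def)
    ultimately have "W = carrier_vec d" using \<rho>(1) v(2) by (auto simp: simple_rep_def)
    then show ?thesis using w by (auto simp: W_def)
  qed
  define m where "m i = (SOME w'. ?R (unit_vec d i) w')" for i
  have m: "?R (unit_vec d i) (m i)" for i
    unfolding m_def by (rule someI_ex) (rule all, simp)
  define M where "M = mat_of_cols d' (map m [0..<d])"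
  have M: "M \<in> carrier_mat d' d" by (simp add: M_def mat_of_cols_def)
  have col: "col M i = m i" if "i < d" for i
    using that Rc(2)[OF m] by (simp add: M_def col_mat_of_cols)
  have "?R x (M *\<^sub>v x)" if x: "x \<in> carrier_vec d" for x
    by (rule additive_relation_matrix[where R = ?R, OF M x R0])
      (auto simp: col m intro: cyclic_pair.add cyclic_pair.smult)
  then have "x = 0\<^sub>v d" if "x \<in> carrier_vec d" "M *\<^sub>v x = 0\<^sub>v d'" for x
    using that kernel by metis
  then show ?thesis by (rule injective_imp_dim_le[OF M])
qed

text \<open>
The regular representation modulo the span of the ideal \<open>I\<close>.
\<close>

lemma contracted_regular_representation:
  assumes S: "monoid S" and fin: "finite (carrier S)"
    and ideal: "\<And>s t. s \<in> carrier S \<Longrightarrow> t \<in> I \<Longrightarrow> s \<otimes>\<^bsub>S\<^esub> t \<in> I" "\<And>s t. s \<in> I \<Longrightarrow> t \<in> carrier S \<Longrightarrow> s \<otimes>\<^bsub>S\<^esub> t \<in> I"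
    and e: "e \<in> carrier S" "e \<notin> I" "e \<otimes>\<^bsub>S\<^esub> e = e"
  shows "\<exists>d (\<rho> :: 'a \<Rightarrow> 'k::field mat). representation S d \<rho> \<and> \<rho> e \<noteq> 0\<^sub>m d d \<and> (\<forall>s\<in>I. \<rho> s = 0\<^sub>m d d)"
proof -
  interpret monoid S by fact
  obtain xs where xs: "set xs = carrier S - I" "distinct xs"
    using finite_distinct_list[of "carrier S - I"] fin by auto
  define N where "N = length xs"
  define \<rho> :: "'a \<Rightarrow> 'k mat" where "\<rho> s = mat N N (\<lambda>(i, j). of_bool (s \<otimes>\<^bsub>S\<^esub> xs ! j = xs ! i))" for s
  have xsc: "xs ! j \<in> carrier S" "xs ! j \<notin> I" if "j < N" for j
    using that xs(1) nth_mem[of j xs] by (auto simp: N_def)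
  have "representation S N \<rho>"
    unfolding representation_def
  proof (intro conjI ballI)
    show "\<rho> s \<in> carrier_mat N N" for s by (simp add: \<rho>_def)
    show "\<rho> \<one>\<^bsub>S\<^esub> = 1\<^sub>m N"
      by (rule eq_matI) (use xsc xs(2) in \<open>auto simp: \<rho>_def nth_eq_iff_index_eq N_def\<close>)
    fix s t assume s: "s \<in> carrier S" and t: "t \<in> carrier S"
    show "\<rho> (s \<otimes>\<^bsub>S\<^esub> t) = \<rho> s * \<rho> t"
    proof (rule eq_matI)
      fix i j assume "i < dim_row (\<rho> s * \<rho> t)" "j < dim_col (\<rho> s * \<rho> t)"
      then have ij: "i < N" "j < N" by (auto simp: \<rho>_def)
      note xi = xsc[OF ij(1)] and xj = xsc[OF ij(2)]
      have "(\<rho> s * \<rho> t) $$ (i, j) = (\<Sum>k = 0..<N. of_bool (s \<otimes>\<^bsub>S\<^esub> xs ! k = xs ! i) * of_bool (t \<otimes>\<^bsub>S\<^esub> xs ! j = xs ! k))"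
        using ij by (simp add: \<rho>_def scalar_prod_def)
      also have "\<dots> = of_bool (s \<otimes>\<^bsub>S\<^esub> (t \<otimes>\<^bsub>S\<^esub> xs ! j) = xs ! i)"
      proof (cases "t \<otimes>\<^bsub>S\<^esub> xs ! j \<in> I")
        case True
        then have "s \<otimes>\<^bsub>S\<^esub> (t \<otimes>\<^bsub>S\<^esub> xs ! j) \<noteq> xs ! i" using ideal(1)[OF s True] xi by auto
        moreover have "t \<otimes>\<^bsub>S\<^esub> xs ! j \<noteq> xs ! k" if "k < N" for k using True xsc(2)[OF that] by auto
        ultimately show ?thesis by (simp add: sum.neutral)
      next
        case False
        then have "t \<otimes>\<^bsub>S\<^esub> xs ! j \<in> set xs" using xs(1) t xj by auto
        then obtain k where k: "k < N" "t \<otimes>\<^bsub>S\<^esub> xs ! j = xs ! k" by (auto simp: in_set_conv_nth N_def)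
        have "(\<Sum>l = 0..<N. of_bool (s \<otimes>\<^bsub>S\<^esub> xs ! l = xs ! i) * of_bool (t \<otimes>\<^bsub>S\<^esub> xs ! j = xs ! l) :: 'k)
          = (\<Sum>l = 0..<N. if l = k then of_bool (s \<otimes>\<^bsub>S\<^esub> xs ! k = xs ! i) else 0)"
          by (rule sum.cong) (use k xs(2) in \<open>auto simp: nth_eq_iff_index_eq N_def\<close>)
        then show ?thesis using k by simp
      qed
      also have "\<dots> = \<rho> (s \<otimes>\<^bsub>S\<^esub> t) $$ (i, j)" using ij s t xj by (simp add: \<rho>_def m_assoc)
      finally show "\<rho> (s \<otimes>\<^bsub>S\<^esub> t) $$ (i, j) = (\<rho> s * \<rho> t) $$ (i, j)" by simp
    qed (auto simp: \<rho>_def)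
  qed
  moreover have "\<rho> e \<noteq> 0\<^sub>m N N"
  proof -
    have "e \<in> set xs" using xs(1) e by simp
    then obtain j where j: "j < N" "xs ! j = e" by (auto simp: in_set_conv_nth N_def)
    then have "\<rho> e $$ (j, j) = 1" using e by (simp add: \<rho>_def)
    then show ?thesis using j by auto
  qed
  moreover have "\<rho> s = 0\<^sub>m N N" if "s \<in> I" for s
    by (rule eq_matI) (use ideal(2)[OF that] xsc in \<open>force simp: \<rho>_def\<close>)+
  ultimately show ?thesis by blast
qed

text \<open>
Among the representations that kill \<open>I\<close> but not \<open>e\<close> take one of smallest dimension. If it had a
proper subrepresentation, then \<open>e\<close> would act by zero on the sub and on the quotient, hence with
square zero, hence by zero, since \<open>e\<close> is idempotent.
\<close>

lemma simple_rep_corner_exists: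
  assumes S: "monoid S" and fin: "finite (carrier S)" and I: "I \<subseteq> carrier S"
    and ideal: "\<And>s t. s \<in> carrier S \<Longrightarrow> t \<in> I \<Longrightarrow> s \<otimes>\<^bsub>S\<^esub> t \<in> I" "\<And>s t. s \<in> I \<Longrightarrow> t \<in> carrier S \<Longrightarrow> s \<otimes>\<^bsub>S\<^esub> t \<in> I"
    and e: "e \<in> carrier S" "e \<notin> I" "e \<otimes>\<^bsub>S\<^esub> e = e"
  shows "\<exists>d (\<rho> :: 'a \<Rightarrow> 'k::field mat). simple_rep S d \<rho> \<and> \<rho> e \<noteq> 0\<^sub>m d d \<and> (\<forall>s\<in>I. \<rho> s = 0\<^sub>m d d)"
proof -
  define ok where "ok d \<longleftrightarrow> (\<exists>\<rho> :: 'a \<Rightarrow> 'k mat. representation S d \<rho> \<and> \<rho> e \<noteq> 0\<^sub>m d d \<and> (\<forall>s\<in>I. \<rho> s = 0\<^sub>m d d))" for d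
  define d where "d = (LEAST d. ok d)"
  have "\<exists>d. ok d" unfolding ok_def by (rule contracted_regular_representation[OF S fin ideal e])
  then have "ok d" unfolding d_def by (rule LeastI_ex)
  then obtain \<rho> :: "'a \<Rightarrow> 'k mat" where \<rho>: "representation S d \<rho>" "\<rho> e \<noteq> 0\<^sub>m d d" "\<And>s. s \<in> I \<Longrightarrow> \<rho> s = 0\<^sub>m d d"
    by (auto simp: ok_def)
  have min: "\<tau> e = 0\<^sub>m m m" if "m < d" "representation S m \<tau>" "\<And>s. s \<in> I \<Longrightarrow> \<tau> s = 0\<^sub>m m m" for m and \<tau> :: "'a \<Rightarrow> 'k mat"
    using not_less_Least[of m ok] that unfolding d_def ok_def by blast
  have "d > 0"
    using \<rho>(2) representationD(1)[OF \<rho>(1) e(1)] by (cases "d = 0") (auto intro!: eq_matI)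
  moreover have "W = {0\<^sub>v d} \<or> W = carrier_vec d" if W: "invariant_subspace S d \<rho> W" for W
  proof (rule ccontr)
    assume "\<not> ?thesis"
    then have "W \<noteq> {0\<^sub>v d}" "W \<noteq> carrier_vec d" by auto
    from reducible_block_form[OF S \<rho>(1) W this]
    obtain r q P Q A B C where d: "d = r + q" "0 < r" "0 < q"
      and P: "P \<in> carrier_mat d d" "Q \<in> carrier_mat d d" "P * Q = 1\<^sub>m d" "Q * P = 1\<^sub>m d"
      and dims: "\<And>s. s \<in> carrier S \<Longrightarrow> A s \<in> carrier_mat r r" "\<And>s. s \<in> carrier S \<Longrightarrow> B s \<in> carrier_mat r q"
        "\<And>s. s \<in> carrier S \<Longrightarrow> C s \<in> carrier_mat q q"
      and blk: "\<And>s. s \<in> carrier S \<Longrightarrow> Q * \<rho> s * P = four_block_mat (A s) (B s) (0\<^sub>m q r) (C s)"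
      and reps: "representation S r A" "representation S q C" by metis
    have zero: "A s = 0\<^sub>m r r" "C s = 0\<^sub>m q q" if s: "s \<in> I" for s
    proof -
      have sc: "s \<in> carrier S" using s I by auto
      have "Q * \<rho> s * P = 0\<^sub>m d d" using P \<rho>(3)[OF s] by simp
      then have "four_block_mat (A s) (B s) (0\<^sub>m q r) (C s) = four_block_mat (0\<^sub>m r r) (0\<^sub>m r q) (0\<^sub>m q r) (0\<^sub>m q q)"
        using blk[OF sc] d by simp
      from four_block_mat_inject[OF _ _ _ _ _ _ _ _ this, of r r q q] dims[OF sc]
      show "A s = 0\<^sub>m r r" "C s = 0\<^sub>m q q" by auto
    qed
    have "A e = 0\<^sub>m r r" "C e = 0\<^sub>m q q"
      using min[of r A] min[of q C] d reps zero by auto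
    then have X: "Q * \<rho> e * P = four_block_mat (0\<^sub>m r r) (B e) (0\<^sub>m q r) (0\<^sub>m q q)" using blk[OF e(1)] by simp
    note re = representationD(1)[OF \<rho>(1) e(1)]
    have "\<rho> e * \<rho> e = \<rho> e" using representationD(3)[OF \<rho>(1) e(1) e(1)] e(3) by simp
    then have "Q * \<rho> e * P = (Q * \<rho> e * P) * (Q * \<rho> e * P)" using conj_mult[OF P(1-3) re re] by simp
    also have "\<dots> = 0\<^sub>m d d"
      unfolding X using four_block_upper_mult[of "0\<^sub>m r r" r "B e" q "0\<^sub>m q q" "0\<^sub>m r r" "B e" "0\<^sub>m q q"] dims(2)[OF e(1)] d
      by simp
    finally have "P * (Q * \<rho> e * P) * Q = 0\<^sub>m d d" using P by simp
    moreover have "P * (Q * \<rho> e * P) * Q = (P * Q) * \<rho> e * (P * Q)"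
      using P(1,2) re by (smt (verit) assoc_mult_mat mult_carrier_mat)
    ultimately show False using P(3) re \<rho>(2) by simp
  qed
  ultimately have "simple_rep S d \<rho>" using \<rho>(1) by (auto simp: simple_rep_def)
  with \<rho> show ?thesis by blast
qed

section \<open>Isomorphisms of representations\<close>

lemma rep_isomorphicE:
  assumes "rep_isomorphic S d \<rho> (\<sigma> :: 'a \<Rightarrow> 'k::field mat)"
  obtains P Q where "P \<in> carrier_mat d d" "Q \<in> carrier_mat d d" "P * Q = 1\<^sub>m d" "Q * P = 1\<^sub>m d"
    "\<And>s. s \<in> carrier S \<Longrightarrow> P * \<rho> s = \<sigma> s * P"
  using assms unfolding rep_isomorphic_def by (metis invertible_matE)

lemma rep_isomorphicI:
  assumes "P \<in> carrier_mat d d" "Q \<in> carrier_mat d d" "P * Q = 1\<^sub>m d" "Q * P = 1\<^sub>m d"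
    "\<And>s. s \<in> carrier S \<Longrightarrow> P * \<rho> s = \<sigma> s * P"
  shows "rep_isomorphic S d \<rho> (\<sigma> :: 'a \<Rightarrow> 'k::field mat)"
  using assms invertible_matI unfolding rep_isomorphic_def by blast

lemma rep_isomorphic_trans:
  fixes \<rho> \<sigma> \<tau> :: "'a \<Rightarrow> 'k::field mat"
  assumes "rep_isomorphic S d \<rho> \<sigma>" "rep_isomorphic S d \<sigma> \<tau>"
    and c: "\<And>s. s \<in> carrier S \<Longrightarrow> \<rho> s \<in> carrier_mat d d" "\<And>s. s \<in> carrier S \<Longrightarrow> \<sigma> s \<in> carrier_mat d d"
      "\<And>s. s \<in> carrier S \<Longrightarrow> \<tau> s \<in> carrier_mat d d"
  shows "rep_isomorphic S d \<rho> \<tau>"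
proof -
  from rep_isomorphicE[OF assms(1)] obtain P Q where P: "P \<in> carrier_mat d d" "Q \<in> carrier_mat d d"
    "P * Q = 1\<^sub>m d" "Q * P = 1\<^sub>m d" "\<And>s. s \<in> carrier S \<Longrightarrow> P * \<rho> s = \<sigma> s * P" by blast
  from rep_isomorphicE[OF assms(2)] obtain P' Q' where P': "P' \<in> carrier_mat d d" "Q' \<in> carrier_mat d d"
    "P' * Q' = 1\<^sub>m d" "Q' * P' = 1\<^sub>m d" "\<And>s. s \<in> carrier S \<Longrightarrow> P' * \<sigma> s = \<tau> s * P'" by blast
  have "(P' * P) * (Q * Q') = P' * (P * Q) * Q'"
    using P(1,2) P'(1,2) by (smt (verit) assoc_mult_mat mult_carrier_mat)
  then have i: "(P' * P) * (Q * Q') = 1\<^sub>m d" using P P' by simp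
  show ?thesis
  proof (rule rep_isomorphicI[OF _ _ i mat_mult_left_right_inverse[OF _ _ i]])
    fix s assume s: "s \<in> carrier S"
    have "P' * P * \<rho> s = P' * (P * \<rho> s)" by (rule assoc_mult_mat[OF P'(1) P(1) c(1)[OF s]])
    also have "\<dots> = P' * \<sigma> s * P" unfolding P(5)[OF s] by (rule assoc_mult_mat[OF P'(1) c(2)[OF s] P(1), symmetric])
    also have "\<dots> = \<tau> s * (P' * P)" unfolding P'(5)[OF s] by (rule assoc_mult_mat[OF c(3)[OF s] P'(1) P(1)])
    finally show "P' * P * \<rho> s = \<tau> s * (P' * P)" .
  qed (use P P' in auto)
qed

lemma rep_isomorphic_conj:
  fixes \<rho> :: "'a \<Rightarrow> 'k::field mat"
  assumes P: "P \<in> carrier_mat d d" "Q \<in> carrier_mat d d" "P * Q = 1\<^sub>m d" "Q * P = 1\<^sub>m d"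
    and c: "\<And>s. s \<in> carrier S \<Longrightarrow> \<rho> s \<in> carrier_mat d d"
  shows "rep_isomorphic S d \<rho> (\<lambda>s. Q * \<rho> s * P)"
proof (rule rep_isomorphicI[OF P(2,1,4,3)])
  fix s assume s: "s \<in> carrier S"
  have "Q * \<rho> s * P * Q = Q * \<rho> s * (P * Q)"
    using P(1,2) c[OF s] by (smt (verit) assoc_mult_mat mult_carrier_mat)
  then show "Q * \<rho> s = Q * \<rho> s * P * Q" using P c[OF s] by simp
qed

lemma representation_isomorphic:
  fixes \<rho> \<sigma> :: "'a \<Rightarrow> 'k::field mat"
  assumes S: "monoid S" and \<rho>: "representation S d \<rho>" and iso: "rep_isomorphic S d \<rho> \<sigma>"
    and c: "\<And>s. s \<in> carrier S \<Longrightarrow> \<sigma> s \<in> carrier_mat d d"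
  shows "representation S d \<sigma>"
proof -
  interpret monoid S by fact
  from rep_isomorphicE[OF iso] obtain P Q where P: "P \<in> carrier_mat d d" "Q \<in> carrier_mat d d"
    "P * Q = 1\<^sub>m d" "Q * P = 1\<^sub>m d" "\<And>s. s \<in> carrier S \<Longrightarrow> P * \<rho> s = \<sigma> s * P" by blast
  have eq: "\<sigma> s = P * \<rho> s * Q" if s: "s \<in> carrier S" for s
  proof -
    have "P * \<rho> s * Q = \<sigma> s * (P * Q)" using P c[OF s] s by simp
    then show ?thesis using P c[OF s] by simp
  qed
  show ?thesis
    using representation_conj[OF S \<rho> P(2,1,4,3)] by (simp add: representation_def eq)
qed

lemma block_isomorphic:
  fixes A A' B C C' :: "'a \<Rightarrow> 'k::field mat"
  assumes A: "rep_isomorphic S r A A'" and C: "rep_isomorphic S q C C'"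
    and c: "\<And>s. s \<in> carrier S \<Longrightarrow> A s \<in> carrier_mat r r" "\<And>s. s \<in> carrier S \<Longrightarrow> A' s \<in> carrier_mat r r"
      "\<And>s. s \<in> carrier S \<Longrightarrow> B s \<in> carrier_mat r q"
      "\<And>s. s \<in> carrier S \<Longrightarrow> C s \<in> carrier_mat q q" "\<And>s. s \<in> carrier S \<Longrightarrow> C' s \<in> carrier_mat q q"
  shows "\<exists>B'. (\<forall>s\<in>carrier S. B' s \<in> carrier_mat r q) \<and>
    rep_isomorphic S (r + q) (\<lambda>s. four_block_mat (A s) (B s) (0\<^sub>m q r) (C s))
       (\<lambda>s. four_block_mat (A' s) (B' s) (0\<^sub>m q r) (C' s))"
proof -
  from rep_isomorphicE[OF A] obtain P Q where P: "P \<in> carrier_mat r r" "Q \<in> carrier_mat r r"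
    "P * Q = 1\<^sub>m r" "Q * P = 1\<^sub>m r" "\<And>s. s \<in> carrier S \<Longrightarrow> P * A s = A' s * P" by blast
  from rep_isomorphicE[OF C] obtain P' Q' where P': "P' \<in> carrier_mat q q" "Q' \<in> carrier_mat q q"
    "P' * Q' = 1\<^sub>m q" "Q' * P' = 1\<^sub>m q" "\<And>s. s \<in> carrier S \<Longrightarrow> P' * C s = C' s * P'" by blast
  define B' where "B' s = P * B s * Q'" for s
  have B': "B' s \<in> carrier_mat r q" if "s \<in> carrier S" for s
    using P P' c(3)[OF that] by (auto simp: B'_def)
  let ?T = "four_block_mat P (0\<^sub>m r q) (0\<^sub>m q r) P'" and ?T' = "four_block_mat Q (0\<^sub>m r q) (0\<^sub>m q r) Q'"
  have "rep_isomorphic S (r + q) (\<lambda>s. four_block_mat (A s) (B s) (0\<^sub>m q r) (C s))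
       (\<lambda>s. four_block_mat (A' s) (B' s) (0\<^sub>m q r) (C' s))"
  proof (rule rep_isomorphicI)
    show "?T \<in> carrier_mat (r + q) (r + q)" "?T' \<in> carrier_mat (r + q) (r + q)" using P P' by auto
    show "?T * ?T' = 1\<^sub>m (r + q)" "?T' * ?T = 1\<^sub>m (r + q)"
      using P(1-4) P'(1-4) by (simp_all add: four_block_upper_mult[of _ r _ q])
    fix s assume s: "s \<in> carrier S"
    have "B' s * P' = P * B s * (Q' * P')"
      unfolding B'_def using P(1) P'(1,2) c(3)[OF s] by (smt (verit) assoc_mult_mat mult_carrier_mat)
    also have "\<dots> = P * B s" using P P' c(3)[OF s] by simp
    finally show "?T * four_block_mat (A s) (B s) (0\<^sub>m q r) (C s)
        = four_block_mat (A' s) (B' s) (0\<^sub>m q r) (C' s) * ?T"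
      using P(1,5) P'(1,5) c[OF s] B'[OF s] s by (simp add: four_block_upper_mult[of _ r _ q])
  qed
  with B' show ?thesis by blast
qed

lemma direct_sum_rep_eq_diag:
  assumes "\<And>\<sigma>. \<sigma> \<in> set \<sigma>s \<Longrightarrow> \<sigma> s \<in> carrier_mat 1 1"
  shows "direct_sum_rep \<sigma>s s = mat_diag (length \<sigma>s) (\<lambda>i. (\<sigma>s ! i) s $$ (0, 0) :: 'k::field)"
  using assms
proof (induction \<sigma>s)
  case Nil
  show ?case by (auto simp: direct_sum_rep_def mat_diag_def)
next
  case (Cons \<sigma> \<sigma>s)
  have IH: "direct_sum_rep \<sigma>s s = mat_diag (length \<sigma>s) (\<lambda>i. (\<sigma>s ! i) s $$ (0, 0))"
    using Cons by auto
  have c: "\<sigma> s \<in> carrier_mat 1 1" using Cons.prems by simp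
  have "direct_sum_rep (\<sigma> # \<sigma>s) s = four_block_mat (\<sigma> s) (0\<^sub>m 1 (length \<sigma>s)) (0\<^sub>m (length \<sigma>s) 1)
      (mat_diag (length \<sigma>s) (\<lambda>i. (\<sigma>s ! i) s $$ (0, 0)))"
    using IH c by (simp add: direct_sum_rep_def Let_def carrier_matD[OF mat_diag_dim])
  also have "\<dots> = mat_diag (length (\<sigma> # \<sigma>s)) (\<lambda>i. ((\<sigma> # \<sigma>s) ! i) s $$ (0, 0))"
    using c by (intro eq_matI) (auto simp: mat_diag_def nth_Cons')
  finally show ?case .
qed

lemma direct_sum_rep_append:
  assumes "\<And>\<sigma>. \<sigma> \<in> set (\<sigma>s @ \<tau>s) \<Longrightarrow> \<sigma> s \<in> carrier_mat 1 1"
  shows "direct_sum_rep (\<sigma>s @ \<tau>s) s = (four_block_mat (direct_sum_rep \<sigma>s s) (0\<^sub>m (length \<sigma>s) (length \<tau>s))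
    (0\<^sub>m (length \<tau>s) (length \<sigma>s)) (direct_sum_rep \<tau>s s) :: 'k::field mat)"
proof -
  have d: "direct_sum_rep (\<sigma>s @ \<tau>s) s = mat_diag (length \<sigma>s + length \<tau>s) (\<lambda>i. ((\<sigma>s @ \<tau>s) ! i) s $$ (0, 0))"
    "direct_sum_rep \<sigma>s s = mat_diag (length \<sigma>s) (\<lambda>i. (\<sigma>s ! i) s $$ (0, 0))"
    "direct_sum_rep \<tau>s s = mat_diag (length \<tau>s) (\<lambda>i. (\<tau>s ! i) s $$ (0, 0))"
    using assms by (subst direct_sum_rep_eq_diag; auto)+
  show ?thesis unfolding d by (intro eq_matI) (auto simp: mat_diag_def nth_append)
qed

section \<open>Extensions of trivial representations\<close>

text \<open>
The properties of the ideal \<open>I\<close> of nonunits which force extensions between the trivial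
representations to split: \<open>factor\<close> for extensions of the bottom representation by itself, \<open>z\<close>
for those of the top representation by itself, and connectedness from both sides for the mixed ones.
\<close>

locale connected_monoid = monoid S for S (structure) +
  fixes I and z
  assumes I_def: "I = carrier S - {\<one>}"
    and unit_free: "\<lbrakk>x \<in> carrier S; y \<in> carrier S; x \<otimes> y = \<one>\<rbrakk> \<Longrightarrow> x = \<one>"
    and factor: "s \<in> I \<Longrightarrow> \<exists>x\<in>I. \<exists>y\<in>I. s = x \<otimes> y"
    and absorb: "z \<in> I" "x \<in> carrier S \<Longrightarrow> z \<otimes> x \<otimes> z = z"
    and right_connected: "\<lbrakk>equivp R; \<And>s x. s \<in> I \<Longrightarrow> x \<in> I \<Longrightarrow> R s (s \<otimes> x)\<rbrakk> \<Longrightarrow> s \<in> I \<Longrightarrow> t \<in> I \<Longrightarrow> R s t"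
    and left_connected: "\<lbrakk>equivp R; \<And>s x. s \<in> I \<Longrightarrow> x \<in> I \<Longrightarrow> R s (x \<otimes> s)\<rbrakk> \<Longrightarrow> s \<in> I \<Longrightarrow> t \<in> I \<Longrightarrow> R s t"
begin

lemma I_closed: "s \<in> I \<Longrightarrow> t \<in> I \<Longrightarrow> s \<otimes> t \<in> I"
  using unit_free by (auto simp: I_def)

lemma Units_trivial: "Units S = {\<one>}"
  using unit_free by (auto simp: Units_def)

lemma triv_b_simps: "triv_b S \<one> = 1\<^sub>m 1" "s \<in> I \<Longrightarrow> triv_b S s = 0\<^sub>m 1 1"
  by (auto simp: triv_b_def Units_trivial I_def)

lemma right_invariant_const:
  assumes "\<And>s x. s \<in> I \<Longrightarrow> x \<in> I \<Longrightarrow> f (s \<otimes> x) = f s" "s \<in> I" "t \<in> I"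
  shows "f s = f t"
  by (rule right_connected[of "\<lambda>s t. f s = f t"])
    (use assms in \<open>auto intro!: equivpI simp: reflp_def symp_def transp_def\<close>)

lemma left_invariant_const:
  assumes "\<And>s x. s \<in> I \<Longrightarrow> x \<in> I \<Longrightarrow> f (x \<otimes> s) = f s" "s \<in> I" "t \<in> I"
  shows "f s = f t"
  by (rule left_connected[of "\<lambda>s t. f s = f t"])
    (use assms in \<open>auto intro!: equivpI simp: reflp_def symp_def transp_def\<close>)

text \<open>
For \<open>a = c = 0\<close> the function vanishes on products, and every element of \<open>I\<close> is one. For
\<open>a = c = 1\<close> it is additive, so it vanishes at the idempotent \<open>z\<close> and, because of
\<open>z x z = z\<close>, at every \<open>x\<close>. In the mixed cases it is invariant under multiplication from one side.
\<close>

lemma cocycle_const: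
  fixes f :: "'a \<Rightarrow> 'k::field"
  assumes ac: "a \<in> {0, 1}" "c \<in> {0, 1}"
    and f: "\<And>s t. s \<in> I \<Longrightarrow> t \<in> I \<Longrightarrow> f (s \<otimes> t) = a * f t + f s * c"
    and s: "s \<in> I" "t \<in> I"
  shows "f s = f t" and "a = c \<Longrightarrow> f s = 0"
proof -
  have zero: "f x = 0" if x: "x \<in> I" and eq: "a = c" for x
  proof (cases "a = 0")
    case True
    from factor[OF x] obtain y y' where "y \<in> I" "y' \<in> I" "x = y \<otimes> y'" by auto
    then show ?thesis using f True eq by simp
  next
    case False
    then have a: "a = 1" "c = 1" using ac eq by auto
    have "z \<otimes> z = z" using absorb(2)[of \<one>] absorb(1) by (simp add: I_def)
    then have "f z + f z = f z" using f[OF absorb(1) absorb(1)] a by simp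
    then have "f z = 0" by (simp only: add_cancel_left_left)
    moreover have "f (z \<otimes> x \<otimes> z) = f z + f x + f z"
      using f[OF I_closed[OF absorb(1) x] absorb(1)] f[OF absorb(1) x] a by simp
    ultimately show ?thesis using absorb x by (simp add: I_def)
  qed
  then show "a = c \<Longrightarrow> f s = 0" using s by simp
  show "f s = f t"
  proof (cases "a = c")
    case True then show ?thesis using zero s by simp
  next
    case False
    then consider "a = 1" "c = 0" | "a = 0" "c = 1" using ac by auto
    then show ?thesis
    proof cases
      case 1 show ?thesis by (rule left_invariant_const[of f]) (use 1 f s in auto)
    next
      case 2 show ?thesis by (rule right_invariant_const[of f]) (use 2 f s in auto)
    qed
  qed
qed

text \<open>
For scalars \<open>a\<close>, \<open>c\<close> in \<open>{0, 1}\<close> and an entry \<open>\<beta>\<close> that vanishes unless \<open>a \<noteq> c\<close>, the number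
\<open>y = (a - c) \<beta>\<close> solves \<open>\<beta> + y c = a y\<close>, because \<open>(a - c)\<^sup>2 = 1\<close> if \<open>a \<noteq> c\<close>. The matrix \<open>Y'\<close> of
these numbers conjugates the block \<open>B\<close> away.
\<close>

lemma trivial_extension_splits:
  fixes B :: "'a \<Rightarrow> 'k::field mat"
  assumes triv: "set \<sigma>s \<subseteq> {triv_b S, triv_t}" "set \<tau>s \<subseteq> {triv_b S, triv_t}"
    and len: "length \<sigma>s = r" "length \<tau>s = q"
    and B: "\<And>s. s \<in> carrier S \<Longrightarrow> B s \<in> carrier_mat r q"
    and R: "representation S (r + q)
      (\<lambda>s. four_block_mat (direct_sum_rep \<sigma>s s) (B s) (0\<^sub>m q r) (direct_sum_rep \<tau>s s))"
  shows "rep_isomorphic S (r + q)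
    (\<lambda>s. four_block_mat (direct_sum_rep \<sigma>s s) (B s) (0\<^sub>m q r) (direct_sum_rep \<tau>s s))
    (direct_sum_rep (\<sigma>s @ \<tau>s))"
proof -
  define A where "A = direct_sum_rep \<sigma>s"
  define C where "C = direct_sum_rep \<tau>s"
  define a where "a i s = (\<sigma>s ! i) s $$ (0, 0)" for i s
  define c where "c i s = (\<tau>s ! i) s $$ (0, 0)" for i s
  have one: "\<sigma> s \<in> carrier_mat 1 1" if "\<sigma> \<in> {triv_b S, triv_t}" for s and \<sigma> :: "'a \<Rightarrow> 'k mat"
    using that by (auto simp: triv_b_def triv_t_def)
  have A: "A s = mat_diag r (\<lambda>i. a i s)" and C: "C s = mat_diag q (\<lambda>i. c i s)" for s
    unfolding A_def C_def a_def c_def len[symmetric]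
    using triv one by (subst direct_sum_rep_eq_diag; blast)+
  have val: "\<sigma> s $$ (0, 0) \<in> {0, 1} \<and> \<sigma> s $$ (0, 0) = \<sigma> z $$ (0, 0)" if "\<sigma> \<in> {triv_b S, triv_t}" "s \<in> I" for s and \<sigma> :: "'a \<Rightarrow> 'k mat"
    using that absorb(1) by (auto simp: triv_b_simps triv_t_def)
  have a: "a i s \<in> {0, 1}" "a i s = a i z" if "i < r" "s \<in> I" for i s
    using val[of "\<sigma>s ! i" s] that triv(1) len nth_mem[of i \<sigma>s] unfolding a_def by blast+
  have c: "c i s \<in> {0, 1}" "c i s = c i z" if "i < q" "s \<in> I" for i s
    using val[of "\<tau>s ! i" s] that triv(2) len nth_mem[of i \<tau>s] unfolding c_def by blast+
  have car: "A s \<in> carrier_mat r r" "C s \<in> carrier_mat q q" for s by (auto simp: A C)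
  have R': "representation S (r + q) (\<lambda>s. four_block_mat (A s) (B s) (0\<^sub>m q r) (C s))"
    using R by (simp add: A_def C_def)
  have reps: "representation S r A" "representation S q C"
    using block_form_representations(1,2)[OF monoid_axioms R', of A B C] car B by auto
  have mult: "B (s \<otimes> t) = A s * B t + B s * C t" if "s \<in> carrier S" "t \<in> carrier S" for s t
    using block_form_representations(3)[OF monoid_axioms R', of A B C] car B that by auto
  have Bone: "B \<one> = 0\<^sub>m r q"
  proof -
    have "four_block_mat (A \<one>) (B \<one>) (0\<^sub>m q r) (C \<one>) = four_block_mat (1\<^sub>m r) (0\<^sub>m r q) (0\<^sub>m q r) (1\<^sub>m q)"
      using representationD(2)[OF R] by (simp add: A_def C_def)
    from four_block_mat_inject(2)[OF _ _ _ _ _ _ _ _ this, of r r q q] car B[OF one_closed]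
    show ?thesis by auto
  qed
  have cocycle: "B (s \<otimes> t) $$ (i, j) = a i z * B t $$ (i, j) + B s $$ (i, j) * c j z"
    if st: "s \<in> I" "t \<in> I" and ij: "i < r" "j < q" for s t i j
  proof -
    have sc: "s \<in> carrier S" "t \<in> carrier S" using st by (auto simp: I_def)
    show ?thesis
      using mult[OF sc] ij B[OF sc(1)] B[OF sc(2)] a(2)[OF ij(1) st(1)] c(2)[OF ij(2) st(2)]
      by (simp add: A C mat_diag_mult_left[of _ r q] mat_diag_mult_right[of _ r q])
  qed
  have Bconst: "B s $$ (i, j) = B z $$ (i, j)" "a i z = c j z \<Longrightarrow> B s $$ (i, j) = 0"
    if "s \<in> I" "i < r" "j < q" for s i j
    using cocycle_const[of "a i z" "c j z" "\<lambda>s. B s $$ (i, j)" s z] a[OF that(2) absorb(1)] c[OF that(3) absorb(1)]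
      cocycle that absorb(1) by auto
  define Y where "Y = mat r q (\<lambda>(i, j). (c j z - a i z) * B z $$ (i, j))"
  define Y' where "Y' = mat r q (\<lambda>(i, j). (a i z - c j z) * B z $$ (i, j))"
  have Y: "Y \<in> carrier_mat r q" "Y' \<in> carrier_mat r q" by (auto simp: Y_def Y'_def)
  have YY: "Y + Y' = 0\<^sub>m r q" "Y' + Y = 0\<^sub>m r q" by (auto simp: Y_def Y'_def algebra_simps intro!: eq_matI)
  define U where "U = four_block_mat (1\<^sub>m r) Y (0\<^sub>m q r) (1\<^sub>m q)"
  define V where "V = four_block_mat (1\<^sub>m r) Y' (0\<^sub>m q r) (1\<^sub>m q)"
  have UV: "U \<in> carrier_mat (r + q) (r + q)" "V \<in> carrier_mat (r + q) (r + q)"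
    "U * V = 1\<^sub>m (r + q)" "V * U = 1\<^sub>m (r + q)"
    using Y YY unfolding U_def V_def by (auto simp: four_block_upper_mult[of _ r _ q])
  have key: "B s + Y' * C s = A s * Y'" if s: "s \<in> carrier S" for s
  proof (rule eq_matI)
    fix i j assume "i < dim_row (A s * Y')" "j < dim_col (A s * Y')"
    then have ij: "i < r" "j < q" using carrier_matD[OF car(1)[of s]] carrier_matD[OF Y(2)] by auto
    have AY: "(A s * Y') $$ (i, j) = a i s * Y' $$ (i, j)" "(Y' * C s) $$ (i, j) = Y' $$ (i, j) * c j s"
      using ij Y by (simp_all add: A C mat_diag_mult_left[of _ r q] mat_diag_mult_right[of _ r q])
    show "(B s + Y' * C s) $$ (i, j) = (A s * Y') $$ (i, j)"
    proof (cases "s = \<one>")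
      case True
      have "A s = 1\<^sub>m r" "C s = 1\<^sub>m q"
        using True representationD(2)[OF reps(1)] representationD(2)[OF reps(2)] by auto
      then show ?thesis using Bone True ij Y by simp
    next
      case False
      then have sI: "s \<in> I" using s by (simp add: I_def)
      have "a i z = 1 \<and> c j z = 0 \<or> a i z = 0 \<and> c j z = 1 \<or> B s $$ (i, j) = 0 \<and> a i z = c j z"
        using Bconst(2)[OF sI ij] a(1)[OF ij(1) absorb(1)] c(1)[OF ij(2) absorb(1)] by auto
      moreover have "(B s + Y' * C s) $$ (i, j) = B s $$ (i, j) + Y' $$ (i, j) * c j s"
        using ij AY(2) carrier_matD[OF Y(2)] carrier_matD[OF car(2)[of s]] by simp
      moreover have "Y' $$ (i, j) = (a i z - c j z) * B z $$ (i, j)" using ij by (simp add: Y'_def)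
      ultimately show ?thesis
        using AY(1) Bconst(1)[OF sI ij] a(2)[OF ij(1) sI] c(2)[OF ij(2) sI] by auto
    qed
  qed (use carrier_matD[OF car(1)[of s]] carrier_matD[OF Y(2)] carrier_matD[OF car(2)[of s]]
      carrier_matD[OF B[OF s]] in auto)
  show ?thesis
  proof (rule rep_isomorphicI[OF UV(2,1,4,3)])
    fix s assume s: "s \<in> carrier S"
    have "direct_sum_rep (\<sigma>s @ \<tau>s) s = four_block_mat (A s) (0\<^sub>m r q) (0\<^sub>m q r) (C s)"
      unfolding A_def C_def len[symmetric]
      by (rule direct_sum_rep_append) (use triv one in auto)
    moreover have "V * four_block_mat (A s) (B s) (0\<^sub>m q r) (C s) = four_block_mat (A s) (0\<^sub>m r q) (0\<^sub>m q r) (C s) * V"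
      unfolding V_def using key[OF s] car[of s] Y B[OF s] by (simp add: four_block_upper_mult[of _ r _ q])
    ultimately show "V * four_block_mat (direct_sum_rep \<sigma>s s) (B s) (0\<^sub>m q r) (direct_sum_rep \<tau>s s)
        = direct_sum_rep (\<sigma>s @ \<tau>s) s * V" by (simp add: A_def C_def)
  qed
qed

text \<open>
Induction on the dimension: a representation that is not simple is an extension of two smaller
ones, which are sums of trivial representations, and such an extension splits.
\<close>

lemma trivial_if_simples_trivial:
  fixes \<rho> :: "'a \<Rightarrow> 'k::field mat"
  assumes simple: "\<And>d \<rho> :: 'a \<Rightarrow> 'k mat. simple_rep S d \<rho> \<Longrightarrow> d < D \<Longrightarrow>
      d = 1 \<and> (\<exists>\<sigma>\<in>{triv_b S, triv_t}. \<forall>s\<in>carrier S. \<rho> s = \<sigma> s)"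
    and \<rho>: "representation S d \<rho>" and "d < D"
  shows "\<exists>\<sigma>s. length \<sigma>s = d \<and> set \<sigma>s \<subseteq> {triv_b S, triv_t} \<and> rep_isomorphic S d \<rho> (direct_sum_rep \<sigma>s)"
  using \<rho> \<open>d < D\<close>
proof (induction d arbitrary: \<rho> rule: less_induct)
  case (less d)
  note \<rho> = less.prems(1)
  have one: "\<sigma> s \<in> carrier_mat 1 1" if "\<sigma> \<in> {triv_b S, triv_t}" for s and \<sigma> :: "'a \<Rightarrow> 'k mat"
    using that by (auto simp: triv_b_def triv_t_def)
  have ds: "direct_sum_rep \<sigma>s s \<in> carrier_mat (length \<sigma>s) (length \<sigma>s)"
    if "set \<sigma>s \<subseteq> {triv_b S, triv_t}" for s and \<sigma>s :: "('a \<Rightarrow> 'k mat) list"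
    using that one by (subst direct_sum_rep_eq_diag) auto
  consider "d = 0" | "simple_rep S d \<rho>" |
    W where "invariant_subspace S d \<rho> W" "W \<noteq> {0\<^sub>v d}" "W \<noteq> carrier_vec d"
    using \<rho> by (auto simp: simple_rep_def)
  then show ?case
  proof cases
    case 1
    then have "rep_isomorphic S d \<rho> (direct_sum_rep [])"
    proof (intro rep_isomorphicI[of "1\<^sub>m 0" _ "1\<^sub>m 0"])
      fix s assume "s \<in> carrier S"
      then have "\<rho> s \<in> carrier_mat 0 0" using representationD(1)[OF \<rho>] 1 by simp
      then show "1\<^sub>m 0 * \<rho> s = direct_sum_rep [] s * 1\<^sub>m 0"
        by (intro eq_matI) (auto simp: direct_sum_rep_def)
    qed (use 1 in auto)
    then show ?thesis using 1 by (intro exI[of _ "[]"]) auto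
  next
    case 2
    from simple[OF this less.prems(2)] obtain \<sigma> where d: "d = 1" and \<sigma>: "\<sigma> \<in> {triv_b S, triv_t}"
      "\<And>s. s \<in> carrier S \<Longrightarrow> \<rho> s = \<sigma> s" by auto
    have "rep_isomorphic S d \<rho> (direct_sum_rep [\<sigma>])"
    proof (rule rep_isomorphicI[of "1\<^sub>m 1" _ "1\<^sub>m 1"])
      fix s assume s: "s \<in> carrier S"
      have "direct_sum_rep [\<sigma>] s = \<sigma> s"
        by (simp only: direct_sum_rep_def list.map diag_block_mat_singleton)
      then show "1\<^sub>m 1 * \<rho> s = direct_sum_rep [\<sigma>] s * 1\<^sub>m 1" using \<sigma>(2)[OF s] one[OF \<sigma>(1), of s] by simp
    qed (use d in auto)
    then show ?thesis using d \<sigma> by (intro exI[of _ "[\<sigma>]"]) auto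
  next
    case 3
    from reducible_block_form[OF monoid_axioms \<rho> this]
    obtain r q P Q A B C where d: "d = r + q" "0 < r" "0 < q"
      and P: "P \<in> carrier_mat d d" "Q \<in> carrier_mat d d" "P * Q = 1\<^sub>m d" "Q * P = 1\<^sub>m d"
      and dims: "\<And>s. s \<in> carrier S \<Longrightarrow> A s \<in> carrier_mat r r" "\<And>s. s \<in> carrier S \<Longrightarrow> B s \<in> carrier_mat r q"
        "\<And>s. s \<in> carrier S \<Longrightarrow> C s \<in> carrier_mat q q"
      and blk: "\<And>s. s \<in> carrier S \<Longrightarrow> Q * \<rho> s * P = four_block_mat (A s) (B s) (0\<^sub>m q r) (C s)"
      and reps: "representation S r A" "representation S q C" by metis
    from less.IH[OF _ reps(1)] d less.prems(2) obtain \<sigma>s where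
      s: "length \<sigma>s = r" "set \<sigma>s \<subseteq> {triv_b S, triv_t}" "rep_isomorphic S r A (direct_sum_rep \<sigma>s)" by auto
    from less.IH[OF _ reps(2)] d less.prems(2) obtain \<tau>s where
      t: "length \<tau>s = q" "set \<tau>s \<subseteq> {triv_b S, triv_t}" "rep_isomorphic S q C (direct_sum_rep \<tau>s)" by auto
    note dss = ds[OF s(2), unfolded s(1)] and dst = ds[OF t(2), unfolded t(1)]
    have "\<exists>B'. (\<forall>s\<in>carrier S. B' s \<in> carrier_mat r q) \<and>
      rep_isomorphic S (r + q) (\<lambda>s. four_block_mat (A s) (B s) (0\<^sub>m q r) (C s))
       (\<lambda>s. four_block_mat (direct_sum_rep \<sigma>s s) (B' s) (0\<^sub>m q r) (direct_sum_rep \<tau>s s))"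
      by (rule block_isomorphic[OF s(3) t(3)]) (assumption | erule dims | rule dss dst)+
    then obtain B' where B': "\<And>s. s \<in> carrier S \<Longrightarrow> B' s \<in> carrier_mat r q"
      and iso1: "rep_isomorphic S (r + q) (\<lambda>s. four_block_mat (A s) (B s) (0\<^sub>m q r) (C s))
       (\<lambda>s. four_block_mat (direct_sum_rep \<sigma>s s) (B' s) (0\<^sub>m q r) (direct_sum_rep \<tau>s s))" (is "rep_isomorphic _ _ ?R1 ?R2")
      by auto
    have c1: "?R1 s \<in> carrier_mat (r + q) (r + q)" if "s \<in> carrier S" for s using dims[OF that] by auto
    have c2: "?R2 s \<in> carrier_mat (r + q) (r + q)" if "s \<in> carrier S" for s using dss dst by auto
    have iso0: "rep_isomorphic S (r + q) \<rho> ?R1"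
      using rep_isomorphic_conj[OF P, of S \<rho>] representationD(1)[OF \<rho>] blk d(1)
      by (simp add: rep_isomorphic_def)
    have \<rho>': "representation S (r + q) \<rho>" using \<rho> d by simp
    have iso: "rep_isomorphic S (r + q) \<rho> ?R2"
      by (rule rep_isomorphic_trans[OF iso0 iso1 representationD(1)[OF \<rho>'] c1 c2])
    have R2: "representation S (r + q) ?R2"
      by (rule representation_isomorphic[OF monoid_axioms \<rho>' iso c2])
    have iso2: "rep_isomorphic S (r + q) ?R2 (direct_sum_rep (\<sigma>s @ \<tau>s))"
      by (rule trivial_extension_splits[OF s(2) t(2) s(1) t(1) B' R2])
    have c3: "direct_sum_rep (\<sigma>s @ \<tau>s) s' \<in> carrier_mat (r + q) (r + q)" for s'
      using ds[of "\<sigma>s @ \<tau>s" s'] s t by simp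
    have "rep_isomorphic S (r + q) \<rho> (direct_sum_rep (\<sigma>s @ \<tau>s))"
      by (rule rep_isomorphic_trans[OF iso iso2 representationD(1)[OF \<rho>'] c2 c3])
    then show ?thesis using s t d by (intro exI[of _ "\<sigma>s @ \<tau>s"]) auto
  qed
qed

end

section \<open>Monoids whose cells form a chain\<close>

text \<open>
The cells are the fibres of \<open>level\<close>, small levels being large in the cell order, and \<open>E l\<close> is an
idempotent of level \<open>l\<close> whose local monoid has no element of level \<open>l\<close> besides \<open>E l\<close>.
\<close>

locale cell_chain = monoid S for S (structure) +
  fixes level :: "'a \<Rightarrow> nat" and E :: "nat \<Rightarrow> 'a"
  assumes fin: "finite (carrier S)"
    and level_mult: "\<lbrakk>x \<in> carrier S; y \<in> carrier S\<rbrakk> \<Longrightarrow> level (x \<otimes> y) \<le> level x"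
      "\<lbrakk>x \<in> carrier S; y \<in> carrier S\<rbrakk> \<Longrightarrow> level (x \<otimes> y) \<le> level y"
    and level_one: "\<lbrakk>x \<in> carrier S; level x = level \<one>\<rbrakk> \<Longrightarrow> x = \<one>"
    and E: "l \<in> level ` carrier S \<Longrightarrow> E l \<in> carrier S" "l \<in> level ` carrier S \<Longrightarrow> level (E l) = l"
    and E_mult: "\<lbrakk>l \<in> level ` carrier S; l' \<in> level ` carrier S; l \<le> l'\<rbrakk> \<Longrightarrow> E l' \<otimes> E l = E l"
    and down: "a \<in> carrier S \<Longrightarrow> \<exists>x\<in>carrier S. \<exists>y\<in>carrier S. E (level a) = x \<otimes> a \<otimes> y"
    and up: "a \<in> carrier S \<Longrightarrow> \<exists>x\<in>carrier S. \<exists>y\<in>carrier S. a = x \<otimes> E (level a) \<otimes> y"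
    and corner: "\<lbrakk>l \<in> level ` carrier S; s \<in> carrier S; level (E l \<otimes> s \<otimes> E l) = l\<rbrakk> \<Longrightarrow> E l \<otimes> s \<otimes> E l = E l"
begin

abbreviation "\<Lambda> \<equiv> level ` carrier S"

definition J :: "nat \<Rightarrow> 'a set" where
  "J l = {a \<in> carrier S. level a = l}"

definition bottom_level :: nat where "bottom_level = Min \<Lambda>"

definition top_level :: nat where "top_level = level \<one>"

lemma fin_\<Lambda>: "finite \<Lambda>" using fin by simp

lemma bottom_in: "bottom_level \<in> \<Lambda>" unfolding bottom_level_def using fin_\<Lambda> one_closed by (intro Min_in) auto

lemma bottom_le: "l \<in> \<Lambda> \<Longrightarrow> bottom_level \<le> l" unfolding bottom_level_def using fin_\<Lambda> by simp

lemma top_in: "top_level \<in> \<Lambda>" by (auto simp: top_level_def)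

lemma le_top: "l \<in> \<Lambda> \<Longrightarrow> l \<le> top_level"
  using level_mult(1)[of \<one>] by (auto simp: top_level_def)

lemma E_top: "E top_level = \<one>"
  using level_one[OF E(1)[OF top_in]] E(2)[OF top_in] by (simp add: top_level_def)

lemma E_in_J: "l \<in> \<Lambda> \<Longrightarrow> E l \<in> J l" using E by (auto simp: J_def)

lemma J_inj: "l \<in> \<Lambda> \<Longrightarrow> J l = J l' \<Longrightarrow> l = l'" using E_in_J[of l] by (auto simp: J_def)

lemma lr_le_iff_level: "a \<in> carrier S \<Longrightarrow> b \<in> carrier S \<Longrightarrow> level a = level b \<Longrightarrow> lr_le S a b"
proof -
  assume a: "a \<in> carrier S" and b: "b \<in> carrier S" and eq: "level a = level b"
  obtain x y where xy: "x \<in> carrier S" "y \<in> carrier S" "E (level a) = x \<otimes> a \<otimes> y" using down[OF a] by auto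
  obtain x' y' where xy': "x' \<in> carrier S" "y' \<in> carrier S" "b = x' \<otimes> E (level a) \<otimes> y'" using up[OF b] eq by auto
  have "b = (x' \<otimes> x) \<otimes> a \<otimes> (y \<otimes> y')" unfolding xy'(3) xy(3) using xy(1,2) xy'(1,2) a by (simp add: m_assoc)
  then show ?thesis unfolding lr_le_def using xy(1,2) xy'(1,2) by blast
qed

lemma lr_le_level: "a \<in> carrier S \<Longrightarrow> lr_le S a b \<Longrightarrow> level b \<le> level a"
  unfolding lr_le_def using level_mult by (metis m_closed order_trans)

lemma J_cells_eq: "J_cells S = J ` \<Lambda>"
proof -
  have "{(a, b). a \<in> carrier S \<and> b \<in> carrier S \<and> lr_le S a b \<and> lr_le S b a}
      = {(a, b). a \<in> carrier S \<and> b \<in> carrier S \<and> level a = level b}"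
    using lr_le_iff_level lr_le_level by (auto intro: antisym)
  then have "J_cells S = (\<lambda>a. {b \<in> carrier S. level a = level b}) ` carrier S"
    unfolding J_cells_def quotient_def by auto
  then show ?thesis unfolding J_def by (auto simp: image_image intro!: image_eqI)
qed

lemma cell_le_iff:
  assumes "l \<in> \<Lambda>" "l' \<in> \<Lambda>"
  shows "cell_le S (J l) (J l') \<longleftrightarrow> l' \<le> l"
proof
  assume "cell_le S (J l) (J l')"
  then show "l' \<le> l" using lr_le_level by (auto simp: cell_le_def J_def)
next
  assume "l' \<le> l"
  then have "E l' = \<one> \<otimes> E l \<otimes> E l'" using E_mult[OF assms(2,1)] E assms by simp
  then have "lr_le S (E l) (E l')" unfolding lr_le_def using E assms by blast
  then show "cell_le S (J l) (J l')" using E_in_J assms by (auto simp: cell_le_def)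
qed

lemma rep_zero_iff:
  assumes \<rho>: "representation S d (\<rho> :: 'a \<Rightarrow> 'k::field mat)" and a: "a \<in> carrier S"
  shows "\<rho> a = 0\<^sub>m d d \<longleftrightarrow> \<rho> (E (level a)) = 0\<^sub>m d d"
proof -
  note c = representationD(1)[OF \<rho>] and m = representationD(3)[OF \<rho>]
  have Ec: "E (level a) \<in> carrier S" using a E by simp
  obtain x y where xy: "x \<in> carrier S" "y \<in> carrier S" "E (level a) = x \<otimes> a \<otimes> y" using down[OF a] by auto
  obtain x' y' where xy': "x' \<in> carrier S" "y' \<in> carrier S" "a = x' \<otimes> E (level a) \<otimes> y'" using up[OF a] by auto
  have zero: "\<rho> (u \<otimes> b \<otimes> v) = 0\<^sub>m d d"
    if "u \<in> carrier S" "b \<in> carrier S" "v \<in> carrier S" "\<rho> b = 0\<^sub>m d d" for u b v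
    using that m[of "u \<otimes> b" v] m[of u b] right_mult_zero_mat[OF c[of u], of d] left_mult_zero_mat[OF c[of v], of d]
    by simp
  show ?thesis
    using zero[OF xy(1) a xy(2), folded xy(3)] zero[OF xy'(1) Ec xy'(2), folded xy'(3)] by blast
qed

lemma annihilator_disjoint:
  assumes \<rho>: "representation S d (\<rho> :: 'a \<Rightarrow> 'k::field mat)" and l: "l \<in> \<Lambda>"
  shows "J l \<inter> annihilator S d \<rho> = {} \<longleftrightarrow> \<rho> (E l) \<noteq> 0\<^sub>m d d"
proof -
  have "\<rho> a = 0\<^sub>m d d \<longleftrightarrow> \<rho> (E l) = 0\<^sub>m d d" if "a \<in> J l" for a
  proof -
    from that have "a \<in> carrier S" "level a = l" by (auto simp: J_def)
    then show ?thesis using rep_zero_iff[OF \<rho>, of a] by blast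
  qed
  moreover have "J l \<subseteq> carrier S" by (auto simp: J_def)
  ultimately show ?thesis using E_in_J[OF l] unfolding annihilator_def by blast
qed

text \<open>
In a chain of cells the cells on which a representation does not vanish are those above a certain
level, so the apex is the cell of this level.
\<close>

lemma is_apex_iff:
  assumes \<rho>: "representation S d (\<rho> :: 'a \<Rightarrow> 'k::field mat)" and l: "l \<in> \<Lambda>"
  shows "is_apex S d \<rho> (J l) \<longleftrightarrow> \<rho> (E l) \<noteq> 0\<^sub>m d d \<and> (\<forall>l'\<in>\<Lambda>. l' < l \<longrightarrow> \<rho> (E l') = 0\<^sub>m d d)"
proof -
  have max: "maximal_unannihilated S d \<rho> (J m) \<longleftrightarrow>
      \<rho> (E m) \<noteq> 0\<^sub>m d d \<and> (\<forall>l'\<in>\<Lambda>. l' < m \<longrightarrow> \<rho> (E l') = 0\<^sub>m d d)" if m: "m \<in> \<Lambda>" for m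
  proof -
    have "(\<forall>J'\<in>J_cells S. J' \<inter> annihilator S d \<rho> = {} \<and> cell_le S (J m) J' \<longrightarrow> J' = J m)
        \<longleftrightarrow> (\<forall>l'\<in>\<Lambda>. J l' \<inter> annihilator S d \<rho> = {} \<and> cell_le S (J m) (J l') \<longrightarrow> J l' = J m)"
      unfolding J_cells_eq by blast
    also have "\<dots> \<longleftrightarrow> (\<forall>l'\<in>\<Lambda>. \<rho> (E l') \<noteq> 0\<^sub>m d d \<and> l' \<le> m \<longrightarrow> l' = m)"
    proof (intro ball_cong refl)
      fix l' assume l': "l' \<in> \<Lambda>"
      have "J l' = J m \<longleftrightarrow> l' = m" using J_inj[OF l'] by blast
      then show "(J l' \<inter> annihilator S d \<rho> = {} \<and> cell_le S (J m) (J l') \<longrightarrow> J l' = J m)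
          \<longleftrightarrow> (\<rho> (E l') \<noteq> 0\<^sub>m d d \<and> l' \<le> m \<longrightarrow> l' = m)"
        by (simp only: annihilator_disjoint[OF \<rho> l'] cell_le_iff[OF m l'])
    qed
    also have "\<dots> \<longleftrightarrow> (\<forall>l'\<in>\<Lambda>. l' < m \<longrightarrow> \<rho> (E l') = 0\<^sub>m d d)"
      by (metis le_less less_irrefl)
    finally have "(\<forall>J'\<in>J_cells S. J' \<inter> annihilator S d \<rho> = {} \<and> cell_le S (J m) J' \<longrightarrow> J' = J m)
      \<longleftrightarrow> (\<forall>l'\<in>\<Lambda>. l' < m \<longrightarrow> \<rho> (E l') = 0\<^sub>m d d)" .
    moreover have "J m \<in> J_cells S" using m unfolding J_cells_eq by blast
    ultimately show ?thesis
      unfolding maximal_unannihilated_def using annihilator_disjoint[OF \<rho> m] by blast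
  qed
  have "J' = J l" if "maximal_unannihilated S d \<rho> (J l)" "maximal_unannihilated S d \<rho> J'" for J'
  proof -
    have "J' \<in> J ` \<Lambda>" using that(2) unfolding maximal_unannihilated_def J_cells_eq by simp
    then obtain m where m: "m \<in> \<Lambda>" "J' = J m" by auto
    have "\<not> l < m" "\<not> m < l" using that max[OF l] max[OF m(1)] m l by blast+
    then show ?thesis using m by simp
  qed
  then show ?thesis unfolding is_apex_def using max[OF l] by blast
qed

lemma apex_exists:
  assumes \<rho>: "simple_rep S d (\<rho> :: 'a \<Rightarrow> 'k::field mat)"
  obtains l where "l \<in> \<Lambda>" "is_apex S d \<rho> (J l)"
proof -
  have r: "representation S d \<rho>" and d: "0 < d" using \<rho> by (auto simp: simple_rep_def)
  define l where "l = (LEAST l. l \<in> \<Lambda> \<and> \<rho> (E l) \<noteq> 0\<^sub>m d d)"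
  have "\<rho> (E top_level) $$ (0, 0) = 1" using d representationD(2)[OF r] by (simp add: E_top)
  then have "top_level \<in> \<Lambda> \<and> \<rho> (E top_level) \<noteq> 0\<^sub>m d d" using d top_in by auto
  then have l: "l \<in> \<Lambda> \<and> \<rho> (E l) \<noteq> 0\<^sub>m d d" unfolding l_def by (rule LeastI)
  have "\<rho> (E l') = 0\<^sub>m d d" if "l' \<in> \<Lambda>" "l' < l" for l'
    using not_less_Least[of l' "\<lambda>l. l \<in> \<Lambda> \<and> \<rho> (E l) \<noteq> 0\<^sub>m d d"] that unfolding l_def by blast
  then show ?thesis using that l is_apex_iff[OF r] by blast
qed

lemma apex_zero:
  assumes \<rho>: "representation S d (\<rho> :: 'a \<Rightarrow> 'k::field mat)" and l: "l \<in> \<Lambda>" and "is_apex S d \<rho> (J l)"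
    and s: "s \<in> carrier S" "level s < l"
  shows "\<rho> s = 0\<^sub>m d d"
  using assms(3) s rep_zero_iff[OF \<rho> s(1)] unfolding is_apex_iff[OF \<rho> l] by blast

lemma corner_cases:
  assumes "l \<in> \<Lambda>" "s \<in> carrier S"
  shows "E l \<otimes> s \<otimes> E l = E l \<or> E l \<otimes> s \<otimes> E l \<in> {a \<in> carrier S. level a < l}"
proof -
  note El = E[OF assms(1)]
  have "level (E l \<otimes> s \<otimes> E l) \<le> l" using level_mult(2)[of "E l \<otimes> s" "E l"] El assms(2) by simp
  then show ?thesis using corner[OF assms] El assms(2) by (auto simp: le_less)
qed

lemma E_idem: "l \<in> \<Lambda> \<Longrightarrow> E l \<otimes> E l = E l" using E_mult by blast

lemma apex_dim_unique:
  fixes \<rho> \<sigma> :: "'a \<Rightarrow> 'k::field mat"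
  assumes l: "l \<in> \<Lambda>" and \<rho>: "simple_rep S d \<rho>" "is_apex S d \<rho> (J l)"
    and \<sigma>: "simple_rep S d' \<sigma>" "is_apex S d' \<sigma> (J l)"
  shows "d = d'"
proof -
  have r: "representation S d \<rho>" "representation S d' \<sigma>" using \<rho> \<sigma> by (auto simp: simple_rep_def)
  have n: "\<rho> (E l) \<noteq> 0\<^sub>m d d" "\<sigma> (E l) \<noteq> 0\<^sub>m d' d'"
    using \<rho>(2) \<sigma>(2) is_apex_iff[OF r(1) l] is_apex_iff[OF r(2) l] by auto
  have z: "\<rho> s = 0\<^sub>m d d" "\<sigma> s = 0\<^sub>m d' d'" if "s \<in> {a \<in> carrier S. level a < l}" for s
    using that apex_zero[OF r(1) l \<rho>(2)] apex_zero[OF r(2) l \<sigma>(2)] by auto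
  note simple_rep_corner_dim_le[OF monoid_axioms E(1)[OF l] E_idem[OF l] corner_cases[OF l]]
  note this[OF _ \<rho>(1) n(1) z(1) \<sigma>(1) n(2) z(2)] this[OF _ \<sigma>(1) n(2) z(2) \<rho>(1) n(1) z(1)]
  then show ?thesis by (meson antisym)
qed

lemma simple_dim_eq:
  fixes \<rho> :: "'a \<Rightarrow> 'k::field mat"
  assumes "l \<in> \<Lambda>" "simple_rep S d \<rho>" "is_apex S d \<rho> (J l)"
  shows "simple_dim TYPE('k) S (J l) = d"
  unfolding simple_dim_def using assms apex_dim_unique[OF assms(1)] by (intro the_equality) blast+

lemma simple_dim_attained:
  assumes l: "l \<in> \<Lambda>"
  shows "\<exists>\<rho> :: 'a \<Rightarrow> 'k::field mat. simple_rep S (simple_dim TYPE('k) S (J l)) \<rho>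
    \<and> is_apex S (simple_dim TYPE('k) S (J l)) \<rho> (J l)"
proof -
  have "\<exists>d (\<rho> :: 'a \<Rightarrow> 'k mat). simple_rep S d \<rho> \<and> \<rho> (E l) \<noteq> 0\<^sub>m d d \<and> (\<forall>s\<in>{a \<in> carrier S. level a < l}. \<rho> s = 0\<^sub>m d d)"
    using E[OF l] E_idem[OF l]
    by (intro simple_rep_corner_exists[OF monoid_axioms fin])
      (auto intro: le_less_trans[OF level_mult(1)] le_less_trans[OF level_mult(2)])
  then obtain d and \<rho> :: "'a \<Rightarrow> 'k mat" where \<rho>: "simple_rep S d \<rho>" "\<rho> (E l) \<noteq> 0\<^sub>m d d"
    "\<And>s. s \<in> carrier S \<Longrightarrow> level s < l \<Longrightarrow> \<rho> s = 0\<^sub>m d d" by blast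
  have "is_apex S d \<rho> (J l)"
    using \<rho> E is_apex_iff[of d \<rho> l] l by (auto simp: simple_rep_def)
  then show ?thesis using \<rho>(1) simple_dim_eq[OF l \<rho>(1)] by auto
qed

end

lemma simple_rep_dim_one:
  assumes "representation S 1 (\<rho> :: 'a \<Rightarrow> 'k::field mat)"
  shows "simple_rep S 1 \<rho>"
proof -
  have "W = {0\<^sub>v 1} \<or> W = carrier_vec 1" if W: "invariant_subspace S 1 \<rho> W" for W
  proof (cases "W \<subseteq> {0\<^sub>v 1}")
    case True then show ?thesis using W by (auto simp: invariant_subspace_iff)
  next
    case False
    then obtain w where w: "w \<in> W" "w \<noteq> 0\<^sub>v 1" by auto
    have wc: "w \<in> carrier_vec 1" using W w by (auto simp: invariant_subspace_iff)
    have "w $ 0 \<noteq> 0"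
    proof
      assume "w $ 0 = 0"
      then have "w = 0\<^sub>v 1" using wc by (intro eq_vecI) auto
      with w(2) show False ..
    qed
    then have line: "x = (x $ 0 / w $ 0) \<cdot>\<^sub>v w" if "x \<in> carrier_vec 1" for x
      using that wc by (intro eq_vecI) auto
    have "c \<cdot>\<^sub>v w \<in> W" for c using w(1) W by (simp add: invariant_subspace_iff)
    then have "x \<in> W" if "x \<in> carrier_vec 1" for x by (subst line[OF that])
    then show ?thesis using W by (auto simp: invariant_subspace_iff)
  qed
  then show ?thesis using assms by (simp add: simple_rep_def)
qed

text \<open>
The connectedness conditions of \<open>connected_monoid\<close>, with the absorbing element supplied by the
idempotent of the minimal ideal.
\<close>

locale connected_cell_chain = cell_chain S level E for S (structure) and level E +
  assumes factor: "s \<in> carrier S - {\<one>} \<Longrightarrow> \<exists>x\<in>carrier S - {\<one>}. \<exists>y\<in>carrier S - {\<one>}. s = x \<otimes> y"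
    and right_connected: "\<lbrakk>equivp R; \<And>s x. s \<in> carrier S - {\<one>} \<Longrightarrow> x \<in> carrier S - {\<one>} \<Longrightarrow> R s (s \<otimes> x)\<rbrakk>
      \<Longrightarrow> s \<in> carrier S - {\<one>} \<Longrightarrow> t \<in> carrier S - {\<one>} \<Longrightarrow> R s t"
    and left_connected: "\<lbrakk>equivp R; \<And>s x. s \<in> carrier S - {\<one>} \<Longrightarrow> x \<in> carrier S - {\<one>} \<Longrightarrow> R s (x \<otimes> s)\<rbrakk>
      \<Longrightarrow> s \<in> carrier S - {\<one>} \<Longrightarrow> t \<in> carrier S - {\<one>} \<Longrightarrow> R s t"
    and middle_cell: "\<Lambda> - {bottom_level, top_level} \<noteq> {}"
begin

lemma bottom_less_top: "bottom_level < top_level"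
proof -
  obtain l where "l \<in> \<Lambda>" "l \<noteq> bottom_level" using middle_cell by blast
  then have "bottom_level < l" "l \<le> top_level" using bottom_le[of l] le_top[of l] by auto
  then show ?thesis by simp
qed

lemma E_absorb: "x \<in> carrier S \<Longrightarrow> E bottom_level \<otimes> x \<otimes> E bottom_level = E bottom_level"
  using corner_cases[OF bottom_in, of x] bottom_le[of "level (E bottom_level \<otimes> x \<otimes> E bottom_level)"] by auto

lemma E_bottom_nonunit: "E bottom_level \<in> carrier S - {\<one>}"
  using E[OF bottom_in] bottom_less_top by (auto simp: top_level_def)

sublocale connected_monoid S "carrier S - {\<one>}" "E bottom_level"
proof
  show "x = \<one>" if "x \<in> carrier S" "y \<in> carrier S" "x \<otimes> y = \<one>" for x y
    using that level_mult(1)[of x y] le_top[of "level x"] by (intro level_one) (auto simp: top_level_def)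
  show "\<exists>x\<in>carrier S - {\<one>}. \<exists>y\<in>carrier S - {\<one>}. s = x \<otimes> y" if "s \<in> carrier S - {\<one>}" for s
    by (rule factor[OF that])
  show "E bottom_level \<in> carrier S - {\<one>}" by (rule E_bottom_nonunit)
  show "E bottom_level \<otimes> x \<otimes> E bottom_level = E bottom_level" if "x \<in> carrier S" for x by (rule E_absorb[OF that])
qed (fact refl right_connected left_connected)+

definition min_dim :: "'k::field itself \<Rightarrow> nat" where
  "min_dim K = Min ((\<lambda>l. simple_dim K S (J l)) ` (\<Lambda> - {bottom_level, top_level}))"

lemma representation_triv_t: "representation S 1 (triv_t :: 'a \<Rightarrow> 'k::field mat)"
  by (auto simp: representation_def triv_t_def)

lemma representation_triv_b: "representation S 1 (triv_b S :: 'a \<Rightarrow> 'k::field mat)"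
proof -
  have "triv_b S (s \<otimes> t) = (triv_b S s * triv_b S t :: 'k mat)" if "s \<in> carrier S" "t \<in> carrier S" for s t
    using that unit_free[of s t] by (auto simp: triv_b_def Units_trivial)
  then show ?thesis by (auto simp: representation_def triv_b_def)
qed

lemma small_simple_trivial:
  assumes \<rho>: "simple_rep S d (\<rho> :: 'a \<Rightarrow> 'k::field mat)" and d: "d < min_dim TYPE('k)"
  shows "d = 1 \<and> (\<exists>\<sigma>\<in>{triv_b S, triv_t}. \<forall>s\<in>carrier S. \<rho> s = \<sigma> s)"
proof -
  have one_ne_zero: "(1\<^sub>m 1 :: 'k mat) \<noteq> 0\<^sub>m 1 1"
  proof
    assume "(1\<^sub>m 1 :: 'k mat) = 0\<^sub>m 1 1"
    from arg_cong[OF this, of "\<lambda>A. A $$ (0, 0)"] show False by simp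
  qed
  obtain l where l: "l \<in> \<Lambda>" and apex: "is_apex S d \<rho> (J l)" using apex_exists[OF \<rho>] .
  have "l \<notin> \<Lambda> - {bottom_level, top_level}"
  proof
    assume "l \<in> \<Lambda> - {bottom_level, top_level}"
    then have "min_dim TYPE('k) \<le> simple_dim TYPE('k) S (J l)"
      unfolding min_dim_def using fin_\<Lambda> by (intro Min_le) auto
    then show False using d simple_dim_eq[OF l \<rho> apex] by simp
  qed
  then have "l = bottom_level \<or> l = top_level" using l by blast
  then show ?thesis
  proof
    assume lb: "l = bottom_level"
    have "is_apex S 1 (triv_t :: 'a \<Rightarrow> 'k mat) (J bottom_level)"
      unfolding is_apex_iff[OF representation_triv_t bottom_in] triv_t_def
      using one_ne_zero bottom_le leD by blast
    then have d1: "d = 1"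
      using apex_dim_unique[OF l \<rho> apex simple_rep_dim_one[OF representation_triv_t]] lb by simp
    have r: "representation S 1 \<rho>" using \<rho> d1 by (simp add: simple_rep_def)
    have mult: "\<rho> (s \<otimes> t) $$ (0, 0) = \<rho> s $$ (0, 0) * \<rho> t $$ (0, 0)" if "s \<in> carrier S" "t \<in> carrier S" for s t
      using representationD(3)[OF r that] representationD(1)[OF r that(1)] representationD(1)[OF r that(2)]
      by (simp add: scalar_prod_def)
    define c where "c = \<rho> (E bottom_level) $$ (0, 0)"
    have "c \<noteq> 0"
    proof
      assume "c = 0"
      then have "\<rho> (E bottom_level) = 0\<^sub>m 1 1"
        using representationD(1)[OF r E(1)[OF bottom_in]] by (intro eq_matI) (auto simp: c_def)
      then show False using apex is_apex_iff[OF r bottom_in] lb d1 by simp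
    qed
    have Eb: "E bottom_level \<in> carrier S" using E(1)[OF bottom_in] .
    have "c = c * c" using mult[OF Eb Eb] E_idem[OF bottom_in] by (simp add: c_def)
    then have c1: "c = 1" using \<open>c \<noteq> 0\<close> by simp
    have "\<rho> s = triv_t s" if s: "s \<in> carrier S" for s
    proof -
      have "c * \<rho> s $$ (0, 0) * c = c"
        using mult[of "E bottom_level \<otimes> s" "E bottom_level"] mult[OF Eb s] E_absorb[OF s] Eb s by (simp add: c_def)
      then show ?thesis using c1 representationD(1)[OF r s] by (intro eq_matI) (auto simp: triv_t_def)
    qed
    then show ?thesis using d1 by blast
  next
    assume lt: "l = top_level"
    have tb: "triv_b S s = (0\<^sub>m 1 1 :: 'k mat)" if "s \<in> carrier S" "s \<noteq> \<one>" for s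
      using that triv_b_simps(2) by blast
    have lev: "E l' \<noteq> \<one>" if l': "l' < top_level" "l' \<in> \<Lambda>" for l'
    proof
      assume "E l' = \<one>"
      then have "top_level = l'" using E(2)[OF l'(2)] unfolding top_level_def by argo
      then show False using l' by simp
    qed
    have "is_apex S 1 (triv_b S :: 'a \<Rightarrow> 'k mat) (J top_level)"
      unfolding is_apex_iff[OF representation_triv_b top_in] E_top
      unfolding triv_b_simps(1) using one_ne_zero tb[OF E(1) lev] by simp
    then have d1: "d = 1"
      using apex_dim_unique[OF l \<rho> apex simple_rep_dim_one[OF representation_triv_b]] lt by simp
    have r: "representation S 1 \<rho>" using \<rho> d1 by (simp add: simple_rep_def)
    have "\<rho> s = triv_b S s" if s: "s \<in> carrier S" for s
    proof (cases "s = \<one>")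
      case True then show ?thesis using representationD(2)[OF r] by (simp add: triv_b_simps(1))
    next
      case False
      then have "level s < top_level" using level_one[OF s] le_top[of "level s"] s by (auto simp: top_level_def le_less)
      then have "\<rho> s = 0\<^sub>m 1 1" using apex_zero[OF r l _ s] apex d1 lt by simp
      then show ?thesis using tb[OF s False] by simp
    qed
    then show ?thesis using d1 by blast
  qed
qed

lemma min_dim_attained:
  obtains l where "l \<in> \<Lambda> - {bottom_level, top_level}" "min_dim TYPE('k::field) = simple_dim TYPE('k) S (J l)"
proof -
  have "min_dim TYPE('k) \<in> (\<lambda>l. simple_dim TYPE('k) S (J l)) ` (\<Lambda> - {bottom_level, top_level})"
    unfolding min_dim_def using fin_\<Lambda> middle_cell by (intro Min_in) auto
  then show ?thesis using that by auto
qed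

lemma not_m_trivial:
  assumes "min_dim TYPE('k::field) \<le> m"
  shows "\<not> m_trivial TYPE('k) S m"
proof
  assume triv: "m_trivial TYPE('k) S m"
  obtain l where l: "l \<in> \<Lambda> - {bottom_level, top_level}" and D: "min_dim TYPE('k) = simple_dim TYPE('k) S (J l)"
    using min_dim_attained .
  define d where "d = simple_dim TYPE('k) S (J l)"
  have l': "l \<in> \<Lambda>" using l by simp
  obtain \<rho> :: "'a \<Rightarrow> 'k mat" where \<rho>: "simple_rep S d \<rho>" "is_apex S d \<rho> (J l)"
    using simple_dim_attained[OF l'] unfolding d_def by blast
  have r: "representation S d \<rho>" using \<rho>(1) by (simp add: simple_rep_def)
  have "d \<le> m" using assms D by (simp add: d_def)
  then obtain \<sigma>s where s: "set \<sigma>s \<subseteq> {triv_b S, triv_t}"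
    and iso: "rep_isomorphic S d \<rho> (direct_sum_rep \<sigma>s)"
    using triv r unfolding m_trivial_def by blast
  have const: "direct_sum_rep \<sigma>s s = direct_sum_rep \<sigma>s t" if "s \<in> carrier S - {\<one>}" "t \<in> carrier S - {\<one>}" for s t
  proof -
    have "map (\<lambda>\<sigma>. \<sigma> s) \<sigma>s = map (\<lambda>\<sigma>. \<sigma> t) \<sigma>s"
      using s that by (auto simp: triv_b_simps triv_t_def)
    then show ?thesis unfolding direct_sum_rep_def by (rule arg_cong)
  qed
  have El: "E l \<in> carrier S - {\<one>}" using E[OF l'] l by (auto simp: top_level_def)
  obtain P Q where P: "P \<in> carrier_mat d d" "Q \<in> carrier_mat d d" "P * Q = 1\<^sub>m d" "Q * P = 1\<^sub>m d"
    "\<And>s. s \<in> carrier S \<Longrightarrow> P * \<rho> s = direct_sum_rep \<sigma>s s * P"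
    using rep_isomorphicE[OF iso] by blast
  have "P * \<rho> (E l) = P * \<rho> (E bottom_level)"
    using P(5) El E_bottom_nonunit const[OF El E_bottom_nonunit] by simp
  then have "Q * P * \<rho> (E l) = Q * P * \<rho> (E bottom_level)"
    using assoc_mult_mat[OF P(2,1) representationD(1)[OF r]] El E_bottom_nonunit by simp
  then have "\<rho> (E l) = \<rho> (E bottom_level)"
    using P(4) left_mult_one_mat[OF representationD(1)[OF r]] El E_bottom_nonunit by simp
  moreover have "bottom_level < l" using l bottom_le[OF l'] by auto
  ultimately show False using \<rho>(2) bottom_in unfolding is_apex_iff[OF r l'] by auto
qed

lemma m_trivial_below:
  assumes "m < min_dim TYPE('k::field)"
  shows "m_trivial TYPE('k) S m"
  unfolding m_trivial_def
  using trivial_if_simples_trivial[where D = "min_dim TYPE('k)", OF small_simple_trivial] assms by fastforce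

lemma not_exceptional: "\<not> exceptional_monoid S"
proof
  assume ex: "exceptional_monoid S"
  obtain l where l: "l \<in> \<Lambda>" "l \<noteq> bottom_level" "l \<noteq> top_level" using middle_cell by auto
  have "E l \<noteq> E bottom_level" "E l \<noteq> \<one>" "E bottom_level \<noteq> \<one>" "E l \<in> carrier S" "E bottom_level \<in> carrier S"
    using E[OF l(1)] E[OF bottom_in] l(2,3) E_bottom_nonunit by (auto simp: top_level_def)
  then show False using ex unfolding exceptional_monoid_def by auto
qed

theorem rep_gap_eq_min_dim: "rep_gap TYPE('k::field) S = min_dim TYPE('k)"
proof -
  obtain l where l: "l \<in> \<Lambda> - {bottom_level, top_level}" and D: "min_dim TYPE('k) = simple_dim TYPE('k) S (J l)"
    using min_dim_attained .
  then have pos: "0 < min_dim TYPE('k)"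
    using simple_dim_attained[of l, where 'k = 'k] by (auto simp: simple_rep_def)
  have "(GREATEST m. 0 < m \<and> m_trivial TYPE('k) S (m - 1)) = min_dim TYPE('k)"
  proof (rule Greatest_equality)
    show "0 < min_dim TYPE('k) \<and> m_trivial TYPE('k) S (min_dim TYPE('k) - 1)"
      using pos m_trivial_below[of "min_dim TYPE('k) - 1", where 'k = 'k] by simp
    show "m \<le> min_dim TYPE('k)" if "0 < m \<and> m_trivial TYPE('k) S (m - 1)" for m
      using that not_m_trivial[of "m - 1", where 'k = 'k] by (cases "min_dim TYPE('k) \<le> m - 1") auto
  qed
  then show ?thesis using not_exceptional by (simp add: rep_gap_def)
qed

end

section \<open>Contracting adjacent points of a noncrossing matching\<close>

text \<open>
A perfect matching as a fixed point free involution. That arcs do not cross is expressed by the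
condition that the partner of a point below an arc lies below the same arc.
\<close>

definition nc_matching :: "nat set \<Rightarrow> (nat \<Rightarrow> nat) \<Rightarrow> bool" where
  "nc_matching V f \<longleftrightarrow> (\<forall>x\<in>V. f x \<in> V \<and> f x \<noteq> x \<and> f (f x) = x \<and>
     (\<forall>y\<in>V. x < y \<and> y < f x \<longrightarrow> x < f y \<and> f y < f x))"

definition contract :: "(nat \<Rightarrow> nat) \<Rightarrow> nat \<Rightarrow> nat \<Rightarrow> nat \<Rightarrow> nat" where
  "contract f x y u = (if f u = x then f y else if f u = y then f x else f u)"

lemma nc_matchingD:
  assumes "nc_matching V f" "x \<in> V"
  shows "f x \<in> V" "f x \<noteq> x" "f (f x) = x" "y \<in> V \<Longrightarrow> x < y \<Longrightarrow> y < f x \<Longrightarrow> x < f y \<and> f y < f x"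
  using assms by (auto simp: nc_matching_def)

lemma nc_matching_contract:
  assumes f: "nc_matching V f" and x: "x \<in> V" and y: "y \<in> V" and xy: "x < y"
    and adj: "\<And>v. v \<in> V \<Longrightarrow> v \<le> x \<or> y \<le> v"
  shows "nc_matching (V - {x, y}) (contract f x y)"
  unfolding nc_matching_def
proof (intro ballI conjI allI impI)
  note D = nc_matchingD[OF f]
  have inj: "f a = f b \<longleftrightarrow> a = b" if "a \<in> V" "b \<in> V" for a b using D(3) that by metis
  fix u assume u: "u \<in> V - {x, y}"
  then have uV: "u \<in> V" by simp
  consider (c0) "f u \<noteq> x" "f u \<noteq> y" | (c1) "f u = x" "f x = u" | (c2) "f u = y" "f y = u"
    using D(3)[OF uV] by blast
  then have "contract f x y u \<in> V - {x, y} \<and> contract f x y u \<noteq> u \<and> contract f x y (contract f x y u) = u"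
  proof cases
    case c0
    then have "contract f x y u = f u" by (simp add: contract_def)
    then show ?thesis using c0 D(1-3)[OF uV] u by (simp add: contract_def)
  next
    case c1
    have "f y \<noteq> x" "f y \<noteq> u" using c1 D(3)[OF y] D(3)[OF uV] u xy by auto
    then show ?thesis using c1 D(1-3)[OF y] xy by (simp add: contract_def)
  next
    case c2
    have "f x \<noteq> y" "f x \<noteq> u" using c2 D(3)[OF x] D(3)[OF uV] u xy by auto
    then show ?thesis using c2 D(1-3)[OF x] xy by (simp add: contract_def)
  qed
  then show "contract f x y u \<in> V - {x, y}" "contract f x y u \<noteq> u"
    "contract f x y (contract f x y u) = u" by auto
  fix w assume w: "w \<in> V - {x, y}" and uw: "u < w \<and> w < contract f x y u"
  then have wV: "w \<in> V" by simp
  have P: "a < b \<Longrightarrow> b < f a \<Longrightarrow> a < f b \<and> f b < f a" if "a \<in> V" "b \<in> V" for a b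
    using D(4)[OF that] .
  note mem = uV wV x y D(1)[OF uV] D(1)[OF wV] D(1)[OF x] D(1)[OF y]
  note inv = D(3)[OF uV] D(3)[OF wV] D(3)[OF x] D(3)[OF y]
  have A: "a < x \<or> y < a" if "a \<in> V" "a \<noteq> x" "a \<noteq> y" for a using adj[OF that(1)] that by linarith
  note Au = A[OF uV] A[OF wV] A[OF mem(5)] A[OF mem(6)] A[OF mem(7)] A[OF mem(8)]
  consider (none) "f u \<noteq> x" "f u \<noteq> y" "f w \<noteq> x" "f w \<noteq> y"
    | (w1) "f u \<noteq> x" "f u \<noteq> y" "f w = x" | (w2) "f u \<noteq> x" "f u \<noteq> y" "f w = y"
    | (u1) "f u = x" | (u2) "f u = y" by blast
  then show "u < contract f x y w" "contract f x y w < contract f x y u"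
  proof (atomize (full), cases)
    case none
    then show "u < contract f x y w \<and> contract f x y w < contract f x y u"
      using P[OF uV wV] uw by (auto simp: contract_def)
  next
    case w1
    then have "u < w" "w < f u" using uw by (auto simp: contract_def)
    then have "u < x" "x < f u" using P[OF uV wV] w1 by auto
    then have "u < y" "y < f u" using Au(3) w1 xy by auto
    then show "u < contract f x y w \<and> contract f x y w < contract f x y u"
      using P[OF uV y] w1 by (auto simp: contract_def)
  next
    case w2
    then have "u < w" "w < f u" using uw xy by (auto simp: contract_def)
    then have "u < y" "y < f u" using P[OF uV wV] w2 by auto
    then have "u < x" "x < f u" using Au(1) u w2 xy by auto
    then show "u < contract f x y w \<and> contract f x y w < contract f x y u"
      using P[OF uV x] w2 xy by (auto simp: contract_def)
  next
    case u1
    then have fx: "f x = u" using inv by simp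
    have v: "u < w" "w < f y" using uw u1 by (auto simp: contract_def)
    have ne: "f w \<noteq> x" "f w \<noteq> y" using fx v inv by auto
    have ux: "u < x"
    proof (rule ccontr)
      assume "\<not> u < x"
      then have "y < u" using Au(1) u by auto
      then have "f y < u" using P[OF x y] xy fx by auto
      then show False using v by simp
    qed
    have yv: "y < f y"
    proof (rule ccontr)
      assume "\<not> y < f y"
      then have "f y < x" using Au(6) D(2)[OF y] fx inv u by (cases "f y = x") auto
      then have "f y < f x" using P[OF mem(8) x] xy inv by auto
      then show False using fx v by simp
    qed
    have "u < f w \<and> f w < f y"
    proof (cases "w < x")
      case True
      then show ?thesis using P[OF uV wV] v u1 yv xy by auto
    next
      case False
      then have "y < w" using Au(2) w by auto
      then show ?thesis using P[OF y wV] v ux xy by auto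
    qed
    then show "u < contract f x y w \<and> contract f x y w < contract f x y u"
      using ne u1 by (auto simp: contract_def)
  next
    case u2
    then have fy: "f y = u" using inv by simp
    have v: "u < w" "w < f x" using uw u2 xy by (auto simp: contract_def)
    have ne: "f w \<noteq> x" "f w \<noteq> y" using fy v inv by auto
    have "u < f w \<and> f w < f x"
    proof (cases "u < x")
      case True
      then have "f x < y" using P[OF uV x] u2 xy by auto
      then have vx: "f x < x" using Au(5) D(2)[OF x] by auto
      then have 1: "u < f w" "f w < y" using P[OF uV wV] v u2 xy by auto
      then have "f w < x" using Au(4) ne by auto
      then have "f w < f x" using P[OF mem(7) mem(6)] inv v ne
        by (metis linorder_neqE_nat less_asym)
      then show ?thesis using 1 by simp
    next
      case False
      then have yu: "y < u" using Au(1) u by auto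
      then have 1: "x < f w" "f w < f x" using P[OF x wV] v xy by auto
      then have "y < f w" using Au(4) ne by auto
      then have "u < f w" using P[OF y mem(6)] inv v ne fy
        by (metis linorder_neqE_nat less_asym)
      then show ?thesis using 1 by simp
    qed
    then show "u < contract f x y w \<and> contract f x y w < contract f x y u"
      using ne u2 xy by (auto simp: contract_def)
  qed
qed

section \<open>Eliminating points from a reachability problem\<close>

text \<open>
Along a path whose \<open>V\<close>-steps stay in \<open>Y\<close>, the maximal stretches of \<open>U\<close>-steps between
elements of \<open>Y\<close> can be replaced by single steps.
\<close>

lemma rtrancl_eliminate:
  assumes "(x, y) \<in> (U \<union> V)\<^sup>*" "x \<in> Y" "y \<in> Y" and V: "V \<subseteq> Y \<times> Y"
  shows "(x, y) \<in> ((U\<^sup>* \<inter> Y \<times> Y) \<union> V)\<^sup>*"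
proof -
  let ?W = "(U\<^sup>* \<inter> Y \<times> Y) \<union> V"
  have "\<exists>z\<in>Y. (x, z) \<in> ?W\<^sup>* \<and> (z, w) \<in> U\<^sup>*" if "(x, w) \<in> (U \<union> V)\<^sup>*" for w
    using that
  proof (induction rule: rtrancl_induct)
    case base then show ?case using assms(2) by blast
  next
    case (step w w')
    then obtain z where z: "z \<in> Y" "(x, z) \<in> ?W\<^sup>*" "(z, w) \<in> U\<^sup>*" by blast
    from step(2) show ?case
    proof
      assume "(w, w') \<in> U"
      then show ?case using z by (meson rtrancl.rtrancl_into_rtrancl)
    next
      assume ww: "(w, w') \<in> V"
      then have "(z, w) \<in> ?W" using z V by blast
      then have "(x, w') \<in> ?W\<^sup>*" using z(2) ww by (meson UnI2 rtrancl.rtrancl_into_rtrancl)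
      then show ?case using ww V by blast
    qed
  qed
  then obtain z where z: "z \<in> Y" "(x, z) \<in> ?W\<^sup>*" "(z, y) \<in> U\<^sup>*" using assms(1) by blast
  then have "(z, y) \<in> ?W" using assms(3) by blast
  then show ?thesis using z(2) by (meson rtrancl.rtrancl_into_rtrancl)
qed

lemma rtrancl_eliminate_iff:
  assumes "x \<in> Y" "y \<in> Y" "V \<subseteq> Y \<times> Y"
  shows "(x, y) \<in> (U \<union> V)\<^sup>* \<longleftrightarrow> (x, y) \<in> ((U\<^sup>* \<inter> Y \<times> Y) \<union> V)\<^sup>*"
proof
  have "(U\<^sup>* \<inter> Y \<times> Y) \<union> V \<subseteq> (U \<union> V)\<^sup>*" using rtrancl_mono[of U "U \<union> V"] by auto
  then have "((U\<^sup>* \<inter> Y \<times> Y) \<union> V)\<^sup>* \<subseteq> (U \<union> V)\<^sup>*" by (metis rtrancl_idemp rtrancl_mono)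
  then show "(x, y) \<in> ((U\<^sup>* \<inter> Y \<times> Y) \<union> V)\<^sup>* \<Longrightarrow> (x, y) \<in> (U \<union> V)\<^sup>*" by blast
qed (rule rtrancl_eliminate[OF _ assms])

lemma rtrancl_closed:
  assumes "(x, y) \<in> R\<^sup>*" "x \<in> C" "\<And>a b. a \<in> C \<Longrightarrow> (a, b) \<in> R \<Longrightarrow> b \<in> C"
  shows "y \<in> C"
  using assms by (induction rule: rtrancl_induct) auto

abbreviation graph_on :: "nat set \<Rightarrow> (nat \<Rightarrow> nat) \<Rightarrow> (nat \<times> nat) set" where
  "graph_on V f \<equiv> {(a, f a) |a. a \<in> V}"

lemma contract_reach:
  assumes f: "nc_matching V f" and x: "x \<in> V" and y: "y \<in> V" and "x \<noteq> y"
    and u: "u \<in> V - {x, y}" and v: "v \<in> V - {x, y}"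
  shows "(u, v) \<in> (graph_on V f \<union> {(x, y), (y, x)})\<^sup>* \<longleftrightarrow> u = v \<or> v = contract f x y u"
    (is "_ \<in> ?R\<^sup>* \<longleftrightarrow> _")
proof
  note D = nc_matchingD[OF f]
  have uV: "u \<in> V" using u by simp
  have inj: "f a = f b \<longleftrightarrow> a = b" if "a \<in> V" "b \<in> V" for a b using D(3) that by metis
  {
    assume uv: "(u, v) \<in> ?R\<^sup>*"
    \<comment> \<open>the connected component of \<open>u\<close>\<close>
    define C where "C = {u, contract f x y u} \<union> (if f u = x \<or> f u = y then {x, y} else {})"
    have "b \<in> C" if "a \<in> C" "(a, b) \<in> ?R" for a b
      using that u x y D(1-3)[OF uV] D(1-3)[OF x] D(1-3)[OF y] inj[OF uV x] inj[OF uV y] inj[OF x y] \<open>x \<noteq> y\<close>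
      by (auto simp: C_def contract_def split: if_splits)
    then have "v \<in> C" using rtrancl_closed[OF uv, of C] by (auto simp: C_def)
    then show "u = v \<or> v = contract f x y u" using v by (auto simp: C_def split: if_splits)
  }
  assume "u = v \<or> v = contract f x y u"
  then show "(u, v) \<in> ?R\<^sup>*"
  proof
    assume vc: "v = contract f x y u"
    have s: "(a, f a) \<in> ?R" if "a \<in> V" for a using that by blast
    have l: "(x, y) \<in> ?R" "(y, x) \<in> ?R" by auto
    consider "f u = x" | "f u = y" | "f u \<noteq> x" "f u \<noteq> y" by blast
    then show ?thesis
    proof cases
      case 1
      then have "v = f y" using vc by (simp add: contract_def)
      then show ?thesis using s[OF uV] l(1) s[OF y] 1 by (meson converse_rtrancl_into_rtrancl r_into_rtrancl)
    next
      case 2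
      then have "v = f x" using vc \<open>x \<noteq> y\<close> by (simp add: contract_def)
      then show ?thesis using s[OF uV] l(2) s[OF x] 2 by (meson converse_rtrancl_into_rtrancl r_into_rtrancl)
    next
      case 3
      then have "v = f u" using vc by (simp add: contract_def)
      then show ?thesis using s[OF uV] by blast
    qed
  qed simp
qed

text \<open>
The positions \<open>0, ..., 4 n - 1\<close> run along the boundary of the lower diagram of a stack and then
along that of the upper one. The points that are glued on the middle line are mirror images of each
other in the centre of this interval; the first \<open>i\<close> of these pairs are linked.
\<close>

definition links :: "nat \<Rightarrow> nat \<Rightarrow> (nat \<times> nat) set" where
  "links n i = {(2 * n - 1 - j, 2 * n + j) | j. j < i} \<union> {(2 * n + j, 2 * n - 1 - j) | j. j < i}"

text \<open>
Contracting the pairs of glued points from the inside out, each pair is adjacent among the points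
that are left when its turn comes.
\<close>

lemma contract_middle:
  assumes f: "nc_matching {..<4 * n} f" and "i \<le> n"
  shows "\<exists>g. nc_matching ({..<2 * n - i} \<union> {2 * n + i..<4 * n}) g \<and>
    (\<forall>u\<in>{..<2 * n - i} \<union> {2 * n + i..<4 * n}. \<forall>v\<in>{..<2 * n - i} \<union> {2 * n + i..<4 * n}.
      (u, v) \<in> (graph_on {..<4 * n} f \<union> links n i)\<^sup>* \<longleftrightarrow> u = v \<or> v = g u)"
  using \<open>i \<le> n\<close>
proof (induction i)
  case 0
  have V: "{..<2 * n - 0} \<union> {2 * n + 0..<4 * n} = {..<4 * n}" by auto
  have "(u, v) \<in> (graph_on {..<4 * n} f)\<^sup>* \<longleftrightarrow> u = v \<or> v = f u" if u: "u < 4 * n" for u v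
  proof
    assume "(u, v) \<in> (graph_on {..<4 * n} f)\<^sup>*"
    then have "v \<in> {u, f u}"
      by (rule rtrancl_closed) (use nc_matchingD(3)[OF f] u in auto)
    then show "u = v \<or> v = f u" by auto
  qed (use u in auto)
  moreover have "links n 0 = {}" by (auto simp: links_def)
  ultimately show ?case unfolding V using f by (intro exI[of _ f]) auto
next
  case (Suc i)
  define V where "V = {..<2 * n - i} \<union> {2 * n + i..<4 * n}"
  define x where "x = 2 * n - 1 - i"
  define y where "y = 2 * n + i"
  have i: "i < n" using Suc.prems by simp
  have V': "{..<2 * n - Suc i} \<union> {2 * n + Suc i..<4 * n} = V - {x, y}"
    using i by (auto simp: V_def x_def y_def)
  obtain g where g: "nc_matching V g" and reach: "\<And>u v. u \<in> V \<Longrightarrow> v \<in> V \<Longrightarrow>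
      (u, v) \<in> (graph_on {..<4 * n} f \<union> links n i)\<^sup>* \<longleftrightarrow> u = v \<or> v = g u"
    using Suc.IH i unfolding V_def by auto
  have xy: "x \<in> V" "y \<in> V" "x < y" using i by (auto simp: V_def x_def y_def)
  have nc: "nc_matching (V - {x, y}) (contract g x y)"
    by (rule nc_matching_contract[OF g xy]) (auto simp: V_def x_def y_def)
  let ?U = "graph_on {..<4 * n} f \<union> links n i"
  have "links n (Suc i) = links n i \<union> {(x, y), (y, x)}"
    by (auto simp: links_def x_def y_def less_Suc_eq)
  then have U: "graph_on {..<4 * n} f \<union> links n (Suc i) = ?U \<union> {(x, y), (y, x)}" by blast
  have "(u, v) \<in> (?U \<union> {(x, y), (y, x)})\<^sup>* \<longleftrightarrow> u = v \<or> v = contract g x y u"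
    if u: "u \<in> V - {x, y}" and v: "v \<in> V - {x, y}" for u v
  proof -
    have "?U\<^sup>* \<inter> V \<times> V = Id_on V \<union> graph_on V g"
      using reach nc_matchingD(1)[OF g] by auto
    moreover have "(Id_on V \<union> graph_on V g \<union> {(x, y), (y, x)})\<^sup>* = (graph_on V g \<union> {(x, y), (y, x)})\<^sup>*"
    proof (rule rtrancl_subset)
      show "Id_on V \<union> graph_on V g \<union> {(x, y), (y, x)} \<subseteq> (graph_on V g \<union> {(x, y), (y, x)})\<^sup>*" by auto
    qed auto
    moreover have "(u, v) \<in> (?U \<union> {(x, y), (y, x)})\<^sup>* \<longleftrightarrow>
        (u, v) \<in> ((?U\<^sup>* \<inter> V \<times> V) \<union> {(x, y), (y, x)})\<^sup>*"
      by (rule rtrancl_eliminate_iff) (use u v xy in auto)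
    ultimately show ?thesis using contract_reach[OF g xy(1,2) _ u v] xy(3) by simp
  qed
  then show ?case unfolding V' U using nc by blast
qed

section \<open>Diagrams as noncrossing matchings of boundary positions\<close>

definition perfect :: "nat \<Rightarrow> diagram \<Rightarrow> bool" where
  "perfect n D \<longleftrightarrow> partition_on (points n) D \<and> (\<forall>e\<in>D. card e = 2)"

lemma tl_diagrams_iff: "D \<in> tl_diagrams n \<longleftrightarrow> perfect n D \<and> crossingless n D"
  by (auto simp: tl_diagrams_def perfect_def)

lemma perfectI:
  assumes "\<And>e. e \<in> D \<Longrightarrow> \<exists>p q. e = {p, q} \<and> p \<noteq> q \<and> p \<in> points n \<and> q \<in> points n"
    and "\<And>p. p \<in> points n \<Longrightarrow> \<exists>q. {p, q} \<in> D"
    and "\<And>p q r. {p, q} \<in> D \<Longrightarrow> {p, r} \<in> D \<Longrightarrow> q = r"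
  shows "perfect n D"
  unfolding perfect_def
proof
  show "partition_on (points n) D"
  proof (rule partition_onI)
    show "\<Union>D = points n"
    proof
      show "\<Union>D \<subseteq> points n"
      proof
        fix x assume "x \<in> \<Union>D"
        then obtain e where "e \<in> D" "x \<in> e" by blast
        then show "x \<in> points n" using assms(1)[of e] by blast
      qed
      show "points n \<subseteq> \<Union>D" using assms(2) by blast
    qed
    show "{} \<notin> D" using assms(1)[of "{}"] by auto
    show "disjnt e e'" if e: "e \<in> D" "e' \<in> D" "e \<noteq> e'" for e e'
    proof (rule ccontr)
      assume "\<not> disjnt e e'"
      then obtain x where x: "x \<in> e" "x \<in> e'" by (auto simp: disjnt_def)
      obtain y where y: "e = {x, y}" using assms(1)[OF e(1)] x(1) by blast
      obtain z where z: "e' = {x, z}" using assms(1)[OF e(2)] x(2) by blast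
      show False using assms(3)[of x y z] e y z by auto
    qed
  qed
  show "\<forall>e\<in>D. card e = 2"
  proof
    fix e assume "e \<in> D"
    then obtain p q where "e = {p, q}" "p \<noteq> q" using assms(1) by blast
    then show "card e = 2" by simp
  qed
qed

lemma
  assumes "perfect n D"
  shows perfect_edge: "e \<in> D \<Longrightarrow> \<exists>p q. e = {p, q} \<and> p \<noteq> q \<and> p \<in> points n \<and> q \<in> points n"
    and perfect_ex: "p \<in> points n \<Longrightarrow> \<exists>q. {p, q} \<in> D"
    and perfect_unique: "{p, q} \<in> D \<Longrightarrow> {p, r} \<in> D \<Longrightarrow> q = r"
    and perfect_points: "{p, q} \<in> D \<Longrightarrow> p \<in> points n \<and> q \<in> points n \<and> p \<noteq> q"
proof -
  have part: "partition_on (points n) D" and card: "\<And>e. e \<in> D \<Longrightarrow> card e = 2"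
    using assms by (auto simp: perfect_def)
  have U: "\<Union>D = points n" using part by (simp add: partition_on_def)
  have disj: "e = e'" if "e \<in> D" "e' \<in> D" "x \<in> e" "x \<in> e'" for e e' x
    using part that by (auto simp: partition_on_def disjoint_def)
  show edge: "\<exists>p q. e = {p, q} \<and> p \<noteq> q \<and> p \<in> points n \<and> q \<in> points n" if "e \<in> D" for e
  proof -
    note e = that
    obtain p q where "e = {p, q}" "p \<noteq> q" using card[OF e] by (auto simp: card_2_iff)
    then show ?thesis using e U by blast
  qed
  show "p \<in> points n \<Longrightarrow> \<exists>q. {p, q} \<in> D"
  proof -
    assume "p \<in> points n"
    then obtain e where e: "e \<in> D" "p \<in> e" using U by blast
    then show ?thesis using edge[OF e(1)] by (metis insertE insert_commute singletonD)
  qed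
  show pts: "{p, q} \<in> D \<Longrightarrow> p \<in> points n \<and> q \<in> points n \<and> p \<noteq> q" for p q
    using edge[of "{p, q}"] by (auto simp: doubleton_eq_iff)
  show "{p, q} \<in> D \<Longrightarrow> {p, r} \<in> D \<Longrightarrow> q = r"
    using disj[of "{p, q}" "{p, r}" p] pts[of p q] by (auto simp: doubleton_eq_iff)
qed

lemma perfect_subset_eq:
  assumes "perfect n D" "perfect n D'" "\<And>p q. {p, q} \<in> D \<Longrightarrow> {p, q} \<in> D'"
  shows "D = D'"
proof
  show "D \<subseteq> D'" using perfect_edge[OF assms(1)] assms(3) by blast
  show "D' \<subseteq> D"
  proof
    fix e assume "e \<in> D'"
    then obtain p q where e: "e = {p, q}" "{p, q} \<in> D'" "p \<in> points n" using perfect_edge[OF assms(2)] by blast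
    then obtain r where r: "{p, r} \<in> D" using perfect_ex[OF assms(1)] by blast
    then have "r = q" using perfect_unique[OF assms(2)] assms(3) e by blast
    then show "e \<in> D" using r e by simp
  qed
qed

text \<open>
The inverse of \<^const>\<open>boundary_pos\<close>.
\<close>

definition pt :: "nat \<Rightarrow> nat \<Rightarrow> point" where
  "pt n x = (if x < n then (Bottom, x) else (Top, 2 * n - 1 - x))"

lemma pt_points: "x < 2 * n \<Longrightarrow> pt n x \<in> points n"
  by (auto simp: pt_def points_def)

lemma boundary_pos_pt: "x < 2 * n \<Longrightarrow> boundary_pos n (pt n x) = x"
  by (auto simp: pt_def)

lemma boundary_pos_less: "p \<in> points n \<Longrightarrow> boundary_pos n p < 2 * n"
  by (cases p) (auto simp: points_def)

lemma pt_boundary_pos: "p \<in> points n \<Longrightarrow> pt n (boundary_pos n p) = p"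
  by (cases p) (auto simp: points_def pt_def)

lemma pt_inj: "x < 2 * n \<Longrightarrow> y < 2 * n \<Longrightarrow> pt n x = pt n y \<longleftrightarrow> x = y"
  by (metis boundary_pos_pt)

lemma points_eq_pt: "points n = pt n ` {..<2 * n}"
proof
  show "points n \<subseteq> pt n ` {..<2 * n}"
  proof
    fix p assume "p \<in> points n"
    then show "p \<in> pt n ` {..<2 * n}"
      using pt_boundary_pos[of p n] boundary_pos_less[of p n] by (metis image_eqI lessThan_iff)
  qed
qed (auto simp: pt_points)

lemma tl_diagram_matching:
  assumes D: "D \<in> tl_diagrams n"
  obtains f where "nc_matching {..<2 * n} f" "D = {{pt n x, pt n (f x)} | x. x < 2 * n}"
proof -
  have P: "perfect n D" and nc: "crossingless n D" using D by (auto simp: tl_diagrams_iff)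
  define f where "f x = boundary_pos n (SOME q. {pt n x, q} \<in> D)" for x
  have edge: "{pt n x, pt n (f x)} \<in> D" if x: "x < 2 * n" for x
  proof -
    have "{pt n x, SOME q. {pt n x, q} \<in> D} \<in> D"
      using perfect_ex[OF P pt_points[OF x]] by (rule someI_ex)
    then show ?thesis using perfect_points[OF P] pt_boundary_pos by (simp add: f_def)
  qed
  have fless: "f x < 2 * n" if x: "x < 2 * n" for x
    using perfect_ex[OF P pt_points[OF x]] perfect_points[OF P] boundary_pos_less someI_ex
    unfolding f_def by (metis (mono_tags, lifting))
  have ne: "f x \<noteq> x" if "x < 2 * n" for x using perfect_points[OF P edge[OF that]] by auto
  have inv: "f (f x) = x" if x: "x < 2 * n" for x
  proof -
    have "{pt n (f x), pt n x} \<in> D" using edge[OF x] by (simp add: insert_commute)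
    then have "pt n (f (f x)) = pt n x" using perfect_unique[OF P edge[OF fless[OF x]]] by simp
    then show ?thesis using pt_inj fless x by simp
  qed
  have cross: "\<not> (a < b \<and> b < f a \<and> f a < f b)" if "a < 2 * n" "b < 2 * n" for a b
  proof
    assume "a < b \<and> b < f a \<and> f a < f b"
    moreover have "{pt n a, pt n (f a)} \<in> D" "{pt n b, pt n (f b)} \<in> D" using edge that by auto
    ultimately show False using nc that fless unfolding crossingless_def
      by (metis boundary_pos_pt)
  qed
  have "nc_matching {..<2 * n} f"
    unfolding nc_matching_def
  proof (intro ballI conjI allI impI)
    fix x y assume x: "x \<in> {..<2 * n}" and y: "y \<in> {..<2 * n}" and xy: "x < y \<and> y < f x"
    have "f y \<noteq> f x" "f y \<noteq> x" using inv[of x] inv[of y] x y xy by auto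
    moreover have "\<not> f x < f y" using cross[of x y] x y xy by auto
    moreover have "\<not> f y < x"
    proof
      assume "f y < x"
      then show False using cross[of "f y" x] inv[of y] x y xy fless[of y] by auto
    qed
    ultimately show "x < f y" "f y < f x" by auto
  qed (use fless ne inv in auto)
  moreover have "D = {{pt n x, pt n (f x)} | x. x < 2 * n}"
  proof
    show "D \<subseteq> {{pt n x, pt n (f x)} | x. x < 2 * n}"
    proof
      fix e assume "e \<in> D"
      then obtain p q where e: "e = {p, q}" "{p, q} \<in> D" "p \<in> points n"
        using perfect_edge[OF P] by blast
      obtain x where x: "x < 2 * n" "p = pt n x" using e(3) by (auto simp: points_eq_pt)
      then have "q = pt n (f x)" using perfect_unique[OF P e(2)] edge[OF x(1)] by simp
      then show "e \<in> {{pt n x, pt n (f x)} | x. x < 2 * n}" using e x by blast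
    qed
  qed (use edge in auto)
  ultimately show ?thesis using that by blast
qed

lemma matching_tl_diagram:
  assumes f: "nc_matching {..<2 * n} f"
  shows "{{pt n x, pt n (f x)} | x. x < 2 * n} \<in> tl_diagrams n" (is "?D \<in> _")
proof -
  note D = nc_matchingD[OF f, unfolded lessThan_iff]
  have edge: "\<exists>x<2 * n. p = pt n x \<and> q = pt n (f x)" if pq: "{p, q} \<in> ?D" for p q
  proof -
    obtain x where x: "x < 2 * n" "{p, q} = {pt n x, pt n (f x)}" using pq by blast
    then have "p = pt n x \<and> q = pt n (f x) \<or> p = pt n (f x) \<and> q = pt n (f (f x))"
      using D(3) by (auto simp: doubleton_eq_iff)
    then show ?thesis using x(1) D(1) by blast
  qed
  have "perfect n ?D"
  proof (rule perfectI)
    show "\<exists>p q. e = {p, q} \<and> p \<noteq> q \<and> p \<in> points n \<and> q \<in> points n" if e: "e \<in> ?D" for e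
    proof -
      obtain x where "x < 2 * n" "e = {pt n x, pt n (f x)}" using e by blast
      then show ?thesis using D(1,2)[of x] pt_points pt_inj[of x n "f x"] by metis
    qed
    show "\<exists>q. {p, q} \<in> ?D" if "p \<in> points n" for p using that unfolding points_eq_pt by blast
    show "q = r" if q: "{p, q} \<in> ?D" and r: "{p, r} \<in> ?D" for p q r
      using edge[OF q] edge[OF r] pt_inj by metis
  qed
  moreover have "crossingless n ?D"
    unfolding crossingless_def
  proof
    assume "\<exists>p q r s. {p, r} \<in> ?D \<and> {q, s} \<in> ?D \<and> boundary_pos n p < boundary_pos n q \<and>
          boundary_pos n q < boundary_pos n r \<and> boundary_pos n r < boundary_pos n s"
    then obtain p q r s where e: "{p, r} \<in> ?D" "{q, s} \<in> ?D" and
      pos: "boundary_pos n p < boundary_pos n q" "boundary_pos n q < boundary_pos n r" "boundary_pos n r < boundary_pos n s"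
      by blast
    obtain x where x: "x < 2 * n" "p = pt n x" "r = pt n (f x)" using edge[OF e(1)] by blast
    obtain y where y: "y < 2 * n" "q = pt n y" "s = pt n (f y)" using edge[OF e(2)] by blast
    show False using pos D(1,4) x y boundary_pos_pt[of _ n] by (metis less_asym)
  qed
  ultimately show ?thesis by (simp add: tl_diagrams_iff)
qed

section \<open>Closure under stacking\<close>

definition stack_rel :: "diagram \<Rightarrow> diagram \<Rightarrow> (point \<times> point) set" where
  "stack_rel a b = {(x, y). {x, y} \<in> stack a b}"

lemma tl_mult_eq: "tl_mult n a b = {{p, q} | p q. p \<in> points n \<and> q \<in> points n \<and> p \<noteq> q \<and> (p, q) \<in> (stack_rel a b)\<^sup>*}"
  by (simp add: tl_mult_def stack_rel_def)

lemma sym_stack_rel: "sym (stack_rel a b)"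
  by (auto simp: sym_def stack_rel_def insert_commute)

lemma tl_mult_edge: "{p, q} \<in> tl_mult n a b \<longleftrightarrow>
    p \<in> points n \<and> q \<in> points n \<and> p \<noteq> q \<and> (p, q) \<in> (stack_rel a b)\<^sup>*"
    (is "_ \<longleftrightarrow> ?R")
proof
  assume "{p, q} \<in> tl_mult n a b"
  then obtain p' q' where eq: "{p, q} = {p', q'}" and
    R: "p' \<in> points n" "q' \<in> points n" "p' \<noteq> q'" "(p', q') \<in> (stack_rel a b)\<^sup>*"
    unfolding tl_mult_eq by blast
  moreover have "(q', p') \<in> (stack_rel a b)\<^sup>*" using R(4) sym_rtrancl[OF sym_stack_rel] by (rule symD[rotated])
  ultimately show ?R by (auto simp: doubleton_eq_iff)
qed (unfold tl_mult_eq, blast)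

text \<open>
Let \<open>F\<close> be the disjoint union of the two matchings on the positions below \<open>4 n\<close>, and let
\<open>\<iota>\<close> send a position to its point in the stack; it identifies exactly the linked positions. So
connectivity in the stack is reachability along \<open>F\<close> and the links, which on the outer positions is
a noncrossing matching by \<open>contract_middle\<close>. The map \<open>\<kappa>\<close> skips the middle positions.
\<close>

lemma tl_mult_closed:
  assumes a: "a \<in> tl_diagrams n" and b: "b \<in> tl_diagrams n"
  shows "tl_mult n a b \<in> tl_diagrams n"
proof -
  obtain fa where fa: "nc_matching {..<2 * n} fa" and a_eq: "a = {{pt n x, pt n (fa x)} | x. x < 2 * n}"
    using tl_diagram_matching[OF a] .
  obtain fb where fb: "nc_matching {..<2 * n} fb" and b_eq: "b = {{pt n x, pt n (fb x)} | x. x < 2 * n}"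
    using tl_diagram_matching[OF b] .
  note A = nc_matchingD[OF fa, unfolded lessThan_iff] and B = nc_matchingD[OF fb, unfolded lessThan_iff]
  define F where "F x = (if x < 2 * n then fb x else 2 * n + fa (x - 2 * n))" for x
  have F: "nc_matching {..<4 * n} F"
    unfolding nc_matching_def
  proof (intro ballI conjI allI impI; unfold lessThan_iff)
    fix x assume x: "x < 4 * n"
    have "F x < 4 * n \<and> F x \<noteq> x \<and> F (F x) = x"
    proof (cases "x < 2 * n")
      case False
      then have "x - 2 * n < 2 * n" "2 * n + (x - 2 * n) = x" using x by auto
      then show ?thesis using A(1-3)[of "x - 2 * n"] False by (auto simp: F_def)
    qed (use B(1-3)[of x] in \<open>auto simp: F_def\<close>)
    then show "F x < 4 * n" "F x \<noteq> x" "F (F x) = x" by auto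
    fix y assume y: "y < 4 * n" and xy: "x < y \<and> y < F x"
    have "x < F y \<and> F y < F x"
    proof (cases "x < 2 * n")
      case True
      then have "x < y" "y < fb x" "fb x < 2 * n" using xy B(1)[of x] by (auto simp: F_def)
      then show ?thesis using True B(4)[of x y] by (auto simp: F_def)
    next
      case False
      then have "x - 2 * n < 2 * n" "y - 2 * n < 2 * n" "x - 2 * n < y - 2 * n" "y - 2 * n < fa (x - 2 * n)"
        using x y xy by (auto simp: F_def)
      from A(4)[OF this] show ?thesis using False xy by (auto simp: F_def)
    qed
    then show "x < F y" "F y < F x" by auto
  qed
  define \<iota> where "\<iota> x = (if x < 2 * n then move_level Top Middle (pt n x)
    else move_level Bottom Middle (pt n (x - 2 * n)))" for x
  have \<iota>: "\<iota> x = (if x < n then (Bottom, x) else if x < 2 * n then (Middle, 2 * n - 1 - x)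
      else if x < 3 * n then (Middle, x - 2 * n) else (Top, 4 * n - 1 - x))" if "x < 4 * n" for x
    using that by (auto simp: \<iota>_def pt_def move_level_def)
  have \<iota>_eq: "(x, y) \<in> (links n n)\<^sup>*" if "x < 4 * n" "y < 4 * n" "\<iota> x = \<iota> y" for x y
  proof -
    have "x = y \<or> n \<le> x \<and> x < 2 * n \<and> y = 4 * n - 1 - x \<or> 2 * n \<le> x \<and> x < 3 * n \<and> y = 4 * n - 1 - x"
      using that by (auto simp: \<iota> split: if_splits)
    moreover have "(x, y) \<in> links n n" if "n \<le> x" "x < 2 * n" "y = 4 * n - 1 - x"
    proof -
      have "x = 2 * n - 1 - (2 * n - 1 - x) \<and> y = 2 * n + (2 * n - 1 - x) \<and> 2 * n - 1 - x < n" using that by auto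
      then show ?thesis unfolding links_def by blast
    qed
    moreover have "(x, y) \<in> links n n" if "2 * n \<le> x" "x < 3 * n" "y = 4 * n - 1 - x"
    proof -
      have "x = 2 * n + (x - 2 * n) \<and> y = 2 * n - 1 - (x - 2 * n) \<and> x - 2 * n < n" using that by auto
      then show ?thesis unfolding links_def by blast
    qed
    ultimately show ?thesis by auto
  qed
  have \<iota>_links: "\<iota> x = \<iota> y" if "(x, y) \<in> links n n" for x y
    using that by (auto simp: links_def \<iota>)
  have linksc: "x < 4 * n \<and> y < 4 * n" if "(x, y) \<in> links n n" for x y using that by (auto simp: links_def)
  have stackD: "\<exists>x<4 * n. p = \<iota> x \<and> q = \<iota> (F x)" if pq: "(p, q) \<in> stack_rel a b" for p q
  proof -
    have "{p, q} \<in> (`) (move_level Bottom Middle) ` a \<or> {p, q} \<in> (`) (move_level Top Middle) ` b"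
      using pq by (auto simp: stack_rel_def stack_def)
    then obtain z where z: "z < 4 * n" "{p, q} = {\<iota> z, \<iota> (F z)}"
    proof
      assume "{p, q} \<in> (`) (move_level Bottom Middle) ` a"
      then obtain x where x: "x < 2 * n" "{p, q} = move_level Bottom Middle ` {pt n x, pt n (fa x)}"
        unfolding a_eq by auto
      then have "{p, q} = {\<iota> (2 * n + x), \<iota> (F (2 * n + x))}" by (simp add: \<iota>_def F_def)
      then show thesis using that[of "2 * n + x"] x(1) by simp
    next
      assume "{p, q} \<in> (`) (move_level Top Middle) ` b"
      then obtain x where x: "x < 2 * n" "{p, q} = move_level Top Middle ` {pt n x, pt n (fb x)}"
        unfolding b_eq by auto
      then have "{p, q} = {\<iota> x, \<iota> (F x)}" using B(1)[of x] by (simp add: \<iota>_def F_def)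
      then show thesis using that[of x] x(1) by simp
    qed
    then have "p = \<iota> z \<and> q = \<iota> (F z) \<or> p = \<iota> (F z) \<and> q = \<iota> (F (F z))"
      using nc_matchingD(3)[OF F] by (auto simp: doubleton_eq_iff)
    then show ?thesis using z(1) nc_matchingD(1)[OF F] by auto
  qed
  have stackI: "(\<iota> x, \<iota> (F x)) \<in> stack_rel a b" if x: "x < 4 * n" for x
  proof (cases "x < 2 * n")
    case True
    then have "{pt n x, pt n (fb x)} \<in> b" by (auto simp: b_eq)
    then have "move_level Top Middle ` {pt n x, pt n (fb x)} \<in> stack a b" unfolding stack_def by blast
    then show ?thesis using True B(1)[of x] by (simp add: stack_rel_def \<iota>_def F_def)
  next
    case False
    then have "{pt n (x - 2 * n), pt n (fa (x - 2 * n))} \<in> a" using x unfolding a_eq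
      by (intro CollectI exI[of _ "x - 2 * n"]) auto
    then have "move_level Bottom Middle ` {pt n (x - 2 * n), pt n (fa (x - 2 * n))} \<in> stack a b" unfolding stack_def by blast
    then show ?thesis using False by (simp add: stack_rel_def \<iota>_def F_def)
  qed
  let ?R = "graph_on {..<4 * n} F \<union> links n n"
  have to: "(\<iota> x, \<iota> y) \<in> (stack_rel a b)\<^sup>*" if "(x, y) \<in> ?R\<^sup>*" for x y
    using that
  proof (induction rule: rtrancl_induct)
    case (step y z)
    from step(2) have "(\<iota> y, \<iota> z) \<in> stack_rel a b \<or> \<iota> y = \<iota> z"
      using stackI \<iota>_links by auto
    then show ?case using step(3) by (metis rtrancl.rtrancl_into_rtrancl)
  qed simp
  have lR: "(links n n)\<^sup>* \<subseteq> ?R\<^sup>*" by (rule rtrancl_mono) auto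
  have from': "\<forall>y<4 * n. q = \<iota> y \<longrightarrow> (x, y) \<in> ?R\<^sup>*" if pq: "(\<iota> x, q) \<in> (stack_rel a b)\<^sup>*" and x: "x < 4 * n" for x q
    using pq
  proof (induction rule: rtrancl_induct)
    case base
    show ?case using \<iota>_eq[OF x] lR by auto
  next
    case (step q q')
    obtain z where z: "z < 4 * n" "q = \<iota> z" "q' = \<iota> (F z)" using stackD[OF step(2)] by blast
    have Fz: "F z < 4 * n" using nc_matchingD(1)[OF F] z by auto
    have "(x, z) \<in> ?R\<^sup>*" using step(3) z(1,2) by blast
    moreover have "(z, F z) \<in> ?R" using z(1) by blast
    ultimately have "(x, F z) \<in> ?R\<^sup>*" by (rule rtrancl.rtrancl_into_rtrancl)
    then show ?case using z \<iota>_eq[OF Fz] lR by (auto intro: rtrancl_trans)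
  qed
  obtain g where "nc_matching ({..<2 * n - n} \<union> {2 * n + n..<4 * n}) g" and
    "\<forall>u\<in>{..<2 * n - n} \<union> {2 * n + n..<4 * n}. \<forall>v\<in>{..<2 * n - n} \<union> {2 * n + n..<4 * n}.
      (u, v) \<in> ?R\<^sup>* \<longleftrightarrow> u = v \<or> v = g u"
    using contract_middle[OF F order_refl] by blast
  moreover define V where "V = {..<n} \<union> {3 * n..<4 * n}"
  moreover have "{..<2 * n - n} \<union> {2 * n + n..<4 * n} = V" by (auto simp: V_def)
  ultimately have g: "nc_matching V g"
    and greach: "\<And>u v. u \<in> V \<Longrightarrow> v \<in> V \<Longrightarrow> (u, v) \<in> ?R\<^sup>* \<longleftrightarrow> u = v \<or> v = g u" by simp_all
  note G = nc_matchingD[OF g]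
  define \<kappa> where "\<kappa> x = (if x < n then x else x + 2 * n)" for x
  define \<mu> where "\<mu> x = (if x < n then x else x - 2 * n)" for x
  have \<kappa>: "\<kappa> x \<in> V" "\<mu> (\<kappa> x) = x" "\<iota> (\<kappa> x) = pt n x" if "x < 2 * n" for x
    using that by (auto simp: \<kappa>_def \<mu>_def V_def \<iota> pt_def)
  have \<mu>: "\<mu> x < 2 * n" "\<kappa> (\<mu> x) = x" if "x \<in> V" for x
    using that by (auto simp: \<kappa>_def \<mu>_def V_def)
  have \<kappa>_less: "\<kappa> x < \<kappa> y \<longleftrightarrow> x < y" for x y by (auto simp: \<kappa>_def)
  have V4: "x < 4 * n" if "x \<in> V" for x using that by (auto simp: V_def)
  define h where "h x = \<mu> (g (\<kappa> x))" for x
  have \<kappa>h: "\<kappa> (h x) = g (\<kappa> x)" if "x < 2 * n" for x using that \<kappa> \<mu> G(1) by (simp add: h_def)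
  have h: "nc_matching {..<2 * n} h"
    unfolding nc_matching_def
  proof (intro ballI conjI allI impI; unfold lessThan_iff)
    fix x assume x: "x < 2 * n"
    show hx: "h x < 2 * n" using x \<kappa> \<mu> G(1) by (simp add: h_def)
    show "h x \<noteq> x" using \<kappa>h[OF x] G(2)[OF \<kappa>(1)[OF x]] by metis
    show "h (h x) = x" using \<kappa>h[OF x] G(3)[OF \<kappa>(1)[OF x]] \<kappa>(2)[OF x] by (simp add: h_def[of "h x"])
    fix y assume y: "y < 2 * n" and xy: "x < y \<and> y < h x"
    have "\<kappa> x < \<kappa> y" "\<kappa> y < g (\<kappa> x)" using xy \<kappa>_less \<kappa>h[OF x] by metis+
    then have "\<kappa> x < \<kappa> (h y) \<and> \<kappa> (h y) < \<kappa> (h x)"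
      using G(4)[OF \<kappa>(1)[OF x] \<kappa>(1)[OF y]] by (simp add: \<kappa>h[OF x] \<kappa>h[OF y])
    then show "x < h y" "h y < h x" using \<kappa>_less by auto
  qed
  have reach: "(pt n x, pt n y) \<in> (stack_rel a b)\<^sup>* \<longleftrightarrow> x = y \<or> y = h x" if x: "x < 2 * n" and y: "y < 2 * n" for x y
  proof -
    have "(pt n x, pt n y) \<in> (stack_rel a b)\<^sup>* \<longleftrightarrow> (\<kappa> x, \<kappa> y) \<in> ?R\<^sup>*"
      using to[of "\<kappa> x" "\<kappa> y"] from'[of "\<kappa> x" "\<iota> (\<kappa> y)"] \<kappa>[OF x] \<kappa>[OF y] V4 by auto
    also have "\<dots> \<longleftrightarrow> \<kappa> x = \<kappa> y \<or> \<kappa> y = \<kappa> (h x)" using greach[OF \<kappa>(1)[OF x] \<kappa>(1)[OF y]] \<kappa>h[OF x] by simp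
    also have "\<dots> \<longleftrightarrow> x = y \<or> y = h x" using \<kappa>_less by (metis nat_neq_iff)
    finally show ?thesis .
  qed
  have "tl_mult n a b = {{pt n x, pt n (h x)} | x. x < 2 * n}"
  proof
    show "tl_mult n a b \<subseteq> {{pt n x, pt n (h x)} | x. x < 2 * n}"
    proof
      fix e assume "e \<in> tl_mult n a b"
      then obtain p q where e: "e = {p, q}" "p \<in> points n" "q \<in> points n" "p \<noteq> q" "(p, q) \<in> (stack_rel a b)\<^sup>*"
        by (auto simp: tl_mult_eq)
      then obtain x y where "x < 2 * n" "y < 2 * n" "p = pt n x" "q = pt n y" by (auto simp: points_eq_pt)
      then show "e \<in> {{pt n x, pt n (h x)} | x. x < 2 * n}" using e reach by blast
    qed
    show "{{pt n x, pt n (h x)} | x. x < 2 * n} \<subseteq> tl_mult n a b"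
    proof
      fix e assume "e \<in> {{pt n x, pt n (h x)} | x. x < 2 * n}"
      then obtain x where x: "x < 2 * n" "e = {pt n x, pt n (h x)}" by blast
      have hx: "h x < 2 * n" "h x \<noteq> x" using nc_matchingD(1,2)[OF h] x by auto
      then show "e \<in> tl_mult n a b"
        using reach[OF x(1) hx(1)] pt_points x pt_inj[OF x(1) hx(1)] by (simp add: tl_mult_edge)
    qed
  qed
  then show ?thesis using matching_tl_diagram[OF h] by simp
qed

section \<open>Associativity\<close>

definition place :: "(point \<Rightarrow> 'b) \<Rightarrow> diagram \<Rightarrow> ('b \<times> 'b) set" where
  "place f D = {(f p, f q) | p q. {p, q} \<in> D}"

lemma placeI: "{p, q} \<in> D \<Longrightarrow> (f p, f q) \<in> place f D"
  unfolding place_def by blast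

lemma rtrancl_map:
  assumes "\<And>x y. (x, y) \<in> R \<Longrightarrow> (f x, f y) \<in> S" "(x, y) \<in> R\<^sup>*"
  shows "(f x, f y) \<in> S\<^sup>*"
  using assms(2) by induction (auto intro: rtrancl_into_rtrancl assms(1))

lemma stack_rel_place:
  assumes a: "perfect n a" and b: "perfect n b"
  shows "stack_rel a b = place (move_level Bottom Middle) a \<union> place (move_level Top Middle) b"
proof -
  have *: "{(x, y). {x, y} \<in> (`) f ` D} = place f D" if D: "perfect n D" for f :: "point \<Rightarrow> point" and D
  proof (intro equalityI subrelI)
    fix x y assume "(x, y) \<in> {(x, y). {x, y} \<in> (`) f ` D}"
    then obtain e where e: "e \<in> D" "{x, y} = f ` e" by auto
    obtain p q where pq: "e = {p, q}" using perfect_edge[OF D e(1)] by blast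
    then have "x = f p \<and> y = f q \<or> x = f q \<and> y = f p" using e(2) by (auto simp: doubleton_eq_iff)
    then show "(x, y) \<in> place f D" using e(1) pq placeI[of p q D f] placeI[of q p D f]
      by (auto simp: insert_commute)
  next
    fix x y assume "(x, y) \<in> place f D"
    then obtain p q where "{p, q} \<in> D" "x = f p" "y = f q" by (auto simp: place_def)
    then have "{x, y} = f ` {p, q}" "{p, q} \<in> D" by auto
    then show "(x, y) \<in> {(x, y). {x, y} \<in> (`) f ` D}" by blast
  qed
  have "stack_rel a b = {(x, y). {x, y} \<in> (`) (move_level Bottom Middle) ` a} \<union> {(x, y). {x, y} \<in> (`) (move_level Top Middle) ` b}"
    by (auto simp: stack_rel_def stack_def)
  then show ?thesis by (simp only: *[OF a] *[OF b])
qed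

fun at_height :: "nat \<Rightarrow> nat \<Rightarrow> nat \<Rightarrow> point \<Rightarrow> nat \<times> nat" where
  "at_height l m u (Bottom, i) = (l, i)"
| "at_height l m u (Middle, i) = (m, i)"
| "at_height l m u (Top, i) = (u, i)"

lemma at_height_move:
  assumes "p \<in> points n"
  shows "at_height l m u (move_level Bottom Middle p) = at_height m v u p"
    "at_height l m u (move_level Top Middle p) = at_height l v m p"
  using assms by (auto simp: points_def move_level_def)

text \<open>
Stacking three diagrams gives a graph on four heights. An edge of the left-hand side is a path in
it, and eliminating height 1 from this path turns the two lower diagrams into their product. One
direction suffices for equality, because both sides are perfect matchings.
\<close>

lemma tl_mult_assoc_edge:
  assumes a: "perfect n a" and b: "perfect n b" and c: "perfect n c"
    and ab: "perfect n (tl_mult n a b)" and bc: "perfect n (tl_mult n b c)"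
    and pq: "{p, q} \<in> tl_mult n (tl_mult n a b) c"
  shows "{p, q} \<in> tl_mult n a (tl_mult n b c)"
proof -
  define A where "A = place (at_height 2 0 3) a"
  define B where "B = place (at_height 1 0 2) b"
  define C where "C = place (at_height 0 0 1) c"
  have p: "p \<in> points n" "q \<in> points n" "p \<noteq> q" and R: "(p, q) \<in> (stack_rel (tl_mult n a b) c)\<^sup>*"
    using pq by (auto simp: tl_mult_edge)
  have pc: "perfect n D \<Longrightarrow> {x, y} \<in> D \<Longrightarrow> x \<in> points n \<and> y \<in> points n" for D x y
    using perfect_points by blast
  have AB: "(at_height 1 2 3 x, at_height 1 2 3 y) \<in> A \<union> B" if "(x, y) \<in> stack_rel a b" for x y
    using that unfolding stack_rel_place[OF a b]
  proof
    assume "(x, y) \<in> place (move_level Bottom Middle) a"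
    then obtain x' y' where e: "{x', y'} \<in> a" "x = move_level Bottom Middle x'" "y = move_level Bottom Middle y'"
      by (auto simp: place_def)
    have "(at_height 2 0 3 x', at_height 2 0 3 y') \<in> A" unfolding A_def by (rule placeI[OF e(1)])
    then show ?thesis using e(2,3) pc[OF a e(1)] at_height_move(1)[of _ n 1 2 3 0] by simp
  next
    assume "(x, y) \<in> place (move_level Top Middle) b"
    then obtain x' y' where e: "{x', y'} \<in> b" "x = move_level Top Middle x'" "y = move_level Top Middle y'"
      by (auto simp: place_def)
    have "(at_height 1 0 2 x', at_height 1 0 2 y') \<in> B" unfolding B_def by (rule placeI[OF e(1)])
    then show ?thesis using e(2,3) pc[OF b e(1)] at_height_move(2)[of _ n 1 2 3 0] by simp
  qed
  have step: "(at_height 0 1 3 x, at_height 0 1 3 y) \<in> (A \<union> B \<union> C)\<^sup>*"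
    if "(x, y) \<in> stack_rel (tl_mult n a b) c" for x y
    using that unfolding stack_rel_place[OF ab c]
  proof
    assume "(x, y) \<in> place (move_level Bottom Middle) (tl_mult n a b)"
    then obtain x' y' where e: "{x', y'} \<in> tl_mult n a b"
      "x = move_level Bottom Middle x'" "y = move_level Bottom Middle y'" by (auto simp: place_def)
    then have "x' \<in> points n" "y' \<in> points n" "(x', y') \<in> (stack_rel a b)\<^sup>*" by (auto simp: tl_mult_edge)
    then have "(at_height 1 2 3 x', at_height 1 2 3 y') \<in> (A \<union> B)\<^sup>*" by (intro rtrancl_map[OF AB])
    then have "(at_height 1 2 3 x', at_height 1 2 3 y') \<in> (A \<union> B \<union> C)\<^sup>*"
      using rtrancl_mono[of "A \<union> B" "A \<union> B \<union> C"] by blast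
    then show ?thesis using e \<open>x' \<in> points n\<close> \<open>y' \<in> points n\<close> at_height_move(1)[of _ n 0 1 3 2] by simp
  next
    assume "(x, y) \<in> place (move_level Top Middle) c"
    then obtain x' y' where e: "{x', y'} \<in> c" "x = move_level Top Middle x'" "y = move_level Top Middle y'"
      by (auto simp: place_def)
    then have "(at_height 0 0 1 x', at_height 0 0 1 y') \<in> C" by (auto simp: C_def intro: placeI)
    then show ?thesis using e pc[OF c e(1)] at_height_move(2)[of _ n 0 1 3 0] by auto
  qed
  have R3: "(at_height 0 1 3 p, at_height 0 1 3 q) \<in> (B \<union> C \<union> A)\<^sup>*"
  proof -
    have "(at_height 0 1 3 p, at_height 0 1 3 q) \<in> ((A \<union> B \<union> C)\<^sup>*)\<^sup>*"
      by (rule rtrancl_map[OF step R])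
    then show ?thesis by (simp add: Un_ac)
  qed
  \<comment> \<open>height 1 is the line between \<open>b\<close> and \<open>c\<close>, height 2 the line between \<open>a\<close> and \<open>b\<close>\<close>
  define Y where "Y = {0, 2, 3 :: nat} \<times> (UNIV :: nat set)"
  have AY: "A \<subseteq> Y \<times> Y"
    using pc[OF a] by (fastforce simp: A_def Y_def place_def points_def)
  have pY: "at_height 0 1 3 x \<in> Y" if "x \<in> points n" for x using that by (auto simp: Y_def points_def)
  have elim: "(at_height 0 1 3 p, at_height 0 1 3 q) \<in> (((B \<union> C)\<^sup>* \<inter> Y \<times> Y) \<union> A)\<^sup>*"
    by (rule rtrancl_eliminate[OF R3 pY pY AY]) (use p in auto)
  define \<psi> :: "nat \<times> nat \<Rightarrow> point" where "\<psi> = (\<lambda>(l, i). (if l = 0 then Bottom else if l = 1 then Middle else Top, i))"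
  have \<psi>: "\<psi> (at_height 1 0 2 x) = move_level Bottom Middle x" "\<psi> (at_height 0 0 1 x) = move_level Top Middle x"
    if "x \<in> points n" for x using that by (auto simp: \<psi>_def points_def move_level_def)
  define \<chi> :: "nat \<times> nat \<Rightarrow> point" where "\<chi> = (\<lambda>(l, i). (if l = 0 then Bottom else if l = 3 then Top else Middle, i))"
  have \<chi>: "\<chi> (at_height 2 0 3 x) = move_level Bottom Middle x" "\<chi> (at_height 0 1 3 x) = x"
    if "x \<in> points n" for x using that by (auto simp: \<chi>_def points_def move_level_def)
  have BC: "(\<psi> x, \<psi> y) \<in> stack_rel b c \<and> fst x \<le> 2 \<and> fst y \<le> 2 \<and> snd x < n \<and> snd y < n" if "(x, y) \<in> B \<union> C" for x y
    using that
  proof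
    assume "(x, y) \<in> B"
    then obtain x' y' where e: "{x', y'} \<in> b" "x = at_height 1 0 2 x'" "y = at_height 1 0 2 y'"
      by (auto simp: B_def place_def)
    then show ?thesis using pc[OF b e(1)] \<psi>(1) unfolding stack_rel_place[OF b c]
      by (auto simp: points_def intro: placeI)
  next
    assume "(x, y) \<in> C"
    then obtain x' y' where e: "{x', y'} \<in> c" "x = at_height 0 0 1 x'" "y = at_height 0 0 1 y'"
      by (auto simp: C_def place_def)
    then show ?thesis using pc[OF c e(1)] \<psi>(2) unfolding stack_rel_place[OF b c]
      by (auto simp: points_def intro: placeI)
  qed
  have BCstar: "(\<chi> x, \<chi> y) \<in> (stack_rel a (tl_mult n b c))\<^sup>*"
    if xy: "(x, y) \<in> (B \<union> C)\<^sup>*" and Y: "x \<in> Y" "y \<in> Y" for x y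
  proof (cases "x = y")
    case False
    obtain x1 where "(x, x1) \<in> B \<union> C" using xy False by (meson converse_rtranclE)
    then have x: "fst x \<le> 2" "snd x < n" using BC by blast+
    obtain y1 where "(y1, y) \<in> B \<union> C" using xy False by (meson rtranclE)
    then have y: "fst y \<le> 2" "snd y < n" using BC by blast+
    have lev: "fst x = 0 \<or> fst x = 2" "fst y = 0 \<or> fst y = 2" using Y x y by (auto simp: Y_def)
    have "(\<psi> x, \<psi> y) \<in> (stack_rel b c)\<^sup>*" by (rule rtrancl_map[OF _ xy]) (use BC in blast)
    moreover have "\<psi> x \<in> points n" "\<psi> y \<in> points n" "\<psi> x \<noteq> \<psi> y"
      using x y lev False by (auto simp: \<psi>_def points_def split: prod.splits)
    ultimately have e: "{\<psi> x, \<psi> y} \<in> tl_mult n b c" by (simp add: tl_mult_edge)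
    have "\<chi> x = move_level Top Middle (\<psi> x)" "\<chi> y = move_level Top Middle (\<psi> y)"
      using lev by (auto simp: \<psi>_def \<chi>_def move_level_def split: prod.splits)
    then have "(\<chi> x, \<chi> y) \<in> stack_rel a (tl_mult n b c)"
      unfolding stack_rel_place[OF a bc] using placeI[OF e, of "move_level Top Middle"] by simp
    then show ?thesis by blast
  qed simp
  have "(\<chi> x, \<chi> y) \<in> (stack_rel a (tl_mult n b c))\<^sup>*" if "(x, y) \<in> ((B \<union> C)\<^sup>* \<inter> Y \<times> Y) \<union> A" for x y
    using that
  proof
    assume "(x, y) \<in> A"
    then obtain x' y' where e: "{x', y'} \<in> a" "x = at_height 2 0 3 x'" "y = at_height 2 0 3 y'"
      by (auto simp: A_def place_def)
    then have "(\<chi> x, \<chi> y) \<in> stack_rel a (tl_mult n b c)"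
      using pc[OF a e(1)] \<chi>(1) unfolding stack_rel_place[OF a bc] by (auto intro: placeI)
    then show ?thesis by blast
  qed (use BCstar in blast)
  then have "(\<chi> (at_height 0 1 3 p), \<chi> (at_height 0 1 3 q)) \<in> ((stack_rel a (tl_mult n b c))\<^sup>*)\<^sup>*"
    by (rule rtrancl_map[OF _ elim])
  then show ?thesis using p \<chi>(2) by (simp add: tl_mult_edge)
qed

lemma tl_mult_assoc:
  assumes "a \<in> tl_diagrams n" "b \<in> tl_diagrams n" "c \<in> tl_diagrams n"
  shows "tl_mult n (tl_mult n a b) c = tl_mult n a (tl_mult n b c)"
proof (rule perfect_subset_eq)
  have P: "perfect n D" if "D \<in> tl_diagrams n" for D using that by (simp add: tl_diagrams_iff)
  show "perfect n (tl_mult n (tl_mult n a b) c)" "perfect n (tl_mult n a (tl_mult n b c))"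
    using assms by (auto intro!: P tl_mult_closed)
  show "{p, q} \<in> tl_mult n a (tl_mult n b c)" if "{p, q} \<in> tl_mult n (tl_mult n a b) c" for p q
    by (rule tl_mult_assoc_edge[OF _ _ _ _ _ that]) (use assms in \<open>auto intro!: P tl_mult_closed\<close>)
qed

lemma stack_rel_topI: "{(v, i), (w, j)} \<in> a \<Longrightarrow>
    (move_level Bottom Middle (v, i), move_level Bottom Middle (w, j)) \<in> stack_rel a b"
proof -
  assume "{(v, i), (w, j)} \<in> a"
  then have "move_level Bottom Middle ` {(v, i), (w, j)} \<in> stack a b" unfolding stack_def by blast
  then show ?thesis by (simp add: stack_rel_def)
qed

lemma stack_rel_bottomI: "{(v, i), (w, j)} \<in> b \<Longrightarrow>
    (move_level Top Middle (v, i), move_level Top Middle (w, j)) \<in> stack_rel a b"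
proof -
  assume "{(v, i), (w, j)} \<in> b"
  then have "move_level Top Middle ` {(v, i), (w, j)} \<in> stack a b" unfolding stack_def by blast
  then show ?thesis by (simp add: stack_rel_def)
qed

section \<open>Half diagrams\<close>

text \<open>
A system of cups on a line. The last condition says at the same time that cups do not cross and
that no unmatched point lies below a cup, so that all of these can be joined to through strands.
\<close>

definition half :: "nat \<Rightarrow> nat set set \<Rightarrow> bool" where
  "half n T \<longleftrightarrow> (\<forall>e\<in>T. \<exists>i j. e = {i, j} \<and> i < j \<and> j < n) \<and>
     (\<forall>i j k. {i, j} \<in> T \<and> {i, k} \<in> T \<longrightarrow> j = k) \<and>
     (\<forall>i j x. {i, j} \<in> T \<and> i < x \<and> x < j \<longrightarrow> (\<exists>y. i < y \<and> y < j \<and> {x, y} \<in> T))"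

definition free :: "nat \<Rightarrow> nat set set \<Rightarrow> nat set" where
  "free n T = {..<n} - \<Union>T"

definition rank :: "nat \<Rightarrow> nat set set \<Rightarrow> nat \<Rightarrow> nat" where
  "rank n T i = card {x \<in> free n T. x < i}"

text \<open>
The diagram with prescribed sides. As through strands do not cross, they have to join the free
points of both sides in increasing order.
\<close>

definition diag :: "nat \<Rightarrow> nat set set \<Rightarrow> nat set set \<Rightarrow> diagram" where
  "diag n T B = {{(Top, i), (Top, j)} | i j. {i, j} \<in> T} \<union> {{(Bottom, i), (Bottom, j)} | i j. {i, j} \<in> B}
     \<union> {{(Bottom, i), (Top, j)} | i j. i \<in> free n B \<and> j \<in> free n T \<and> rank n B i = rank n T j}"

definition side :: "level \<Rightarrow> diagram \<Rightarrow> nat set set" where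
  "side v D = {{i, j} | i j. {(v, i), (v, j)} \<in> D}"

lemma halfD:
  assumes "half n T"
  shows "e \<in> T \<Longrightarrow> \<exists>i j. e = {i, j} \<and> i < j \<and> j < n"
    and "{i, j} \<in> T \<Longrightarrow> {i, k} \<in> T \<Longrightarrow> j = k"
    and "{i, j} \<in> T \<Longrightarrow> i < x \<Longrightarrow> x < j \<Longrightarrow> \<exists>y. i < y \<and> y < j \<and> {x, y} \<in> T"
    and "{i, j} \<in> T \<Longrightarrow> i < n \<and> j < n \<and> i \<noteq> j"
proof -
  show 1: "\<exists>i j. e = {i, j} \<and> i < j \<and> j < n" if "e \<in> T" for e
    using assms that unfolding half_def by blast
  show "{i, j} \<in> T \<Longrightarrow> {i, k} \<in> T \<Longrightarrow> j = k"
    using assms unfolding half_def by blast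
  show "{i, j} \<in> T \<Longrightarrow> i < x \<Longrightarrow> x < j \<Longrightarrow> \<exists>y. i < y \<and> y < j \<and> {x, y} \<in> T"
    using assms unfolding half_def by blast
  show "{i, j} \<in> T \<Longrightarrow> i < n \<and> j < n \<and> i \<noteq> j"
    using 1[of "{i, j}"] by (auto simp: doubleton_eq_iff)
qed

lemma half_Union: "half n T \<Longrightarrow> i \<in> \<Union>T \<longleftrightarrow> (\<exists>j. {i, j} \<in> T)"
proof
  assume T: "half n T" and "i \<in> \<Union>T"
  then obtain e where e: "e \<in> T" "i \<in> e" by blast
  obtain a b where "e = {a, b}" using halfD(1)[OF T e(1)] by blast
  then have "e = {i, a} \<or> e = {i, b}" using e(2) by auto
  then show "\<exists>j. {i, j} \<in> T" using e(1) by blast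
qed blast

lemma free_iff: "half n T \<Longrightarrow> i \<in> free n T \<longleftrightarrow> i < n \<and> (\<forall>j. {i, j} \<notin> T)"
  unfolding free_def using half_Union[of n T i] by blast

lemma finite_free: "finite (free n T)" by (simp add: free_def)

lemma rank_mono: "i \<in> free n T \<Longrightarrow> i < j \<Longrightarrow> rank n T i < rank n T j"
  unfolding rank_def by (rule psubset_card_mono) (auto simp: finite_free)

lemma rank_inj: "i \<in> free n T \<Longrightarrow> j \<in> free n T \<Longrightarrow> rank n T i = rank n T j \<Longrightarrow> i = j"
  using rank_mono by (metis linorder_neqE_nat nat_less_le)

lemma rank_bij: "bij_betw (rank n T) (free n T) {..<card (free n T)}"
proof -
  have inj: "inj_on (rank n T) (free n T)" by (rule inj_onI) (rule rank_inj)
  have "rank n T i < card (free n T)" if "i \<in> free n T" for i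
    unfolding rank_def by (rule psubset_card_mono) (use that finite_free in auto)
  then have "rank n T ` free n T \<subseteq> {..<card (free n T)}" by auto
  then have "rank n T ` free n T = {..<card (free n T)}"
    by (rule card_subset_eq[rotated]) (auto simp: card_image[OF inj])
  with inj show ?thesis by (simp add: bij_betw_def)
qed

lemma rank_ex: "r < card (free n T) \<Longrightarrow> \<exists>i\<in>free n T. rank n T i = r"
  using rank_bij[of n T] by (metis bij_betw_imp_surj_on imageE lessThan_iff)

lemma rank_less: "i \<in> free n T \<Longrightarrow> rank n T i < card (free n T)"
  using rank_bij[of n T] by (metis bij_betwE lessThan_iff)

lemma diag_cases:
  assumes "{p, q} \<in> diag n T B"
  obtains i j where "p = (Top, i)" "q = (Top, j)" "{i, j} \<in> T"
  | i j where "p = (Bottom, i)" "q = (Bottom, j)" "{i, j} \<in> B"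
  | i j where "p = (Bottom, i)" "q = (Top, j)" "i \<in> free n B" "j \<in> free n T" "rank n B i = rank n T j"
  | i j where "p = (Top, j)" "q = (Bottom, i)" "i \<in> free n B" "j \<in> free n T" "rank n B i = rank n T j"
  using assms unfolding diag_def by (auto simp: doubleton_eq_iff insert_commute)

lemma diag_edges:
  "{(Top, i), (Top, j)} \<in> diag n T B \<longleftrightarrow> {i, j} \<in> T"
  "{(Bottom, i), (Bottom, j)} \<in> diag n T B \<longleftrightarrow> {i, j} \<in> B"
  "{(Bottom, i), (Top, j)} \<in> diag n T B \<longleftrightarrow> i \<in> free n B \<and> j \<in> free n T \<and> rank n B i = rank n T j"
  unfolding diag_def by (auto simp: doubleton_eq_iff insert_commute)

lemma side_iff: "{i, j} \<in> side v D \<longleftrightarrow> {(v, i), (v, j)} \<in> D"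
  unfolding side_def by (auto simp: doubleton_eq_iff insert_commute)

lemma side_doubleton: "e \<in> side v D \<Longrightarrow> \<exists>i j. e = {i, j}"
  unfolding side_def by blast

lemma half_eqI:
  assumes "half n T" "\<And>e. e \<in> T' \<Longrightarrow> \<exists>i j. e = {i, j}" "\<And>i j. {i, j} \<in> T \<longleftrightarrow> {i, j} \<in> T'"
  shows "T = T'"
  using halfD(1)[OF assms(1)] assms(2,3) by blast

lemma side_diag:
  assumes "half n T" "half n B"
  shows "side Top (diag n T B) = T" "side Bottom (diag n T B) = B"
proof -
  have "T = side Top (diag n T B)"
    by (rule half_eqI[OF assms(1)]) (blast dest: side_doubleton, simp only: side_iff diag_edges(1))
  then show "side Top (diag n T B) = T" ..
  have "B = side Bottom (diag n T B)"
    by (rule half_eqI[OF assms(2)]) (blast dest: side_doubleton, simp only: side_iff diag_edges(2))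
  then show "side Bottom (diag n T B) = B" ..
qed

text \<open>
Strands within one side do not cross each other or a through strand by the nesting condition;
through strands do not cross each other since ranks increase.
\<close>

lemma diag_tl:
  assumes T: "half n T" and B: "half n B" and card: "card (free n T) = card (free n B)"
  shows "diag n T B \<in> tl_diagrams n"
proof -
  let ?D = "diag n T B"
  have unique: "q = r" if "{p, q} \<in> ?D" "{p, r} \<in> ?D" for p q r
    using that(1)
  proof (cases rule: diag_cases)
    case (1 i j)
    show ?thesis using that(2) by (cases rule: diag_cases) (use 1 halfD(2)[OF T] free_iff[OF T] in auto)
  next
    case (2 i j)
    show ?thesis using that(2) by (cases rule: diag_cases) (use 2 halfD(2)[OF B] free_iff[OF B] in auto)
  next
    case (3 i j)
    show ?thesis using that(2) by (cases rule: diag_cases) (use 3 free_iff[OF B] rank_inj in auto)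
  next
    case (4 j i)
    show ?thesis using that(2) by (cases rule: diag_cases) (use 4 free_iff[OF T] rank_inj in auto)
  qed
  have "perfect n ?D"
  proof (rule perfectI)
    show "\<exists>p q. e = {p, q} \<and> p \<noteq> q \<and> p \<in> points n \<and> q \<in> points n" if e: "e \<in> ?D" for e
    proof -
      obtain p q where pq: "e = {p, q}" using e unfolding diag_def by blast
      then have "{p, q} \<in> ?D" using e by simp
      then have "p \<noteq> q \<and> p \<in> points n \<and> q \<in> points n"
        by (cases rule: diag_cases) (use halfD(4)[OF T] halfD(4)[OF B] in \<open>auto simp: points_def free_def\<close>)
      then show ?thesis using pq by blast
    qed
    show "\<exists>q. {p, q} \<in> ?D" if p: "p \<in> points n" for p
    proof -
      obtain v i where vi: "p = (v, i)" "i < n" "v = Top \<or> v = Bottom" using p by (auto simp: points_def)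
      from vi(3) show ?thesis
      proof
        assume v: "v = Top"
        show ?thesis
        proof (cases "i \<in> free n T")
          case True
          then obtain j where "j \<in> free n B" "rank n B j = rank n T i"
            using rank_ex[of "rank n T i" n B] rank_less[OF True] card by auto
          then have "{(Bottom, j), (Top, i)} \<in> ?D" using True diag_edges(3) by blast
          then show ?thesis using vi v by (metis insert_commute)
        next
          case False
          then obtain j where "{i, j} \<in> T" using free_iff[OF T] vi by auto
          then show ?thesis using vi v diag_edges(1) by blast
        qed
      next
        assume v: "v = Bottom"
        show ?thesis
        proof (cases "i \<in> free n B")
          case True
          then obtain j where "j \<in> free n T" "rank n T j = rank n B i"
            using rank_ex[of "rank n B i" n T] rank_less[OF True] card by auto
          then have "{(Bottom, i), (Top, j)} \<in> ?D" using True diag_edges(3) by metis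
          then show ?thesis using vi v by blast
        next
          case False
          then obtain j where "{i, j} \<in> B" using free_iff[OF B] vi by auto
          then show ?thesis using vi v diag_edges(2) by blast
        qed
      qed
    qed
  qed (rule unique)
  moreover have "crossingless n ?D"
    unfolding crossingless_def
  proof
    assume "\<exists>p q r s. {p, r} \<in> ?D \<and> {q, s} \<in> ?D \<and> boundary_pos n p < boundary_pos n q \<and>
          boundary_pos n q < boundary_pos n r \<and> boundary_pos n r < boundary_pos n s"
    then obtain p q r s where pr: "{p, r} \<in> ?D" and qs: "{q, s} \<in> ?D" and
      pos: "boundary_pos n p < boundary_pos n q" "boundary_pos n q < boundary_pos n r" "boundary_pos n r < boundary_pos n s"
      by blast
    note PP = \<open>perfect n ?D\<close>
    have pts: "p \<in> points n" "q \<in> points n" "r \<in> points n" "s \<in> points n"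
      using perfect_points[OF PP pr] perfect_points[OF PP qs] by auto
    from pr show False
    proof (cases rule: diag_cases)
      case (1 j i)
      obtain x where x: "q = (Top, x)" "i < x" "x < j" using pos 1 pts by (cases q) (auto simp: points_def split: if_splits)
      obtain y where y: "i < y" "y < j" "{x, y} \<in> T" using halfD(3)[OF T, of i j x] 1 x by (auto simp: insert_commute)
      then have "s = (Top, y)" using unique[OF qs, of "(Top, y)"] x diag_edges(1) by blast
      then show False using pos 1 y pts by (auto simp: points_def)
    next
      case (2 i j)
      obtain x where x: "q = (Bottom, x)" "i < x" "x < j" using pos 2 pts by (cases q) (auto simp: points_def split: if_splits)
      obtain y where y: "i < y" "y < j" "{x, y} \<in> B" using halfD(3)[OF B, of i j x] 2 x by auto
      then have "s = (Bottom, y)" using unique[OF qs, of "(Bottom, y)"] x diag_edges(2) by blast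
      then show False using pos 2 y pts by (auto simp: points_def)
    next
      case (3 i j)
      obtain y where y: "s = (Top, y)" "y < j" using pos 3 pts by (cases s) (auto simp: points_def split: if_splits)
      from qs show False
      proof (cases rule: diag_cases)
        case (1 x y')
        then have "{y, x} \<in> T" "y < j" "j < x" using y pos 3 pts by (auto simp: points_def insert_commute)
        then show False using halfD(3)[OF T] 3(4) free_iff[OF T] by blast
      next
        case (3 x y')
        then have "i < x" using pos \<open>p = (Bottom, i)\<close> by simp
        then have "rank n B i < rank n B x" using rank_mono \<open>i \<in> free n B\<close> by blast
        moreover have "rank n T y < rank n T j" using rank_mono 3 y by auto
        ultimately show False using 3 y \<open>rank n B i = rank n T j\<close> by simp
      qed (use y in auto)
    next
      case (4 j i)
      then show False using pos pts by (auto simp: points_def)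
    qed
  qed
  ultimately show ?thesis by (simp add: tl_diagrams_iff)
qed

lemma tl_nested:
  assumes D: "D \<in> tl_diagrams n" and pr: "{p, r} \<in> D" and qs: "{q, s} \<in> D"
    and pos: "boundary_pos n p < boundary_pos n q" "boundary_pos n q < boundary_pos n r"
  shows "boundary_pos n p < boundary_pos n s \<and> boundary_pos n s < boundary_pos n r"
proof -
  have P: "perfect n D" and nc: "crossingless n D" using D by (auto simp: tl_diagrams_iff)
  note pts = perfect_points[OF P pr] perfect_points[OF P qs]
  have "s \<noteq> r" "s \<noteq> p"
    using perfect_unique[OF P, of r p q] perfect_unique[OF P, of p r q] pr qs pos by (auto simp: insert_commute)
  then have ne: "boundary_pos n s \<noteq> boundary_pos n r" "boundary_pos n s \<noteq> boundary_pos n p"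
    using pts by (metis pt_boundary_pos)+
  have "\<not> boundary_pos n r < boundary_pos n s" using nc pr qs pos unfolding crossingless_def by blast
  moreover have "\<not> boundary_pos n s < boundary_pos n p"
  proof
    assume "boundary_pos n s < boundary_pos n p"
    moreover have "{s, q} \<in> D" using qs by (simp add: insert_commute)
    ultimately show False using nc pr pos unfolding crossingless_def by blast
  qed
  ultimately show ?thesis using ne by linarith
qed

lemma half_side:
  assumes D: "D \<in> tl_diagrams n" and v: "v = Top \<or> v = Bottom"
  shows "half n (side v D)"
proof -
  have P: "perfect n D" using D by (simp add: tl_diagrams_iff)
  have edge: "\<exists>i j. e = {i, j} \<and> i < j \<and> j < n" if e: "e \<in> side v D" for e
  proof -
    obtain i j where ij: "e = {i, j}" "{(v, i), (v, j)} \<in> D" using e by (auto simp: side_def)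
    then have "i \<noteq> j" "i < n" "j < n" using perfect_points[OF P ij(2)] by (auto simp: points_def)
    then show ?thesis using ij(1) by (metis insert_commute linorder_neqE_nat)
  qed
  have nest: "\<exists>y. i < y \<and> y < j \<and> {x, y} \<in> side v D" if ij: "{i, j} \<in> side v D" and x: "i < x" "x < j" for i j x
  proof -
    have e: "{(v, i), (v, j)} \<in> D" using ij by (simp add: side_iff)
    then have n: "i < n" "j < n" using perfect_points[OF P] by (auto simp: points_def)
    then have "(v, x) \<in> points n" using x v by (auto simp: points_def)
    then obtain s where s: "{(v, x), s} \<in> D" using perfect_ex[OF P] by blast
    obtain w y where wy: "s = (w, y)" "y < n" "w = Top \<or> w = Bottom"
      using perfect_points[OF P s] by (cases s) (auto simp: points_def)
    from v have "w = v \<and> i < y \<and> y < j"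
    proof
      assume v: "v = Top"
      have "{(v, j), (v, i)} \<in> D" using e by (simp add: insert_commute)
      moreover have "2 * n - 1 - j < 2 * n - 1 - x" "2 * n - 1 - x < 2 * n - 1 - i" using x n by linarith+
      ultimately have "2 * n - 1 - j < boundary_pos n s" "boundary_pos n s < 2 * n - 1 - i"
        using tl_nested[OF D _ s, of "(v, j)" "(v, i)"] v by auto
      then show ?thesis using wy(1,2) n by (cases "w = Bottom") (use wy(3) v in auto)
    next
      assume v: "v = Bottom"
      have "i < boundary_pos n s" "boundary_pos n s < j" using tl_nested[OF D e s] v x by auto
      then show ?thesis using wy(1,2) n by (cases "w = Bottom") (use wy(3) v in auto)
    qed
    then show ?thesis using s wy by (auto simp: side_iff)
  qed
  show ?thesis
    unfolding half_def using edge nest perfect_unique[OF P] by (auto simp: side_iff)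
qed

lemma through_free:
  assumes D: "D \<in> tl_diagrams n"
  shows "\<exists>m. bij_betw m (free n (side Bottom D)) (free n (side Top D)) \<and>
    (\<forall>i j. {(Bottom, i), (Top, j)} \<in> D \<longleftrightarrow> i \<in> free n (side Bottom D) \<and> j = m i) \<and>
    (\<forall>i\<in>free n (side Bottom D). \<forall>i'\<in>free n (side Bottom D). i < i' \<longrightarrow> m i < m i')"
proof -
  have P: "perfect n D" using D by (simp add: tl_diagrams_iff)
  have hT: "half n (side Top D)" and hB: "half n (side Bottom D)" using half_side[OF D] by auto
  let ?FB = "free n (side Bottom D)" and ?FT = "free n (side Top D)"
  have fr: "i \<in> ?FB \<and> j \<in> ?FT" if e: "{(Bottom, i), (Top, j)} \<in> D" for i j
  proof -
    have e': "{(Top, j), (Bottom, i)} \<in> D" using e by (simp add: insert_commute)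
    have "{(Bottom, i), (Bottom, k)} \<notin> D" for k using perfect_unique[OF P e, of "(Bottom, k)"] by auto
    moreover have "{(Top, j), (Top, k)} \<notin> D" for k using perfect_unique[OF P e', of "(Top, k)"] by auto
    moreover have "i < n" "j < n" using perfect_points[OF P e] by (auto simp: points_def)
    ultimately show ?thesis by (simp add: free_iff[OF hT] free_iff[OF hB] side_iff)
  qed
  have exB: "\<exists>j. {(Bottom, i), (Top, j)} \<in> D" if i: "i \<in> ?FB" for i
  proof -
    have "(Bottom, i) \<in> points n" using i by (auto simp: free_def points_def)
    then obtain s where s: "{(Bottom, i), s} \<in> D" using perfect_ex[OF P] by blast
    then show ?thesis using perfect_points[OF P s] i by (cases s) (auto simp: free_iff[OF hB] side_iff points_def)
  qed
  have exT: "\<exists>i. {(Bottom, i), (Top, j)} \<in> D" if j: "j \<in> ?FT" for j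
  proof -
    have "(Top, j) \<in> points n" using j by (auto simp: free_def points_def)
    then obtain s where s: "{(Top, j), s} \<in> D" using perfect_ex[OF P] by blast
    then show ?thesis using perfect_points[OF P s] j
      by (cases s) (auto simp: free_iff[OF hT] side_iff points_def insert_commute)
  qed
  define m where "m i = (SOME j. {(Bottom, i), (Top, j)} \<in> D)" for i
  have m: "{(Bottom, i), (Top, m i)} \<in> D" if "i \<in> ?FB" for i
    unfolding m_def by (rule someI_ex[OF exB[OF that]])
  have miff: "{(Bottom, i), (Top, j)} \<in> D \<longleftrightarrow> i \<in> ?FB \<and> j = m i" for i j
    using m fr perfect_unique[OF P, of "(Bottom, i)" "(Top, j)" "(Top, m i)"] by blast
  have mono: "m i < m i'" if i: "i \<in> ?FB" "i' \<in> ?FB" "i < i'" for i i'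
  proof -
    have n: "i < n" "i' < n" "m i < n" "m i' < n" using i fr[OF m[OF i(1)]] fr[OF m[OF i(2)]] by (auto simp: free_def)
    then have "i' < 2 * n - 1 - m i" by linarith
    then show ?thesis using tl_nested[OF D m[OF i(1)] m[OF i(2)]] n i(3) by auto
  qed
  have "bij_betw m ?FB ?FT"
    unfolding bij_betw_def
  proof
    show "inj_on m ?FB"
    proof (rule inj_onI)
      fix x y assume "x \<in> ?FB" "y \<in> ?FB" "m x = m y"
      then show "x = y" using mono[of x y] mono[of y x] by (cases x y rule: linorder_cases) auto
    qed
    show "m ` ?FB = ?FT" using fr m exT miff by blast
  qed
  then show ?thesis using miff mono by blast
qed

lemma card_free_sides:
  assumes "D \<in> tl_diagrams n"
  shows "card (free n (side Bottom D)) = card (free n (side Top D))"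
  using through_free[OF assms] bij_betw_same_card by blast

text \<open>
The through strands give an increasing bijection between the free points of the two sides, and
increasing bijections preserve ranks.
\<close>

lemma tl_diagram_eq_diag:
  assumes D: "D \<in> tl_diagrams n"
  shows "D = diag n (side Top D) (side Bottom D)"
proof (rule perfect_subset_eq)
  have P: "perfect n D" using D by (simp add: tl_diagrams_iff)
  then show "perfect n D" .
  have hT: "half n (side Top D)" and hB: "half n (side Bottom D)" using half_side[OF D] by auto
  show "perfect n (diag n (side Top D) (side Bottom D))"
    using diag_tl[OF hT hB card_free_sides[OF D, symmetric]] by (simp add: tl_diagrams_iff)
  let ?FB = "free n (side Bottom D)" and ?FT = "free n (side Top D)"
  obtain m where m: "bij_betw m ?FB ?FT" "\<And>i j. {(Bottom, i), (Top, j)} \<in> D \<longleftrightarrow> i \<in> ?FB \<and> j = m i"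
    and mono: "\<And>i i'. i \<in> ?FB \<Longrightarrow> i' \<in> ?FB \<Longrightarrow> i < i' \<Longrightarrow> m i < m i'" using through_free[OF D] by blast
  have through: "{(Bottom, i), (Top, j)} \<in> diag n (side Top D) (side Bottom D)" if e: "{(Bottom, i), (Top, j)} \<in> D" for i j
  proof -
    have i: "i \<in> ?FB" "j = m i" using e m(2) by auto
    have j: "j \<in> ?FT" using i m(1) by (auto simp: bij_betw_def)
    have less: "m x < m i \<longleftrightarrow> x < i" if "x \<in> ?FB" for x
      using mono[OF that i(1)] mono[OF i(1) that] by (metis linorder_neqE_nat less_asym less_irrefl)
    have mim: "m ` ?FB = ?FT" using m(1) by (simp add: bij_betw_def)
    have "m ` {x \<in> ?FB. x < i} = {y \<in> ?FT. y < j}"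
    proof
      show "m ` {x \<in> ?FB. x < i} \<subseteq> {y \<in> ?FT. y < j}" using less i(2) mim by auto
      show "{y \<in> ?FT. y < j} \<subseteq> m ` {x \<in> ?FB. x < i}"
      proof
        fix y assume y: "y \<in> {y \<in> ?FT. y < j}"
        then have "y \<in> m ` ?FB" using mim by simp
        then obtain x where "x \<in> ?FB" "y = m x" by blast
        then show "y \<in> m ` {x \<in> ?FB. x < i}" using less i(2) y by auto
      qed
    qed
    moreover have "inj_on m {x \<in> ?FB. x < i}" using m(1) by (auto simp: bij_betw_def intro: inj_on_subset)
    ultimately have "rank n (side Bottom D) i = rank n (side Top D) j"
      unfolding rank_def using card_image by fastforce
    then show ?thesis using i j by (simp add: diag_edges)
  qed
  fix p q assume e: "{p, q} \<in> D"
  obtain v i where p: "p = (v, i)" "v = Top \<or> v = Bottom"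
    using perfect_points[OF P e] by (cases p) (auto simp: points_def)
  obtain w j where q: "q = (w, j)" "w = Top \<or> w = Bottom"
    using perfect_points[OF P e] by (cases q) (auto simp: points_def)
  consider "v = Top" "w = Top" | "v = Bottom" "w = Bottom" | "v = Bottom" "w = Top" | "v = Top" "w = Bottom"
    using p(2) q(2) by blast
  then show "{p, q} \<in> diag n (side Top D) (side Bottom D)"
  proof cases
    case 4
    then have "{(Bottom, j), (Top, i)} \<in> D" using e p q by (simp add: insert_commute)
    from through[OF this] show ?thesis using 4 p q by (simp add: insert_commute)
  qed (use e p q through in \<open>simp_all add: diag_edges side_iff\<close>)
qed

lemma card_through_strands:
  assumes D: "D \<in> tl_diagrams n"
  shows "card (through_strands D) = card (free n (side Top D))"
proof -
  obtain m where m: "bij_betw m (free n (side Bottom D)) (free n (side Top D))"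
    "\<And>i j. {(Bottom, i), (Top, j)} \<in> D \<longleftrightarrow> i \<in> free n (side Bottom D) \<and> j = m i"
    using through_free[OF D] by blast
  have "through_strands D = (\<lambda>i. {(Bottom, i), (Top, m i)}) ` free n (side Bottom D)"
    unfolding through_strands_def using m(2) by auto
  moreover have "inj_on (\<lambda>i. {(Bottom, i), (Top, m i)}) (free n (side Bottom D))"
    by (auto simp: inj_on_def doubleton_eq_iff)
  ultimately show ?thesis using bij_betw_same_card[OF m(1)] by (simp add: card_image)
qed

section \<open>Products of diagrams\<close>

lemma finite_half: "half n T \<Longrightarrow> finite T"
proof -
  assume "half n T"
  then have "T \<subseteq> Pow {..<n}" using halfD(1) by fastforce
  then show ?thesis by (rule finite_subset) simp
qed

lemma half_card:
  assumes T: "half n T"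
  shows "card (free n T) + 2 * card T = n"
proof -
  have c2: "card e = 2" "e \<subseteq> {..<n}" if "e \<in> T" for e using halfD(1)[OF T that] by auto
  have "pairwise disjnt T"
  proof (rule pairwiseI)
    fix e e' assume e: "e \<in> T" "e' \<in> T" "e \<noteq> e'"
    show "disjnt e e'"
    proof (rule ccontr)
      assume "\<not> disjnt e e'"
      then obtain x where x: "x \<in> e" "x \<in> e'" by (auto simp: disjnt_def)
      obtain y where y: "e = {x, y}" using halfD(1)[OF T e(1)] x(1) by blast
      obtain z where z: "e' = {x, z}" using halfD(1)[OF T e(2)] x(2) by blast
      show False using halfD(2)[OF T, of x y z] e y z by auto
    qed
  qed
  then have "card (\<Union>T) = sum card T"
    by (rule card_Union_disjoint) (use c2 in \<open>auto intro: finite_subset\<close>)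
  also have "\<dots> = 2 * card T" using c2 by simp
  finally have U: "card (\<Union>T) = 2 * card T" .
  have sub: "\<Union>T \<subseteq> {..<n}" using c2 by blast
  then have "card (free n T) = n - card (\<Union>T)"
    unfolding free_def by (subst card_Diff_subset) (auto intro: finite_subset)
  moreover have "card (\<Union>T) \<le> n" using card_mono[OF _ sub] by simp
  ultimately show ?thesis using U by simp
qed

lemma half_subset_eq:
  assumes "half n T" "half n T'" "T \<subseteq> T'" "card (free n T) = card (free n T')"
  shows "T = T'"
  using half_card[OF assms(1)] half_card[OF assms(2)] assms(3,4) finite_half[OF assms(2)]
  by (intro card_subset_eq) auto

lemma half_empty: "half n {}" by (simp add: half_def)

lemma free_subset: "T \<subseteq> T' \<Longrightarrow> free n T' \<subseteq> free n T" by (auto simp: free_def)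

lemma perfect_diag:
  "half n T \<Longrightarrow> half n B \<Longrightarrow> card (free n T) = card (free n B) \<Longrightarrow> perfect n (diag n T B)"
  using diag_tl by (simp add: tl_diagrams_iff)

lemma top_steps:
  "{(Top, i), (Top, j)} \<in> a \<Longrightarrow> ((Top, i), (Top, j)) \<in> stack_rel a b"
  "{(Bottom, i), (Bottom, j)} \<in> a \<Longrightarrow> ((Middle, i), (Middle, j)) \<in> stack_rel a b"
  "{(Bottom, i), (Top, j)} \<in> a \<Longrightarrow> ((Middle, i), (Top, j)) \<in> stack_rel a b"
  "{(Bottom, i), (Top, j)} \<in> a \<Longrightarrow> ((Top, j), (Middle, i)) \<in> stack_rel a b"
  using stack_rel_topI[of Top i Top j a b] stack_rel_topI[of Bottom i Bottom j a b]
    stack_rel_topI[of Bottom i Top j a b] stack_rel_topI[of Top j Bottom i a b]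
  by (auto simp: move_level_def insert_commute)

lemma bottom_steps:
  "{(Top, i), (Top, j)} \<in> b \<Longrightarrow> ((Middle, i), (Middle, j)) \<in> stack_rel a b"
  "{(Bottom, i), (Bottom, j)} \<in> b \<Longrightarrow> ((Bottom, i), (Bottom, j)) \<in> stack_rel a b"
  "{(Bottom, i), (Top, j)} \<in> b \<Longrightarrow> ((Bottom, i), (Middle, j)) \<in> stack_rel a b"
  "{(Bottom, i), (Top, j)} \<in> b \<Longrightarrow> ((Middle, j), (Bottom, i)) \<in> stack_rel a b"
  using stack_rel_bottomI[of Top i Top j b a] stack_rel_bottomI[of Bottom i Bottom j b a]
    stack_rel_bottomI[of Bottom i Top j b a] stack_rel_bottomI[of Top j Bottom i b a]
  by (auto simp: move_level_def insert_commute)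

text \<open>
Since products are perfect matchings, it is enough to find a path for every strand of the claimed
result.
\<close>

lemma tl_mult_eq_diagI:
  assumes T: "half n T" and B: "half n B" and card: "card (free n T) = card (free n B)"
    and a: "a \<in> tl_diagrams n" "b \<in> tl_diagrams n"
    and top: "\<And>i j. {i, j} \<in> T \<Longrightarrow> ((Top, i), (Top, j)) \<in> (stack_rel a b)\<^sup>*"
    and bot: "\<And>i j. {i, j} \<in> B \<Longrightarrow> ((Bottom, i), (Bottom, j)) \<in> (stack_rel a b)\<^sup>*"
    and through: "\<And>i j. i \<in> free n B \<Longrightarrow> j \<in> free n T \<Longrightarrow> rank n B i = rank n T j \<Longrightarrow>
      ((Bottom, i), (Top, j)) \<in> (stack_rel a b)\<^sup>*"
  shows "tl_mult n a b = diag n T B"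
proof (rule perfect_subset_eq[symmetric, OF perfect_diag[OF T B card]])
  show "perfect n (tl_mult n a b)" using tl_mult_closed[OF a] by (simp add: tl_diagrams_iff)
  fix p q assume e: "{p, q} \<in> diag n T B"
  have "(p, q) \<in> (stack_rel a b)\<^sup>*"
    using e
  proof (cases rule: diag_cases)
    case (4 i j)
    then have "(q, p) \<in> (stack_rel a b)\<^sup>*" using through by simp
    then show ?thesis using sym_rtrancl[OF sym_stack_rel] by (meson symD)
  qed (use top bot through in auto)
  then show "{p, q} \<in> tl_mult n a b"
    using perfect_points[OF perfect_diag[OF T B card] e] by (simp add: tl_mult_edge)
qed

lemma diag_mult:
  assumes T: "half n T" and M: "half n M" and B: "half n B"
    and card: "card (free n T) = card (free n M)" "card (free n M) = card (free n B)"
  shows "tl_mult n (diag n T M) (diag n M B) = diag n T B"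
proof (rule tl_mult_eq_diagI[OF T B])
  let ?R = "stack_rel (diag n T M) (diag n M B)"
  show "((Top, i), (Top, j)) \<in> ?R\<^sup>*" if "{i, j} \<in> T" for i j
    using top_steps(1)[of i j "diag n T M"] that by (simp add: diag_edges r_into_rtrancl)
  show "((Bottom, i), (Bottom, j)) \<in> ?R\<^sup>*" if "{i, j} \<in> B" for i j
    using bottom_steps(2)[of i j "diag n M B"] that by (simp add: diag_edges r_into_rtrancl)
  show "((Bottom, i), (Top, j)) \<in> ?R\<^sup>*" if i: "i \<in> free n B" "j \<in> free n T" "rank n B i = rank n T j" for i j
  proof -
    obtain m where m: "m \<in> free n M" "rank n M m = rank n B i"
      using rank_ex[of "rank n B i" n M] rank_less[OF i(1)] card by auto
    have "((Bottom, i), (Middle, m)) \<in> ?R" using bottom_steps(3)[of i m "diag n M B"] m i by (simp add: diag_edges)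
    moreover have "((Middle, m), (Top, j)) \<in> ?R" using top_steps(3)[of m j "diag n T M"] m i by (simp add: diag_edges)
    ultimately show ?thesis by (rule converse_rtrancl_into_rtrancl[OF _ r_into_rtrancl])
  qed
qed (use assms diag_tl in auto)

lemma arc_free_or_old:
  assumes "half n T" "half n T1" "T \<subseteq> T1" "{i, j} \<in> T1" "{i, j} \<notin> T"
  shows "i \<in> free n T" "j \<in> free n T"
proof -
  have n: "i < n" "j < n" using halfD(4)[OF assms(2,4)] by auto
  have "{i, k} \<notin> T" for k using halfD(2)[OF assms(2), of i j k] assms(3-5) by auto
  then show "i \<in> free n T" using n by (simp add: free_iff[OF assms(1)])
  have "{j, k} \<notin> T" for k using halfD(2)[OF assms(2), of j i k] assms(3-5) by (auto simp: insert_commute)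
  then show "j \<in> free n T" using n by (simp add: free_iff[OF assms(1)])
qed

text \<open>
The idempotent with sides \<open>T\<close> consists of the cups of \<open>T\<close> and vertical strands; the latter
carry over everything at the top of the other factor that is not in \<open>T\<close> already.
\<close>

lemma idem_diag_mult:
  assumes T: "half n T" and T1: "half n T1" and B: "half n B"
    and card: "card (free n T1) = card (free n B)" and sub: "T \<subseteq> T1"
  shows "tl_mult n (diag n T T) (diag n T1 B) = diag n T1 B"
proof (rule tl_mult_eq_diagI[OF T1 B card])
  let ?R = "stack_rel (diag n T T) (diag n T1 B)"
  have vert: "((Middle, i), (Top, i)) \<in> ?R" "((Top, i), (Middle, i)) \<in> ?R" if "i \<in> free n T" for i
    using top_steps(3,4)[of i i "diag n T T"] that by (auto simp: diag_edges)
  show "((Top, i), (Top, j)) \<in> ?R\<^sup>*" if ij: "{i, j} \<in> T1" for i j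
  proof (cases "{i, j} \<in> T")
    case True
    then show ?thesis using top_steps(1)[of i j "diag n T T"] by (simp add: diag_edges r_into_rtrancl)
  next
    case False
    note fr = arc_free_or_old[OF T T1 sub ij False]
    have "((Middle, i), (Middle, j)) \<in> ?R" using bottom_steps(1)[of i j "diag n T1 B"] ij by (simp add: diag_edges)
    then show ?thesis using vert(2)[OF fr(1)] vert(1)[OF fr(2)]
      by (meson converse_rtrancl_into_rtrancl r_into_rtrancl)
  qed
  show "((Bottom, i), (Bottom, j)) \<in> ?R\<^sup>*" if "{i, j} \<in> B" for i j
    using bottom_steps(2)[of i j "diag n T1 B"] that by (simp add: diag_edges r_into_rtrancl)
  show "((Bottom, i), (Top, j)) \<in> ?R\<^sup>*" if i: "i \<in> free n B" "j \<in> free n T1" "rank n B i = rank n T1 j" for i j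
  proof -
    have "((Bottom, i), (Middle, j)) \<in> ?R" using bottom_steps(3)[of i j "diag n T1 B"] i by (simp add: diag_edges)
    moreover have "((Middle, j), (Top, j)) \<in> ?R" using vert(1) free_subset[OF sub] i(2) by blast
    ultimately show ?thesis by (rule converse_rtrancl_into_rtrancl[OF _ r_into_rtrancl])
  qed
qed (use assms diag_tl in auto)

lemma diag_idem_mult:
  assumes T: "half n T" and T1: "half n T1" and B: "half n B"
    and card: "card (free n T1) = card (free n B)" and sub: "T \<subseteq> B"
  shows "tl_mult n (diag n T1 B) (diag n T T) = diag n T1 B"
proof (rule tl_mult_eq_diagI[OF T1 B card])
  let ?R = "stack_rel (diag n T1 B) (diag n T T)"
  have vert: "((Bottom, i), (Middle, i)) \<in> ?R" "((Middle, i), (Bottom, i)) \<in> ?R" if "i \<in> free n T" for i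
    using bottom_steps(3,4)[of i i "diag n T T"] that by (auto simp: diag_edges)
  show "((Bottom, i), (Bottom, j)) \<in> ?R\<^sup>*" if ij: "{i, j} \<in> B" for i j
  proof (cases "{i, j} \<in> T")
    case True
    then show ?thesis using bottom_steps(2)[of i j "diag n T T"] by (simp add: diag_edges r_into_rtrancl)
  next
    case False
    note fr = arc_free_or_old[OF T B sub ij False]
    have "((Middle, i), (Middle, j)) \<in> ?R" using top_steps(2)[of i j "diag n T1 B"] ij by (simp add: diag_edges)
    then show ?thesis using vert(1)[OF fr(1)] vert(2)[OF fr(2)]
      by (meson converse_rtrancl_into_rtrancl r_into_rtrancl)
  qed
  show "((Top, i), (Top, j)) \<in> ?R\<^sup>*" if "{i, j} \<in> T1" for i j
    using top_steps(1)[of i j "diag n T1 B"] that by (simp add: diag_edges r_into_rtrancl)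
  show "((Bottom, i), (Top, j)) \<in> ?R\<^sup>*" if i: "i \<in> free n B" "j \<in> free n T1" "rank n B i = rank n T1 j" for i j
  proof -
    have "((Bottom, i), (Middle, i)) \<in> ?R" using vert(1) free_subset[OF sub] i(1) by blast
    moreover have "((Middle, i), (Top, j)) \<in> ?R" using top_steps(3)[of i j "diag n T1 B"] i by (simp add: diag_edges)
    ultimately show ?thesis by (rule converse_rtrancl_into_rtrancl[OF _ r_into_rtrancl])
  qed
qed (use assms diag_tl in auto)

lemma side_mult:
  assumes "a \<in> tl_diagrams n" "b \<in> tl_diagrams n"
  shows "side Top a \<subseteq> side Top (tl_mult n a b)" "side Bottom b \<subseteq> side Bottom (tl_mult n a b)"
proof -
  have P: "perfect n a" "perfect n b" using assms by (auto simp: tl_diagrams_iff)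
  show "side Top a \<subseteq> side Top (tl_mult n a b)"
  proof
    fix e assume e: "e \<in> side Top a"
    obtain i j where ij: "e = {i, j}" using side_doubleton[OF e] by blast
    then have "{(Top, i), (Top, j)} \<in> a" using e by (simp add: side_iff)
    then show "e \<in> side Top (tl_mult n a b)"
      using top_steps(1) perfect_points[OF P(1)] unfolding ij by (fastforce simp: side_iff tl_mult_edge)
  qed
  show "side Bottom b \<subseteq> side Bottom (tl_mult n a b)"
  proof
    fix e assume e: "e \<in> side Bottom b"
    obtain i j where ij: "e = {i, j}" using side_doubleton[OF e] by blast
    then have "{(Bottom, i), (Bottom, j)} \<in> b" using e by (simp add: side_iff)
    then show "e \<in> side Bottom (tl_mult n a b)"
      using bottom_steps(2) perfect_points[OF P(2)] unfolding ij by (fastforce simp: side_iff tl_mult_edge)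
  qed
qed

lemma tl_one_eq_diag: "tl_one n = diag n {} {}"
proof -
  have "rank n {} i = i" if "i < n" for i
  proof -
    have "{x \<in> free n {}. x < i} = {..<i}" using that by (auto simp: free_def)
    then show ?thesis by (simp add: rank_def)
  qed
  then have "diag n {} {} = {{(Bottom, i), (Top, j)} | i j. i < n \<and> j < n \<and> i = j}"
    unfolding diag_def by (auto simp: free_def)
  then show ?thesis by (auto simp: tl_one_def)
qed

section \<open>Connectedness of half diagrams\<close>

lemma half_insert:
  assumes U: "half n U" and ab: "a < b" "a \<in> free n U" "b \<in> free n U"
    and inner: "\<And>x. a < x \<Longrightarrow> x < b \<Longrightarrow> \<exists>y. a < y \<and> y < b \<and> {x, y} \<in> U"
  shows "half n (insert {a, b} U)" "free n (insert {a, b} U) = free n U - {a, b}"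
proof -
  have f: "{a, x} \<notin> U" "{x, a} \<notin> U" "{b, x} \<notin> U" "{x, b} \<notin> U" for x
    using ab free_iff[OF U] by (auto simp: insert_commute)
  have nest: "\<exists>y. i < y \<and> y < j \<and> {x, y} \<in> insert {a, b} U"
    if "{i, j} \<in> insert {a, b} U" "i < x" "x < j" for i j x
  proof (cases "{i, j} \<in> U")
    case True
    then show ?thesis using halfD(3)[OF U True that(2,3)] by blast
  next
    case False
    then have "i = a" "j = b" using that ab(1) by (auto simp: doubleton_eq_iff)
    then show ?thesis using inner[of x] that by blast
  qed
  show "half n (insert {a, b} U)"
    unfolding half_def
  proof (intro conjI allI impI ballI)
    show "\<exists>i j. e = {i, j} \<and> i < j \<and> j < n" if "e \<in> insert {a, b} U" for e
      using that halfD(1)[OF U, of e] ab by (auto simp: free_def)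
    show "j = k" if "{i, j} \<in> insert {a, b} U \<and> {i, k} \<in> insert {a, b} U" for i j k
      using that halfD(2)[OF U] f ab(1) by (auto simp: doubleton_eq_iff)
    show "\<exists>y. i < y \<and> y < j \<and> {x, y} \<in> insert {a, b} U"
      if "{i, j} \<in> insert {a, b} U \<and> i < x \<and> x < j" for i j x using nest that by blast
  qed
  show "free n (insert {a, b} U) = free n U - {a, b}" by (auto simp: free_def)
qed

lemma half_remove:
  assumes T: "half n T" and ij: "{i, j} \<in> T" "i < j"
    and outer: "\<And>a b. {a, b} \<in> T \<Longrightarrow> a < i \<Longrightarrow> j < b \<Longrightarrow> False"
  shows "half n (T - {{i, j}})" "free n (T - {{i, j}}) = free n T \<union> {i, j}"
proof -
  have nest: "\<exists>y. a < y \<and> y < b \<and> {x, y} \<in> T - {{i, j}}"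
    if ab: "{a, b} \<in> T - {{i, j}}" "a < x" "x < b" for a b x
  proof -
    obtain y where y: "a < y" "y < b" "{x, y} \<in> T" using halfD(3)[OF T] ab by blast
    have "{x, y} \<noteq> {i, j}"
    proof
      assume "{x, y} = {i, j}"
      then have "a < i" "j < b" using y ab by (auto simp: doubleton_eq_iff)
      then show False using outer[of a b] ab by blast
    qed
    then show ?thesis using y by blast
  qed
  show h: "half n (T - {{i, j}})"
    unfolding half_def
  proof (intro conjI allI impI ballI)
    show "\<exists>i' j'. e = {i', j'} \<and> i' < j' \<and> j' < n" if "e \<in> T - {{i, j}}" for e
      using that halfD(1)[OF T, of e] by blast
    show "j' = k'" if "{i', j'} \<in> T - {{i, j}} \<and> {i', k'} \<in> T - {{i, j}}" for i' j' k'
      using that halfD(2)[OF T] by blast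
    show "\<exists>y. a < y \<and> y < b \<and> {x, y} \<in> T - {{i, j}}" if "{a, b} \<in> T - {{i, j}} \<and> a < x \<and> x < b" for a b x
      using nest that by blast
  qed
  have n: "i < n" "j < n" using halfD(4)[OF T ij(1)] by auto
  have "x \<in> free n (T - {{i, j}}) \<longleftrightarrow> x \<in> free n T \<union> {i, j}" for x
  proof -
    have ji: "{j, i} \<in> T" using ij(1) by (simp add: insert_commute)
    consider "x = i" | "x = j" | "x \<noteq> i" "x \<noteq> j" by blast
    then show ?thesis
    proof cases
      case 1
      then show ?thesis using halfD(2)[OF T ij(1)] n unfolding free_iff[OF h] by blast
    next
      case 2
      have "{j, y} \<notin> T - {{i, j}}" for y using halfD(2)[OF T ji, of y] by (auto simp: insert_commute)
      then show ?thesis using 2 n unfolding free_iff[OF h] by blast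
    next
      case 3
      then have "{x, y} \<noteq> {i, j}" for y by (auto simp: doubleton_eq_iff)
      then show ?thesis using 3 unfolding free_iff[OF h] Un_iff free_iff[OF T] by blast
    qed
  qed
  then show "free n (T - {{i, j}}) = free n T \<union> {i, j}" by blast
qed

lemma half_extend:
  assumes "half n T"
  shows "\<exists>T1. half n T1 \<and> T \<subseteq> T1 \<and> card (free n T1) \<le> 1"
  using assms
proof (induction "card (free n T)" arbitrary: T rule: less_induct)
  case less
  show ?case
  proof (cases "card (free n T) \<le> 1")
    case True
    then show ?thesis using less.prems by blast
  next
    case False
    define a where "a = Min (free n T)"
    have ne: "free n T \<noteq> {}" using False by auto
    have a: "a \<in> free n T" "\<And>x. x \<in> free n T \<Longrightarrow> a \<le> x" using ne finite_free by (auto simp: a_def)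
    define b where "b = Min (free n T - {a})"
    have "card (free n T - {a}) \<noteq> 0" using False a(1) finite_free by (simp add: card_Diff_singleton)
    then have ne': "free n T - {a} \<noteq> {}" by (metis card.empty)
    have b: "b \<in> free n T - {a}" "\<And>x. x \<in> free n T - {a} \<Longrightarrow> b \<le> x"
      using ne' finite_free[of n T] Min_in[of "free n T - {a}"] by (auto simp: b_def)
    have ab: "a < b" "b < n" using a b by (auto simp: free_def le_less)
    have inner: "\<exists>y. a < y \<and> y < b \<and> {x, y} \<in> T" if x: "a < x" "x < b" for x
    proof -
      have "x \<notin> free n T" using b(2)[of x] x by auto
      then obtain y where y: "{x, y} \<in> T" using free_iff[OF less.prems] x ab by auto
      then have y': "{y, x} \<in> T" by (simp add: insert_commute)
      have "y \<noteq> a" "y \<noteq> b" using y' a(1) b(1) free_iff[OF less.prems] by auto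
      moreover have "\<not> y < a" using halfD(3)[OF less.prems y', of a] x a(1) free_iff[OF less.prems] by blast
      moreover have "\<not> b < y" using halfD(3)[OF less.prems y, of b] x b(1) free_iff[OF less.prems] by blast
      ultimately show ?thesis using y by (intro exI[of _ y]) auto
    qed
    have bf: "b \<in> free n T" using b(1) by simp
    have ins: "half n (insert {a, b} T)" "free n (insert {a, b} T) = free n T - {a, b}"
      using half_insert[OF less.prems ab(1) a(1) bf] inner by blast+
    have "card (free n (insert {a, b} T)) < card (free n T)"
      unfolding ins(2) by (rule psubset_card_mono) (use a(1) finite_free in auto)
    from less.hyps[OF this ins(1)] show ?thesis by blast
  qed
qed

definition std :: "nat \<Rightarrow> nat set set" where
  "std m = {{2 * i, 2 * i + 1} | i. i < m}"

lemma std_Suc: "std (Suc m) = insert {2 * m, 2 * m + 1} (std m)"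
  by (auto simp: std_def less_Suc_eq)

lemma half_std: "2 * m \<le> n \<Longrightarrow> half n (std m) \<and> card (std m) = m \<and> free n (std m) = {2 * m..<n}"
proof (induction m)
  case 0
  show ?case by (auto simp: std_def half_empty free_def)
next
  case (Suc m)
  then have IH: "half n (std m)" "card (std m) = m" "free n (std m) = {2 * m..<n}" by auto
  have m: "2 * m < 2 * m + 1" "2 * m \<in> free n (std m)" "2 * m + 1 \<in> free n (std m)" using IH(3) Suc.prems by auto
  have inner: "\<exists>y. 2 * m < y \<and> y < 2 * m + 1 \<and> {x, y} \<in> std m" if "2 * m < x" "x < 2 * m + 1" for x
    using that by simp
  have ins: "half n (insert {2 * m, 2 * m + 1} (std m))"
    "free n (insert {2 * m, 2 * m + 1} (std m)) = free n (std m) - {2 * m, 2 * m + 1}"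
    using half_insert[OF IH(1) m] inner by blast+
  have "{2 * m, 2 * m + 1} \<notin> std m" by (auto simp: std_def doubleton_eq_iff)
  then have "card (std (Suc m)) = Suc m" unfolding std_Suc using IH(2) finite_half[OF IH(1)] by simp
  moreover have "free n (std (Suc m)) = {2 * Suc m..<n}" unfolding std_Suc ins(2) IH(3) by auto
  moreover have "half n (std (Suc m))" unfolding std_Suc by (rule ins(1))
  ultimately show ?case by simp
qed

text \<open>
The cups of the prefix already use up all points below \<open>2 m\<close>.
\<close>

lemma std_prefix:
  assumes T: "half n T" and std: "std m \<subseteq> T" and ab: "{a, b} \<in> T" "a < 2 * m"
  shows "b < 2 * m"
proof -
  define c where "c = a div 2"
  have c: "c < m" using ab(2) by (auto simp: c_def)
  then have e: "{2 * c, 2 * c + 1} \<in> T" using std by (auto simp: std_def)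
  have "a = 2 * c \<or> a = 2 * c + 1" by (auto simp: c_def)
  then have "b = 2 * c + 1 \<or> b = 2 * c"
  proof
    assume "a = 2 * c"
    then show ?thesis using halfD(2)[OF T e] ab(1) by blast
  next
    assume "a = 2 * c + 1"
    moreover have "{2 * c + 1, 2 * c} \<in> T" using e by (simp add: insert_commute)
    ultimately show ?thesis using halfD(2)[OF T, of a "2 * c" b] ab(1) by blast
  qed
  then show ?thesis using c by auto
qed

text \<open>
The relation \<open>Q\<close> will be the one that multiplication from one side induces between the
idempotents \<open>(T, T)\<close>, where a half diagram is related to all larger ones.
\<close>

locale half_connection =
  fixes n k :: nat and Q :: "nat set set \<Rightarrow> nat set set \<Rightarrow> bool"
  assumes n: "5 \<le> n" and k: "3 \<le> k" "even (n + k)"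
    and sym: "Q T T' \<Longrightarrow> Q T' T" and trans: "Q T T' \<Longrightarrow> Q T' T'' \<Longrightarrow> Q T T''"
    and sub: "\<lbrakk>half n T; half n T'; T \<subseteq> T'; T \<noteq> {}; card (free n T) \<le> k\<rbrakk> \<Longrightarrow> Q T T'"
begin

lemma via:
  assumes "half n U" "half n T" "half n T'" "U \<subseteq> T" "U \<subseteq> T'" "card (free n U) \<le> k" "card (free n U) < n"
  shows "Q T T'"
proof -
  have "U \<noteq> {}" using assms(7) by (auto simp: free_def)
  then show ?thesis using sub[OF assms(1,2)] sub[OF assms(1,3)] assms sym trans by blast
qed

text \<open>
With the defect at position \<open>i = 2 m\<close>, the cup \<open>{i + 1, q}\<close> is exposed. Opening it leaves three
free points, and closing \<open>{i, i + 1}\<close> instead moves the defect to \<open>q\<close>.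
\<close>

lemma odd_step:
  assumes T: "half n T" and free: "free n T = {2 * m}" and std: "std m \<subseteq> T" and m: "2 * m + 2 \<le> n"
  shows "\<exists>T'. half n T' \<and> card (free n T') \<le> 1 \<and> std (Suc m) \<subseteq> T' \<and> Q T T'"
proof -
  let ?i = "2 * m"
  have iT: "{?i, x} \<notin> T" "{x, ?i} \<notin> T" for x using free free_iff[OF T, of ?i] by (auto simp: insert_commute)
  have "?i + 1 \<notin> free n T" using free by simp
  then obtain q where q: "{?i + 1, q} \<in> T" using free_iff[OF T] m by auto
  have qi: "?i + 1 < q"
  proof (rule ccontr)
    assume "\<not> ?i + 1 < q"
    moreover have "q \<noteq> ?i + 1" using halfD(4)[OF T q] by simp
    moreover have "q \<noteq> ?i" using q iT by blast
    ultimately have "q < ?i" by simp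
    moreover have "{q, ?i + 1} \<in> T" using q by (simp add: insert_commute)
    ultimately show False using std_prefix[OF T std] by fastforce
  qed
  define U where "U = T - {{?i + 1, q}}"
  have outer: False if "{a, b} \<in> T" "a < ?i + 1" "q < b" for a b
  proof (cases "a = ?i")
    case False
    then show ?thesis using std_prefix[OF T std that(1)] that qi by simp
  qed (use that iT in blast)
  have hU: "half n U" and fU: "free n U = {?i, ?i + 1, q}"
    using half_remove[OF T q qi outer] free by (auto simp: U_def)
  have "card (free n U) \<le> 3" unfolding fU by (simp add: card_insert_if)
  then have cU: "card (free n U) \<le> k" "card (free n U) < n" using k n by auto
  have ins: "half n (insert {?i, ?i + 1} U)" "free n (insert {?i, ?i + 1} U) = {q}"
    using half_insert[OF hU, of ?i "?i + 1"] fU qi by auto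
  have "?i + 1 \<notin> \<Union>(std m)" by (auto simp: std_def)
  then have "std m \<subseteq> U" using std by (auto simp: U_def)
  then have "std (Suc m) \<subseteq> insert {?i, ?i + 1} U" unfolding std_Suc by auto
  moreover have "Q T (insert {?i, ?i + 1} U)"
    by (rule via[OF hU T ins(1) _ _ cU]) (auto simp: U_def)
  moreover have "card (free n (insert {?i, ?i + 1} U)) \<le> 1" unfolding ins(2) by simp
  ultimately show ?thesis using ins(1) by blast
qed

text \<open>
Let \<open>i = 2 m\<close> be the first point beyond the standard prefix, and suppose that it is matched with
\<open>j > i + 1\<close>. If there is a defect \<open>d\<close>, then it lies to the right of \<open>j\<close>; replacing \<open>{i, j}\<close> by
\<open>{j, d}\<close> moves it to \<open>i\<close>. Otherwise \<open>{i, j}\<close> and the cup \<open>{i + 1, q}\<close> nested in it are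
replaced by \<open>{i, i + 1}\<close> and \<open>{q, j}\<close>.
\<close>

lemma full_step:
  assumes T: "half n T" and full: "card (free n T) \<le> 1" and std: "std m \<subseteq> T" and m: "2 * m + 2 \<le> n"
  shows "\<exists>T'. half n T' \<and> card (free n T') \<le> 1 \<and> std (Suc m) \<subseteq> T' \<and> Q T T'"
proof -
  let ?i = "2 * m"
  have refl: "Q T T"
    by (rule sub[OF T T]) (use full k n in \<open>auto simp: free_def\<close>)
  have pre: False if "{a, b} \<in> T" "a < ?i" "?i \<le> b" for a b using std_prefix[OF T std that(1,2)] that(3) by simp
  have pre_free: "?i \<le> x" if "x \<in> free n T" for x
  proof (rule ccontr)
    assume "\<not> ?i \<le> x"
    then have "x \<in> \<Union>(std m)"
      unfolding std_def by (intro UnionI[of "{2 * (x div 2), 2 * (x div 2) + 1}"]) auto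
    then show False using that std by (auto simp: free_def)
  qed
  show ?thesis
  proof (cases "?i \<in> free n T")
    case True
    have "free n T = {?i}"
    proof
      show "free n T \<subseteq> {?i}"
      proof
        fix x assume "x \<in> free n T"
        then have "card {x, ?i} \<le> 1" using full card_mono[OF finite_free, of "{x, ?i}" n T] True by auto
        then show "x \<in> {?i}" by (cases "x = ?i") auto
      qed
    qed (use True in simp)
    then show ?thesis using odd_step[OF T _ std m] by blast
  next
    case False
    then obtain j where j: "{?i, j} \<in> T" using free_iff[OF T] m by auto
    have j': "{j, ?i} \<in> T" using j by (simp add: insert_commute)
    have ij: "?i < j" using pre[OF j'] halfD(4)[OF T j] by (cases j ?i rule: linorder_cases) auto
    show ?thesis
    proof (cases "j = ?i + 1")
      case True
      then have "std (Suc m) \<subseteq> T" unfolding std_Suc using std j by auto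
      then show ?thesis using T full refl by blast
    next
      case ne: False
      obtain q where q: "?i < q" "q < j" "{?i + 1, q} \<in> T" using halfD(3)[OF T j, of "?i + 1"] ij ne by auto
      have qi: "?i + 1 < q" using q halfD(4)[OF T q(3)] by auto
      define U where "U = T - {{?i, j}}"
      have rem: "half n U" "free n U = free n T \<union> {?i, j}"
        using half_remove[OF T j ij] pre ij unfolding U_def by (metis less_imp_le order_less_le_trans)+
      have iS: "?i \<notin> \<Union>(std m)" unfolding std_def by auto presburger
      then have stdU: "std m \<subseteq> U" using std by (auto simp: U_def)
      show ?thesis
      proof (cases "free n T = {}")
        case False
        \<comment> \<open>\<open>n\<close> is odd: only \<open>{i, j}\<close> is opened, so that three points are free\<close>
        then obtain d where d: "d \<in> free n T" by blast
        have dT: "free n T = {d}"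
        proof -
          have "x = d" if "x \<in> free n T" for x
          proof (rule ccontr)
            assume "x \<noteq> d"
            then have "card {x, d} = 2" by simp
            then show False using full card_mono[OF finite_free, of "{x, d}" n T] that d by auto
          qed
          then show ?thesis using d by blast
        qed
        have fd: "{d, x} \<notin> T" "{x, d} \<notin> T" for x using d free_iff[OF T] by (auto simp: insert_commute)
        have jd: "j < d"
        proof -
          have "?i \<le> d" using pre_free d by blast
          moreover have "d \<noteq> ?i" "d \<noteq> j" using fd(1) j j' by blast+
          moreover have "\<not> (?i < d \<and> d < j)" using halfD(3)[OF T j, of d] fd by blast
          ultimately show ?thesis by linarith
        qed
        have inner: "\<exists>y. j < y \<and> y < d \<and> {x, y} \<in> U" if x: "j < x" "x < d" for x
        proof -
          have "x \<notin> free n T" using dT x by simp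
          moreover have "x < n" using d x by (simp add: free_def)
          ultimately have "x \<notin> free n T" "x < n" .
          then obtain y where y: "{x, y} \<in> T" using free_iff[OF T] by auto
          then have y': "{y, x} \<in> T" by (simp add: insert_commute)
          have "y \<noteq> d" using y fd by blast
          moreover have "\<not> d < y" using halfD(3)[OF T y x(2)] fd by blast
          moreover have "y \<noteq> j" using halfD(2)[OF T j', of x] y' x ij by auto
          moreover have "\<not> y < j"
          proof
            assume yj: "y < j"
            obtain z where z: "y < z" "{j, z} \<in> T" using halfD(3)[OF T y' yj x(1)] by blast
            then have "z = ?i" using halfD(2)[OF T j'] by blast
            then show False using pre[OF y'] z x ij by simp
          qed
          ultimately have "j < y" "y < d" by auto
          then show ?thesis using y ij x by (intro exI[of _ y]) (auto simp: U_def doubleton_eq_iff)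
        qed
        have "d \<in> free n U" "j \<in> free n U" using rem(2) d by auto
        from half_insert[OF rem(1) jd this(2,1)] inner
        have ins: "half n (insert {j, d} U)" "free n (insert {j, d} U) = free n U - {j, d}" by blast+
        have f2: "free n (insert {j, d} U) = {?i}" unfolding ins(2) rem(2) dT using ij jd by auto
        have "card (free n U) \<le> 3" unfolding rem(2) dT by (simp add: card_insert_if)
        then have cU: "card (free n U) \<le> k" "card (free n U) < n" using k n by auto
        have Q1: "Q T (insert {j, d} U)" by (rule via[OF rem(1) T ins(1) _ _ cU]) (auto simp: U_def)
        have "std m \<subseteq> insert {j, d} U" using stdU by auto
        from odd_step[OF ins(1) f2 this m] Q1 show ?thesis using trans by blast
      next
        case True
        \<comment> \<open>\<open>n\<close> is even: four points become free, and parity gives \<open>k \<ge> 4\<close>\<close>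
        have "even n" using half_card[OF T] True by (metis add_0 card.empty dvd_triv_left)
        then have n6: "6 \<le> n" "4 \<le> k" using n k by presburger+
        have qU: "{?i + 1, q} \<in> U" using q qi by (auto simp: U_def doubleton_eq_iff)
        have outer: False if ab: "{a, b} \<in> U" "a < ?i + 1" "q < b" for a b
        proof (cases "a = ?i")
          case True
          then have "b = j" using halfD(2)[OF T j] ab(1) by (auto simp: U_def)
          then show False using True ab(1) by (simp add: U_def)
        next
          case False
          then show False using pre[of a b] ab qi by (auto simp: U_def)
        qed
        define V where "V = U - {{?i + 1, q}}"
        have remV: "half n V" "free n V = {?i, ?i + 1, q, j}"
          using half_remove[OF rem(1) qU qi outer] rem(2) True by (auto simp: V_def)
        have insW: "half n (insert {?i, ?i + 1} V)" "free n (insert {?i, ?i + 1} V) = {q, j}"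
          using half_insert[OF remV(1), of ?i "?i + 1"] remV(2) qi ij ne q by auto
        define W where "W = insert {?i, ?i + 1} V"
        have inner: "\<exists>y. q < y \<and> y < j \<and> {x, y} \<in> W" if x: "q < x" "x < j" for x
        proof -
          obtain y where y: "?i < y" "y < j" "{x, y} \<in> T" using halfD(3)[OF T j, of x] x q by auto
          have y': "{y, x} \<in> T" using y by (simp add: insert_commute)
          have q': "{q, ?i + 1} \<in> T" using q by (simp add: insert_commute)
          have yq: "y \<noteq> q" using halfD(2)[OF T q', of x] y' x qi by auto
          have yi: "y \<noteq> ?i + 1" using halfD(2)[OF T q(3), of x] y' x by auto
          have "q < y"
          proof (rule ccontr)
            assume "\<not> q < y"
            then have "?i + 1 < y" "y < q" using yq yi y by auto
            then obtain z where "z < q" "{y, z} \<in> T" using halfD(3)[OF T q(3), of y] by auto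
            then show False using halfD(2)[OF T y'] x by auto
          qed
          moreover have "{x, y} \<in> W" using y yq yi x qi q by (auto simp: W_def V_def U_def doubleton_eq_iff)
          ultimately show ?thesis using y by blast
        qed
        have fW: "free n W = {q, j}" "half n W" using insW by (auto simp: W_def)
        have ins: "half n (insert {q, j} W)" "free n (insert {q, j} W) = {}"
          using half_insert[OF fW(2) q(2) _ _ inner] fW(1) by auto
        have "card (free n V) \<le> 4" unfolding remV(2) by (simp add: card_insert_if)
        then have cV: "card (free n V) \<le> k" "card (free n V) < n" using n6 by auto
        have "?i + 1 \<notin> \<Union>(std m)" by (auto simp: std_def)
        then have "std m \<subseteq> V" using stdU by (auto simp: V_def)
        then have "std (Suc m) \<subseteq> insert {q, j} W" unfolding std_Suc W_def by auto
        moreover have "Q T (insert {q, j} W)"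
          by (rule via[OF remV(1) T ins(1) _ _ cV]) (auto simp: V_def U_def W_def)
        ultimately show ?thesis using ins by (intro exI[of _ "insert {q, j} W"]) auto
      qed
    qed
  qed
qed

lemma full_connected:
  assumes T: "half n T" and full: "card (free n T) \<le> 1"
  shows "Q T (std (n div 2))"
proof -
  have "2 * m \<le> n \<Longrightarrow> \<exists>T'. half n T' \<and> card (free n T') \<le> 1 \<and> std m \<subseteq> T' \<and> Q T T'" for m
  proof (induction m)
    case 0
    have "Q T T" by (rule sub[OF T T]) (use full k n in \<open>auto simp: free_def\<close>)
    then show ?case using T full by (intro exI[of _ T]) (auto simp: std_def)
  next
    case (Suc m)
    then obtain T' where T': "half n T'" "card (free n T') \<le> 1" "std m \<subseteq> T'" "Q T T'" by auto
    from full_step[OF T'(1-3)] Suc.prems obtain T'' where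
      "half n T''" "card (free n T'') \<le> 1" "std (Suc m) \<subseteq> T''" "Q T' T''" by auto
    then show ?case using T'(4) trans by blast
  qed
  from this[of "n div 2"] obtain T' where T': "half n T'" "card (free n T') \<le> 1" "std (n div 2) \<subseteq> T'" "Q T T'" by auto
  have h: "half n (std (n div 2))" "card (std (n div 2)) = n div 2" using half_std[of "n div 2" n] by auto
  have "card T' = n div 2" using half_card[OF T'(1)] T'(2) by auto
  then have "std (n div 2) = T'" using T'(3) h finite_half[OF T'(1)] by (intro card_subset_eq) auto
  then show ?thesis using T'(4) by simp
qed

theorem connected:
  assumes T: "half n T" "T \<noteq> {}" "card (free n T) \<le> k" and T': "half n T'" "T' \<noteq> {}" "card (free n T') \<le> k"
  shows "Q T T'"
proof -
  have "Q T (std (n div 2))" if T: "half n T" "T \<noteq> {}" "card (free n T) \<le> k" for T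
  proof -
    obtain T1 where "half n T1" "T \<subseteq> T1" "card (free n T1) \<le> 1" using half_extend[OF T(1)] by blast
    then show ?thesis using sub[OF T(1) _ _ T(2,3)] full_connected trans by blast
  qed
  then show ?thesis using T T' sym trans by blast
qed

end

section \<open>The cells of the Temperley--Lieb monoids\<close>

abbreviation level_of :: "diagram \<Rightarrow> nat" where
  "level_of D \<equiv> card (through_strands D)"

definition std_idem :: "nat \<Rightarrow> nat \<Rightarrow> diagram" where
  "std_idem n l = diag n (std ((n - l) div 2)) (std ((n - l) div 2))"

lemma level_diag:
  assumes "half n T" "half n B" "card (free n T) = card (free n B)"
  shows "level_of (diag n T B) = card (free n T)"
  using card_through_strands[OF diag_tl[OF assms]] side_diag[OF assms(1,2)] by simp

lemma tl_diagram_cases: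
  assumes "D \<in> tl_diagrams n"
  obtains T B where "half n T" "half n B" "card (free n T) = card (free n B)" "D = diag n T B"
    "T = side Top D" "B = side Bottom D"
  using that half_side[OF assms] card_free_sides[OF assms] tl_diagram_eq_diag[OF assms] by metis

lemma level_parity:
  assumes "D \<in> tl_diagrams n"
  shows "level_of D \<le> n" "even (n - level_of D)"
proof -
  have "level_of D + 2 * card (side Top D) = n"
    using half_card[of n "side Top D"] half_side[OF assms, of Top] card_through_strands[OF assms] by simp
  then show "level_of D \<le> n" "even (n - level_of D)" by presburger+
qed

text \<open>
A diagram with \<open>n\<close> through strands has no cups, so there is only one.
\<close>

lemma level_eq_n_iff:
  assumes D: "D \<in> tl_diagrams n"
  shows "level_of D = n \<longleftrightarrow> D = tl_one n"
proof -
  obtain T B where TB: "half n T" "half n B" "card (free n T) = card (free n B)" "D = diag n T B"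
    using tl_diagram_cases[OF D] by metis
  have "level_of D = n \<longleftrightarrow> card T = 0" using level_diag[OF TB(1-3)] half_card[OF TB(1)] TB(4) by auto
  also have "\<dots> \<longleftrightarrow> T = {} \<and> B = {}"
    using half_card[OF TB(1)] half_card[OF TB(2)] TB(3) finite_half[OF TB(1)] finite_half[OF TB(2)]
      card_0_eq[of T] card_0_eq[of B] by linarith
  also have "\<dots> \<longleftrightarrow> D = tl_one n"
    using TB(4) tl_one_eq_diag[of n] side_diag[OF TB(1,2)] side_diag[OF half_empty half_empty, of n] by metis
  finally show ?thesis .
qed

lemma std_idem:
  assumes "l \<le> n" "even (n - l)"
  shows "half n (std ((n - l) div 2))" "card (free n (std ((n - l) div 2))) = l"
    "std_idem n l \<in> tl_diagrams n" "level_of (std_idem n l) = l"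
proof -
  have "half n (std ((n - l) div 2)) \<and> free n (std ((n - l) div 2)) = {2 * ((n - l) div 2)..<n}"
    using half_std[of "(n - l) div 2" n] by simp
  then show h: "half n (std ((n - l) div 2))" and c: "card (free n (std ((n - l) div 2))) = l"
    using assms by auto
  show "std_idem n l \<in> tl_diagrams n" "level_of (std_idem n l) = l"
    unfolding std_idem_def using diag_tl[OF h h] level_diag[OF h h] c by auto
qed

lemma TL_simps: "carrier (TL n) = tl_diagrams n" "mult (TL n) = tl_mult n" "one (TL n) = tl_one n"
  by (simp_all add: TL_def)

lemma tl_one_tl: "tl_one n \<in> tl_diagrams n"
  unfolding tl_one_eq_diag by (rule diag_tl[OF half_empty half_empty refl])

text \<open>
The identity is the only diagram of level \<open>n\<close>, which gives a description of the carrier by levels.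
\<close>

lemma TL_trunc_simps:
  "carrier (TL_trunc n k) = {D \<in> tl_diagrams n. level_of D \<le> k \<or> level_of D = n}"
  "mult (TL_trunc n k) = tl_mult n" "one (TL_trunc n k) = tl_one n"
  using level_eq_n_iff tl_one_tl by (auto simp: TL_trunc_def TL_simps TL_J_def)

lemma TL_eq_trunc: "TL n = TL_trunc n n"
proof -
  have "carrier (TL_trunc n n) = tl_diagrams n" using level_parity(1) by (auto simp: TL_trunc_simps)
  then show ?thesis by (simp add: TL_trunc_def TL_def)
qed

lemma finite_tl_diagrams: "finite (tl_diagrams n)"
proof -
  have "tl_diagrams n \<subseteq> Pow (Pow (points n))"
    unfolding tl_diagrams_def partition_on_def by blast
  moreover have "finite (points n)" by (simp add: points_def)
  ultimately show ?thesis by (meson finite_Pow_iff finite_subset)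
qed

lemma level_mult_le:
  assumes a: "a \<in> tl_diagrams n" and b: "b \<in> tl_diagrams n"
  shows "level_of (tl_mult n a b) \<le> level_of a" "level_of (tl_mult n a b) \<le> level_of b"
proof -
  note ab = tl_mult_closed[OF a b]
  have "card (free n (side Top (tl_mult n a b))) \<le> card (free n (side Top a))"
    by (rule card_mono[OF finite_free free_subset[OF side_mult(1)[OF a b]]])
  then show "level_of (tl_mult n a b) \<le> level_of a" unfolding card_through_strands[OF a] card_through_strands[OF ab] .
  have "card (free n (side Bottom (tl_mult n a b))) \<le> card (free n (side Bottom b))"
    by (rule card_mono[OF finite_free free_subset[OF side_mult(2)[OF a b]]])
  then show "level_of (tl_mult n a b) \<le> level_of b" unfolding card_through_strands[OF b] card_through_strands[OF ab] card_free_sides[OF b] card_free_sides[OF ab] .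
qed

lemma tl_one_left: "a \<in> tl_diagrams n \<Longrightarrow> tl_mult n (tl_one n) a = a"
  using idem_diag_mult[OF half_empty] unfolding tl_one_eq_diag by (metis empty_subsetI tl_diagram_cases)

lemma tl_one_right: "a \<in> tl_diagrams n \<Longrightarrow> tl_mult n a (tl_one n) = a"
  using diag_idem_mult[OF half_empty] unfolding tl_one_eq_diag by (metis empty_subsetI tl_diagram_cases)

lemma monoid_TL_trunc: "monoid (TL_trunc n k)"
proof (rule monoidI)
  fix a b assume ab: "a \<in> carrier (TL_trunc n k)" "b \<in> carrier (TL_trunc n k)"
  then have t: "a \<in> tl_diagrams n" "b \<in> tl_diagrams n" by (auto simp: TL_trunc_simps)
  show "a \<otimes>\<^bsub>TL_trunc n k\<^esub> b \<in> carrier (TL_trunc n k)"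
  proof (cases "level_of a = n \<and> level_of b = n")
    case True
    then have "tl_mult n a b = tl_one n" using t level_eq_n_iff tl_one_left[OF tl_one_tl] by metis
    then show ?thesis using tl_one_tl level_eq_n_iff by (simp add: TL_trunc_simps)
  next
    case False
    then show ?thesis using ab level_mult_le[OF t] tl_mult_closed[OF t] by (auto simp: TL_trunc_simps)
  qed
qed (auto simp: TL_trunc_simps tl_one_tl tl_one_left tl_one_right tl_mult_assoc level_eq_n_iff)

text \<open>
Diagrams \<open>(T, B)\<close> and \<open>(T', B')\<close> of the same level are conjugated into each other by
\<open>(T', T)\<close> and \<open>(B, B')\<close>. A product \<open>e s e\<close> contains the cups of \<open>e\<close> on both sides, so it is
equal to \<open>e\<close> if it has no more cups.
\<close>

lemma cell_chain_TL_trunc: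
  assumes k: "k \<le> n" "even (n - k)"
  shows "cell_chain (TL_trunc n k) level_of (std_idem n)"
    and "level_of ` carrier (TL_trunc n k) = {l. l \<le> n \<and> even (n - l) \<and> (l \<le> k \<or> l = n)}"
proof -
  let ?S = "TL_trunc n k"
  show \<Lambda>: "level_of ` carrier ?S = {l. l \<le> n \<and> even (n - l) \<and> (l \<le> k \<or> l = n)}"
  proof
    show "level_of ` carrier ?S \<subseteq> {l. l \<le> n \<and> even (n - l) \<and> (l \<le> k \<or> l = n)}"
      using level_parity by (auto simp: TL_trunc_simps)
    show "{l. l \<le> n \<and> even (n - l) \<and> (l \<le> k \<or> l = n)} \<subseteq> level_of ` carrier ?S"
    proof
      fix l assume l: "l \<in> {l. l \<le> n \<and> even (n - l) \<and> (l \<le> k \<or> l = n)}"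
      then have "std_idem n l \<in> carrier ?S" "level_of (std_idem n l) = l"
        using std_idem[of l n] by (auto simp: TL_trunc_simps)
      then show "l \<in> level_of ` carrier ?S" by force
    qed
  qed
  have tl: "a \<in> tl_diagrams n" if "a \<in> carrier ?S" for a using that by (simp add: TL_trunc_simps)
  have carI: "D \<in> carrier ?S" if "D \<in> tl_diagrams n" "level_of D = level_of a" "a \<in> carrier ?S" for D a
    using that by (simp add: TL_trunc_simps)
  have conj: "\<exists>x\<in>carrier ?S. \<exists>y\<in>carrier ?S. b = tl_mult n (tl_mult n x a) y"
    if a: "a \<in> carrier ?S" and b: "b \<in> carrier ?S" and l: "level_of a = level_of b" for a b
  proof -
    obtain T B where TB: "half n T" "half n B" "card (free n T) = card (free n B)" "a = diag n T B"
      using tl_diagram_cases[OF tl[OF a]] by metis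
    obtain T' B' where TB': "half n T'" "half n B'" "card (free n T') = card (free n B')" "b = diag n T' B'"
      using tl_diagram_cases[OF tl[OF b]] by metis
    have c: "card (free n T) = card (free n T')" using level_diag[OF TB(1-3)] level_diag[OF TB'(1-3)] l TB(4) TB'(4) by simp
    have "diag n T' T \<in> carrier ?S"
      by (rule carI[OF diag_tl _ a]) (use TB TB' c level_diag in auto)
    moreover have "diag n B B' \<in> carrier ?S"
      by (rule carI[OF diag_tl _ a]) (use TB TB' c level_diag in auto)
    moreover have "b = tl_mult n (tl_mult n (diag n T' T) a) (diag n B B')"
      using TB TB' c by (simp add: diag_mult)
    ultimately show ?thesis by blast
  qed
  have Ecar: "std_idem n l \<in> carrier ?S" "level_of (std_idem n l) = l" if "l \<in> level_of ` carrier ?S" for l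
    using that std_idem[of l n] unfolding \<Lambda> by (auto simp: TL_trunc_simps)
  show "cell_chain ?S level_of (std_idem n)"
  proof (rule cell_chain.intro[OF monoid_TL_trunc], unfold_locales)
    show "finite (carrier ?S)" using finite_tl_diagrams by (simp add: TL_trunc_simps)
    show "level_of (x \<otimes>\<^bsub>?S\<^esub> y) \<le> level_of x" "level_of (x \<otimes>\<^bsub>?S\<^esub> y) \<le> level_of y"
      if "x \<in> carrier ?S" "y \<in> carrier ?S" for x y
      using level_mult_le[OF tl tl] that by (auto simp: TL_trunc_simps(2))
    show "x = \<one>\<^bsub>?S\<^esub>" if "x \<in> carrier ?S" "level_of x = level_of \<one>\<^bsub>?S\<^esub>" for x
      using that level_eq_n_iff[OF tl] level_eq_n_iff[OF tl_one_tl] by (simp add: TL_trunc_simps(3))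
    show "std_idem n l \<in> carrier ?S" "level_of (std_idem n l) = l" if "l \<in> level_of ` carrier ?S" for l
      using Ecar[OF that] .
    show "std_idem n l' \<otimes>\<^bsub>?S\<^esub> std_idem n l = std_idem n l"
      if l: "l \<in> level_of ` carrier ?S" "l' \<in> level_of ` carrier ?S" "l \<le> l'" for l l'
    proof -
      have "(n - l') div 2 \<le> (n - l) div 2" using l(3) by (simp add: div_le_mono)
      then have "std ((n - l') div 2) \<subseteq> std ((n - l) div 2)" by (fastforce simp: std_def)
      moreover have "half n (std ((n - l) div 2))" "half n (std ((n - l') div 2))"
        using half_std[of "(n - l) div 2" n] half_std[of "(n - l') div 2" n] by auto
      ultimately show ?thesis
        unfolding TL_trunc_simps(2) std_idem_def using idem_diag_mult by blast
    qed
    fix a assume a: "a \<in> carrier ?S"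
    then have l: "level_of a \<in> level_of ` carrier ?S" by blast
    show "\<exists>x\<in>carrier ?S. \<exists>y\<in>carrier ?S. std_idem n (level_of a) = x \<otimes>\<^bsub>?S\<^esub> a \<otimes>\<^bsub>?S\<^esub> y"
      using conj[OF a Ecar(1)[OF l]] Ecar(2)[OF l] by (simp add: TL_trunc_simps(2))
    show "\<exists>x\<in>carrier ?S. \<exists>y\<in>carrier ?S. a = x \<otimes>\<^bsub>?S\<^esub> std_idem n (level_of a) \<otimes>\<^bsub>?S\<^esub> y"
      using conj[OF Ecar(1)[OF l] a] Ecar(2)[OF l] by (simp add: TL_trunc_simps(2))
  next
    fix l s assume l: "l \<in> level_of ` carrier ?S" and s: "s \<in> carrier ?S"
      and lev: "level_of (std_idem n l \<otimes>\<^bsub>?S\<^esub> s \<otimes>\<^bsub>?S\<^esub> std_idem n l) = l"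
    let ?e = "std_idem n l" and ?M = "std ((n - l) div 2)"
    define p where "p = tl_mult n (tl_mult n ?e s) ?e"
    note e = tl[OF Ecar(1)[OF l]] and st = tl[OF s]
    have es: "tl_mult n ?e s \<in> tl_diagrams n" by (rule tl_mult_closed[OF e st])
    have p: "p \<in> tl_diagrams n" unfolding p_def by (rule tl_mult_closed[OF es e])
    have lp: "level_of p = l" using lev by (simp add: p_def TL_trunc_simps(2))
    have h: "half n ?M" "card (free n ?M) = l" using l std_idem(1,2)[of l n] unfolding \<Lambda> by auto
    have se: "side Top ?e = ?M" "side Bottom ?e = ?M" using side_diag[OF h(1) h(1)] by (auto simp: std_idem_def)
    have "?M \<subseteq> side Top p" using side_mult(1)[OF e st] side_mult(1)[OF es e] se unfolding p_def by blast
    then have T: "?M = side Top p"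
      using half_subset_eq[OF h(1) half_side[OF p, of Top]] h(2) lp card_through_strands[OF p] by simp
    have "?M \<subseteq> side Bottom p" using side_mult(2)[OF es e] se unfolding p_def by blast
    then have "?M = side Bottom p"
      using half_subset_eq[OF h(1) half_side[OF p, of Bottom]] h(2) lp card_through_strands[OF p] card_free_sides[OF p]
      by simp
    then have "p = ?e" using tl_diagram_eq_diag[OF p] T by (simp add: std_idem_def)
    then show "?e \<otimes>\<^bsub>?S\<^esub> s \<otimes>\<^bsub>?S\<^esub> ?e = ?e" by (simp add: p_def TL_trunc_simps(2))
  qed
qed

text \<open>
Multiplying \<open>s = (T, B)\<close> by its flip \<open>(B, T)\<close> from the right gives the idempotent \<open>(T, T)\<close>, and
from the left \<open>(B, B)\<close>. So every nonunit is related to an idempotent, and idempotents of nested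
half diagrams are related since the one with more cups absorbs the other.
\<close>

lemma connected_cell_chain_TL_trunc:
  assumes n: "5 \<le> n" and k: "3 \<le> k" "k \<le> n" "even (n - k)"
  shows "connected_cell_chain (TL_trunc n k) level_of (std_idem n)"
proof -
  let ?S = "TL_trunc n k"
  interpret cell_chain ?S level_of "std_idem n" by (rule cell_chain_TL_trunc(1)[OF k(2,3)])
  note \<Lambda>_eq = cell_chain_TL_trunc(2)[OF k(2,3)]
  let ?I = "carrier ?S - {\<one>\<^bsub>?S\<^esub>}"
  have I: "s \<in> ?I \<longleftrightarrow> s \<in> tl_diagrams n \<and> s \<noteq> tl_one n \<and> level_of s \<le> k" for s
    using level_eq_n_iff[of s n] by (auto simp: TL_trunc_simps)
  have diagI: "diag n T B \<in> ?I"
    if "half n T" "half n B" "card (free n T) = card (free n B)" "card (free n T) \<le> k" "T \<noteq> {}" for T B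
  proof -
    have "card T \<noteq> 0" using that(5) finite_half[OF that(1)] by simp
    then have "level_of (diag n T B) \<noteq> n" using level_diag[OF that(1-3)] half_card[OF that(1)] by auto
    then have "diag n T B \<noteq> tl_one n" using level_eq_n_iff[OF diag_tl[OF that(1-3)]] by simp
    then show ?thesis unfolding I using diag_tl[OF that(1-3)] level_diag[OF that(1-3)] that(4) by simp
  qed
  have decomp: "\<exists>T B. half n T \<and> half n B \<and> card (free n T) = card (free n B) \<and> card (free n T) \<le> k
      \<and> T \<noteq> {} \<and> B \<noteq> {} \<and> s = diag n T B" if s: "s \<in> ?I" for s
  proof -
    have st: "s \<in> tl_diagrams n" "s \<noteq> tl_one n" "level_of s \<le> k" using s unfolding I by auto
    obtain T B where TB: "half n T" "half n B" "card (free n T) = card (free n B)" "s = diag n T B"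
      using tl_diagram_cases[OF st(1)] by metis
    have c: "card (free n T) \<le> k" "card (free n T) \<noteq> n"
      using level_diag[OF TB(1-3)] TB(4) st level_eq_n_iff[OF st(1)] by auto
    have "card (free n {}) = n" using half_card[OF half_empty, of n] by simp
    then have "T \<noteq> {}" "B \<noteq> {}" using c TB(3) by auto
    then show ?thesis using TB c by blast
  qed
  have flip: "s = tl_mult n (diag n T T) s \<and> diag n T T \<in> ?I \<and>
      diag n T T = tl_mult n s (diag n B T) \<and> diag n B T \<in> ?I \<and>
      diag n B B = tl_mult n (diag n B T) s \<and> diag n B B \<in> ?I"
    if "half n T" "half n B" "card (free n T) = card (free n B)" "card (free n T) \<le> k"
      "T \<noteq> {}" "B \<noteq> {}" "s = diag n T B" for s T B
    using that diagI by (auto simp: diag_mult)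
  have ev: "even (n + k)" using k by auto
  show ?thesis
  proof (unfold_locales)
    fix s assume s: "s \<in> ?I"
    obtain T B where TB: "half n T" "half n B" "card (free n T) = card (free n B)" "card (free n T) \<le> k"
      "T \<noteq> {}" "B \<noteq> {}" "s = diag n T B" using decomp[OF s] by (elim exE conjE)
    note f = flip[OF TB]
    have "s = diag n T T \<otimes>\<^bsub>?S\<^esub> s" unfolding TL_trunc_simps(2) by (rule conjunct1[OF f])
    then show "\<exists>x\<in>?I. \<exists>y\<in>?I. s = x \<otimes>\<^bsub>?S\<^esub> y" using f s by blast
  next
    fix R s t
    assume R: "equivp R" "\<And>s x. s \<in> ?I \<Longrightarrow> x \<in> ?I \<Longrightarrow> R s (s \<otimes>\<^bsub>?S\<^esub> x)" and s: "s \<in> ?I" and t: "t \<in> ?I"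
    note Rsym = equivp_symp[OF R(1)] and Rtrans = equivp_transp[OF R(1)]
    interpret half_connection n k "\<lambda>T T'. R (diag n T T) (diag n T' T')"
    proof
      show "R (diag n T T) (diag n T' T')"
        if "half n T" "half n T'" "T \<subseteq> T'" "T \<noteq> {}" "card (free n T) \<le> k" for T T'
      proof -
        have "card (free n T') \<le> k" using card_mono[OF finite_free free_subset[OF that(3)], of n] that(5) by simp
        then have "diag n T T \<in> ?I" "diag n T' T' \<in> ?I" using that diagI by auto
        from R(2)[OF this] show ?thesis using that by (simp add: TL_trunc_simps(2) idem_diag_mult)
      qed
    qed (use n k ev Rsym Rtrans in blast)+
    have red: "\<exists>T. half n T \<and> T \<noteq> {} \<and> card (free n T) \<le> k \<and> R s (diag n T T)" if s: "s \<in> ?I" for s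
    proof -
      obtain T B where TB: "half n T" "half n B" "card (free n T) = card (free n B)" "card (free n T) \<le> k"
        "T \<noteq> {}" "B \<noteq> {}" "s = diag n T B" using decomp[OF s] by (elim exE conjE)
      note f = flip[OF TB]
      have fI: "diag n B T \<in> ?I" using f by blast
      have "s \<otimes>\<^bsub>?S\<^esub> diag n B T = diag n T T" using f by (simp add: TL_trunc_simps(2))
      then have "R s (diag n T T)" using R(2)[OF s fI] by simp
      then show ?thesis using TB by (intro exI[of _ T]) auto
    qed
    obtain T where T: "half n T" "T \<noteq> {}" "card (free n T) \<le> k" "R s (diag n T T)" using red[OF s] by blast
    obtain T' where T': "half n T'" "T' \<noteq> {}" "card (free n T') \<le> k" "R t (diag n T' T')" using red[OF t] by blast
    show "R s t" by (rule Rtrans[OF T(4) Rtrans[OF connected[OF T(1-3) T'(1-3)] Rsym[OF T'(4)]]])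
  next
    fix R s t
    assume R: "equivp R" "\<And>s x. s \<in> ?I \<Longrightarrow> x \<in> ?I \<Longrightarrow> R s (x \<otimes>\<^bsub>?S\<^esub> s)" and s: "s \<in> ?I" and t: "t \<in> ?I"
    note Rsym = equivp_symp[OF R(1)] and Rtrans = equivp_transp[OF R(1)]
    interpret half_connection n k "\<lambda>T T'. R (diag n T T) (diag n T' T')"
    proof
      show "R (diag n T T) (diag n T' T')"
        if "half n T" "half n T'" "T \<subseteq> T'" "T \<noteq> {}" "card (free n T) \<le> k" for T T'
      proof -
        have "card (free n T') \<le> k" using card_mono[OF finite_free free_subset[OF that(3)], of n] that(5) by simp
        then have "diag n T T \<in> ?I" "diag n T' T' \<in> ?I" using that diagI by auto
        from R(2)[OF this] show ?thesis using that by (simp add: TL_trunc_simps(2) diag_idem_mult)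
      qed
    qed (use n k ev Rsym Rtrans in blast)+
    have red: "\<exists>T. half n T \<and> T \<noteq> {} \<and> card (free n T) \<le> k \<and> R s (diag n T T)" if s: "s \<in> ?I" for s
    proof -
      obtain T B where TB: "half n T" "half n B" "card (free n T) = card (free n B)" "card (free n T) \<le> k"
        "T \<noteq> {}" "B \<noteq> {}" "s = diag n T B" using decomp[OF s] by (elim exE conjE)
      note f = flip[OF TB]
      have fI: "diag n B T \<in> ?I" using f by blast
      have "diag n B T \<otimes>\<^bsub>?S\<^esub> s = diag n B B" using f by (simp add: TL_trunc_simps(2))
      then have "R s (diag n B B)" using R(2)[OF s fI] by simp
      then show ?thesis using TB by (intro exI[of _ B]) auto
    qed
    obtain T where T: "half n T" "T \<noteq> {}" "card (free n T) \<le> k" "R s (diag n T T)" using red[OF s] by blast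
    obtain T' where T': "half n T'" "T' \<noteq> {}" "card (free n T') \<le> k" "R t (diag n T' T')" using red[OF t] by blast
    show "R s t" by (rule Rtrans[OF T(4) Rtrans[OF connected[OF T(1-3) T'(1-3)] Rsym[OF T'(4)]]])
  next
    \<comment> \<open>the highest level besides that of the identity\<close>
    define l where "l = (if k = n then n - 2 else k)"
    have l: "3 \<le> l" "l < n" "l \<le> k" using n k unfolding l_def by (cases "k = n"; simp)+
    have "even (n - l)"
    proof (cases "k = n")
      case True
      then have "n - l = 2" using n by (simp add: l_def)
      then show ?thesis by (simp only: even_numeral)
    next
      case False
      then have "l = k" by (simp add: l_def)
      then show ?thesis using k(3) by (simp only:)
    qed
    then have l\<Lambda>: "l \<in> level_of ` carrier ?S" unfolding \<Lambda>_eq using l by simp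
    have "even (n - n mod 2)" "n mod 2 \<le> n" "n mod 2 \<le> k" using k(1) by presburger+
  then have "n mod 2 \<in> level_of ` carrier ?S" unfolding \<Lambda>_eq by blast
    then have "bottom_level \<le> n mod 2" by (rule bottom_le)
    moreover have "n mod 2 < (3::nat)" by simp
    ultimately have "l \<noteq> bottom_level" using l(1) by linarith
    moreover have "top_level = n" using level_eq_n_iff[OF tl_one_tl] by (simp add: top_level_def TL_trunc_simps(3))
    ultimately have "l \<notin> {bottom_level, top_level}" using l(2) by simp
    then have "l \<in> level_of ` carrier ?S - {bottom_level, top_level}" by (rule DiffI[OF l\<Lambda>])
    then show "level_of ` carrier ?S - {bottom_level, top_level} \<noteq> {}" by (metis empty_iff)
  qed
qed

lemma rep_gap_TL_trunc:
  assumes n: "5 \<le> n" and k: "3 \<le> k" "k \<le> n" "even (n - k)"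
  shows "rep_gap TYPE('k::field) (TL_trunc n k) =
    Min {simple_dim TYPE('k) (TL_trunc n k) (TL_J n l) | l. l \<le> k \<and> [l = n] (mod 2) \<and> l \<notin> {0, 1, n}}"
proof -
  let ?S = "TL_trunc n k"
  interpret connected_cell_chain ?S level_of "std_idem n"
    by (rule connected_cell_chain_TL_trunc[OF assms])
  note \<Lambda>_eq = cell_chain_TL_trunc(2)[OF k(2,3)]
  have top: "top_level = n" using level_eq_n_iff[OF tl_one_tl] by (simp add: top_level_def TL_trunc_simps(3))
  have "even (n - n mod 2)" "n mod 2 \<le> n" "n mod 2 \<le> k" using k(1) by presburger+
  then have "n mod 2 \<in> level_of ` carrier ?S" unfolding \<Lambda>_eq by blast
  then have "bottom_level \<le> n mod 2" by (rule bottom_le)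
  moreover have "bottom_level \<in> {l. l \<le> n \<and> even (n - l) \<and> (l \<le> k \<or> l = n)}" using bottom_in unfolding \<Lambda>_eq .
  ultimately have bottom: "bottom_level = n mod 2" using n by simp presburger
  have levels: "level_of ` carrier ?S - {bottom_level, top_level} = {l. l \<le> k \<and> [l = n] (mod 2) \<and> l \<notin> {0, 1, n}}"
    unfolding \<Lambda>_eq bottom top using k
    by (auto simp: cong_def mod2_eq_if even_diff_nat odd_pos split: if_splits)
  have "J l = TL_J n l" if "l \<le> k" for l using that by (auto simp: J_def TL_J_def TL_trunc_simps)
  then have "(\<lambda>l. simple_dim TYPE('k) ?S (J l)) ` {l. l \<le> k \<and> [l = n] (mod 2) \<and> l \<notin> {0, 1, n}}
    = {simple_dim TYPE('k) ?S (TL_J n l) | l. l \<le> k \<and> [l = n] (mod 2) \<and> l \<notin> {0, 1, n}}"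
    by auto
  then show ?thesis using rep_gap_eq_min_dim[where 'k = 'k] unfolding min_dim_def levels by simp
qed

theorem theorem4p5p1:
  fixes n :: nat
  assumes "n \<ge> 5"
  shows "rep_gap TYPE('k::field) (TL n) =
           Min {simple_dim TYPE('k) (TL n) (TL_J n l) | l.
                  l \<le> n \<and> [l = n] (mod 2) \<and> l \<notin> {0, 1, n}}
       \<and> (\<forall>k. 3 \<le> k \<and> k < n \<and> [k = n] (mod 2) \<longrightarrow>
            rep_gap TYPE('k) (TL_trunc n k) =
              Min {simple_dim TYPE('k) (TL_trunc n k) (TL_J n l) | l.
                     l \<le> n \<and> [l = n] (mod 2) \<and> l \<notin> {0, 1} \<union> {k + 1..n}})"
proof (intro conjI allI impI)
  show "rep_gap TYPE('k) (TL n) =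
           Min {simple_dim TYPE('k) (TL n) (TL_J n l) | l. l \<le> n \<and> [l = n] (mod 2) \<and> l \<notin> {0, 1, n}}"
    unfolding TL_eq_trunc using rep_gap_TL_trunc[of n n, where 'k = 'k] assms by simp
next
  fix k assume k: "3 \<le> k \<and> k < n \<and> [k = n] (mod 2)"
  then have ev: "even (n - k)" by (auto simp: cong_def mod2_eq_if even_diff_nat split: if_splits)
  have "l \<le> n \<and> [l = n] (mod 2) \<and> l \<notin> {0, 1} \<union> {k + 1..n} \<longleftrightarrow> l \<le> k \<and> [l = n] (mod 2) \<and> l \<notin> {0, 1, n}" for l
    using k by auto
  then show "rep_gap TYPE('k) (TL_trunc n k) =
      Min {simple_dim TYPE('k) (TL_trunc n k) (TL_J n l) | l.
             l \<le> n \<and> [l = n] (mod 2) \<and> l \<notin> {0, 1} \<union> {k + 1..n}}"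
    using rep_gap_TL_trunc[of n k, where 'k = 'k] assms k ev by simp
qed

end
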